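(* Let $\Gamma^t$, $t\in[0,T)$, be a smooth family of embedded closed plane (Jordan) curves evolving in the direction of the inner normal with the velocity $$\beta=k-\frac{L}{2A},$$ where $k$ is the curvature, $L=L^t$ the total length and $A=A^t$ the enclosed area of $\Gamma^t$. Then: (i) The flow is a gradient flow minimizing the isoperimetric ratio $\Pi=\dfrac{L^2}{4\pi A}$, in the sense that $\dfrac{d}{dt}\Pi<0$ at every time at which $\beta\not\equiv0$ on $\Gamma^t$. (ii) The flow preserves convexity: if $\Gamma^{t_0}$ is convex for some $t_0\in[0,T)$, then $\Gamma^t$ is convex for all $t\in[t_0,T)$. (iii) The enclosed area is increasing: $\dfrac{d}{dt}A^t\ge0$ for all $t\in[0,T)$. (iv) The total length is decreasing for convex curves: $\dfrac{d}{dt}L^t\le0$ at every time $t$ at which $\Gamma^t$ is convex.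
   Context: Curves are parameterized by smooth $\boldsymbol{x}(u,t)$, $u\in\mathbb{R}/\mathbb{Z}$, with $|\partial_u\boldsymbol{x}|>0$; $s$ is arc-length, $\boldsymbol{T}=\partial_s\boldsymbol{x}$ the unit tangent, $\boldsymbol{N}$ the unit inward normal with $\det(\boldsymbol{T},\boldsymbol{N})=1$, $k=\det(\partial_s\boldsymbol{x},\partial_s^2\boldsymbol{x})$ the signed curvature (positive for a circle). The evolution is $\partial_t\boldsymbol{x}=\beta\boldsymbol{N}+\alpha\boldsymbol{T}$, where $\alpha$ is a smooth tangential velocity, which does not affect the shape of the curves. A curve is called convex if its curvature satisfies $k>0$ everywhere. *)

theory Defs
  imports "HOL-Analysis.Analysis" "HOL-Library.Extended_Real"
begin

(* On sets where the derivative within S is not unique this notion is too weak; it is used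
   for S = UNIV and for products of UNIV with a nondegenerate interval, where smoothness at a
   boundary point means that all derivatives exist one-sidedly and are continuous up to the
   boundary. *)
primrec Ck_on ::
  "nat \<Rightarrow> 'a::euclidean_space set \<Rightarrow> ('a \<Rightarrow> 'b::real_normed_vector) \<Rightarrow> bool" where
  "Ck_on 0 S f \<longleftrightarrow> continuous_on S f"
| "Ck_on (Suc k) S f \<longleftrightarrow>
     (\<exists>f'. (\<forall>p\<in>S. (f has_derivative f' p) (at p within S)) \<and> (\<forall>v. Ck_on k S (\<lambda>p. f' p v)))"

definition smooth_on :: "'a::euclidean_space set \<Rightarrow> ('a \<Rightarrow> 'b::real_normed_vector) \<Rightarrow> bool" where
  "smooth_on S f \<longleftrightarrow> (\<forall>k. Ck_on k S f)"

(* The plane is identified with the complex numbers; a closed curve is a 1-periodic function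
   on the real line, i.e. a function on R/Z, and its restriction to [0,1] is a path. *)

definition det2 :: "complex \<Rightarrow> complex \<Rightarrow> real" where
  "det2 v w = Re v * Im w - Im v * Re w"

definition speed :: "(real \<Rightarrow> complex) \<Rightarrow> real \<Rightarrow> real" where
  "speed \<gamma> u = norm (vector_derivative \<gamma> (at u))"

definition arc_deriv :: "(real \<Rightarrow> complex) \<Rightarrow> (real \<Rightarrow> complex) \<Rightarrow> real \<Rightarrow> complex" where
  "arc_deriv \<gamma> f u = vector_derivative f (at u) /\<^sub>R speed \<gamma> u"

definition tangent :: "(real \<Rightarrow> complex) \<Rightarrow> real \<Rightarrow> complex" where
  "tangent \<gamma> = arc_deriv \<gamma> \<gamma>"

(* Multiplication by \<i> is the rotation by +90 degrees: the unit vector N orthogonal to T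
   with det (T, N) = 1. *)
definition unit_normal :: "(real \<Rightarrow> complex) \<Rightarrow> real \<Rightarrow> complex" where
  "unit_normal \<gamma> u = \<i> * tangent \<gamma> u"

definition curvature :: "(real \<Rightarrow> complex) \<Rightarrow> real \<Rightarrow> real" where
  "curvature \<gamma> u = det2 (arc_deriv \<gamma> \<gamma> u) (arc_deriv \<gamma> (arc_deriv \<gamma> \<gamma>) u)"

definition curve_length :: "(real \<Rightarrow> complex) \<Rightarrow> real" where
  "curve_length \<gamma> = integral {0..1} (speed \<gamma>)"

definition enclosed_area :: "(real \<Rightarrow> complex) \<Rightarrow> real" where
  "enclosed_area \<gamma> = measure lebesgue (inside (path_image \<gamma>))"

definition isoperimetric_ratio :: "(real \<Rightarrow> complex) \<Rightarrow> real" where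
  "isoperimetric_ratio \<gamma> = (curve_length \<gamma>)\<^sup>2 / (4 * pi * enclosed_area \<gamma>)"

definition convex_curve :: "(real \<Rightarrow> complex) \<Rightarrow> bool" where
  "convex_curve \<gamma> \<longleftrightarrow> (\<forall>u. curvature \<gamma> u > 0)"

(* simple_path on [0,1] together with periodicity is injectivity on R/Z; the last clause says
   that the normal points inwards, i.e. the curve is traversed counterclockwise. *)
definition embedded_closed_curve :: "(real \<Rightarrow> complex) \<Rightarrow> bool" where
  "embedded_closed_curve \<gamma> \<longleftrightarrow>
     smooth_on UNIV \<gamma> \<and> (\<forall>u. \<gamma> (u + 1) = \<gamma> u) \<and> (\<forall>u. vector_derivative \<gamma> (at u) \<noteq> 0) \<and>
     simple_path \<gamma> \<and>
     (\<forall>u. \<forall>\<^sub>F \<epsilon> in at_right 0. \<gamma> u + \<epsilon> *\<^sub>R unit_normal \<gamma> u \<in> inside (path_image \<gamma>))"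

definition flow_velocity :: "(real \<Rightarrow> complex) \<Rightarrow> real \<Rightarrow> real" where
  "flow_velocity \<gamma> u = curvature \<gamma> u - curve_length \<gamma> / (2 * enclosed_area \<gamma>)"

(* The interval [0,T), where T may be infinite. *)
definition time_interval :: "ereal \<Rightarrow> real set" where
  "time_interval T = {t. 0 \<le> t \<and> ereal t < T}"

end

theory Submission
  imports Defs "HOL-Complex_Analysis.Complex_Analysis"
begin

text \<open>
  Write \<open>\<sigma>\<close> for the speed, \<open>k\<close> for the curvature and \<open>\<beta> = k - L / (2 A)\<close>. Green's formula expresses \<open>A\<close> as a
  line integral, so that \<open>A' = - \<integral> \<beta> ds\<close> and \<open>L' = - \<integral> k \<beta> ds\<close>, and therefore
  \<open>L' - (L / (2 A)) A' = - \<integral> \<beta>\<^sup>2 ds\<close>, which is the sign of the derivative of the isoperimetric ratio. The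
  rotation index theorem \<open>\<integral> k ds = 2 \<pi>\<close> turns the other two derivatives into \<open>A' = L\<^sup>2 / (2 A) - 2 \<pi>\<close>, which is
  nonnegative by the isoperimetric inequality, and \<open>L' = \<pi> L / A - \<integral> k\<^sup>2 ds\<close>, which is nonpositive for convex
  curves by Gage's inequality. Convexity is preserved by the maximum principle for
  \<open>k\<^sub>t = k\<^sub>s\<^sub>s + \<alpha> k\<^sub>s + k\<^sup>2 \<beta>\<close>.
\<close>

section \<open>Regular curves\<close>

text \<open>The enclosed area is the measure of \<open>inside\<close>, and the orientation is known
  only through the direction of the normal. Both are tied to the tangent at a lowest point of the
  curve: there the tangent is horizontal, and the inward normal forces it to be 1 rather than -1.
  This fixes the sign of the winding number, hence of the line integral for the area, and of the
  rotation index. The isoperimetric inequality has to cover nonconvex curves; it comes from cutting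
  the curve into two arcs of equal length and a Wirtinger inequality on each. Gage's inequality is
  confined to convex curves, whose tangent angle is monotone, and rests on an explicit kernel on the
  circle of angles. The nonlocal term \<open>L / (2 A)\<close> does not disturb the maximum
  principle: it is constant along each curve and enters the curvature equation only through the
  coefficient \<open>k \<beta>\<close> of a zeroth order term, so boundedness on compact time
  intervals suffices. At time 0 all time derivatives are one-sided.\<close>

lemma smooth_on_real_has_vector_derivative:
  fixes f :: "real \<Rightarrow> 'b::real_normed_vector"
  assumes "smooth_on UNIV f"
  shows "(f has_vector_derivative vector_derivative f (at u)) (at u)"
proof -
  have "Ck_on (Suc 0) UNIV f" using assms unfolding smooth_on_def by blast
  then have "f differentiable (at u)" by (auto simp: differentiable_def)
  then show ?thesis by (simp add: vector_derivative_works)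
qed

lemma smooth_on_real_vector_derivative:
  fixes f :: "real \<Rightarrow> 'b::real_normed_vector"
  assumes "smooth_on UNIV f"
  shows "smooth_on UNIV (\<lambda>u. vector_derivative f (at u))"
  unfolding smooth_on_def
proof
  fix k
  have "Ck_on (Suc k) UNIV f" using assms unfolding smooth_on_def by blast
  then obtain f' where f': "\<And>p. (f has_derivative f' p) (at p)"
    and C: "\<And>v. Ck_on k UNIV (\<lambda>p. f' p v)" by auto
  have "vector_derivative f (at u) = f' u 1" for u
    using f'[of u] smooth_on_real_has_vector_derivative[OF assms, of u]
    unfolding has_vector_derivative_def
    by (metis has_derivative_unique scaleR_one)
  with C[of 1] show "Ck_on k UNIV (\<lambda>u. vector_derivative f (at u))" by simp
qed

lemma smooth_on_continuous_on: "smooth_on S f \<Longrightarrow> continuous_on S f"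
  unfolding smooth_on_def using Ck_on.simps(1) by blast

lemma has_vector_derivative_Re [derivative_intros]:
  assumes "(f has_vector_derivative f') (at x within S)"
  shows "((\<lambda>x. Re (f x)) has_real_derivative Re f') (at x within S)"
  using bounded_linear.has_vector_derivative[OF bounded_linear_Re assms]
  by (simp add: has_real_derivative_iff_has_vector_derivative)

lemma has_vector_derivative_Im [derivative_intros]:
  assumes "(f has_vector_derivative f') (at x within S)"
  shows "((\<lambda>x. Im (f x)) has_real_derivative Im f') (at x within S)"
  using bounded_linear.has_vector_derivative[OF bounded_linear_Im assms]
  by (simp add: has_real_derivative_iff_has_vector_derivative)

lemma has_vector_derivative_complex_mult:
  fixes f g :: "real \<Rightarrow> complex"
  assumes "(f has_vector_derivative f') (at x within S)" "(g has_vector_derivative g') (at x within S)"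
  shows "((\<lambda>x. f x * g x) has_vector_derivative f' * g x + f x * g') (at x within S)"
  using has_vector_derivative_mult[OF assms] by (simp add: add.commute)

lemma has_vector_derivative_cmod:
  fixes f :: "real \<Rightarrow> complex"
  assumes "(f has_vector_derivative f') (at x within S)" "f x \<noteq> 0"
  shows "((\<lambda>x. norm (f x)) has_real_derivative Re (cnj (f x) * f') / norm (f x)) (at x within S)"
proof -
  have "((\<lambda>x. norm (f x)) has_derivative (\<lambda>h. h *\<^sub>R f' \<bullet> sgn (f x))) (at x within S)"
    using has_derivative_compose[OF assms(1)[unfolded has_vector_derivative_def] has_derivative_norm[OF assms(2)]]
    by simp
  then show ?thesis
    unfolding has_field_derivative_def
    by (rule has_derivative_eq_rhs)
      (auto simp: fun_eq_iff inner_complex_def sgn_div_norm field_simps add_divide_distrib)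
qed

lemma has_vector_derivative_of_real_complex:
  assumes "(f has_real_derivative f') (at x within S)"
  shows "((\<lambda>x. complex_of_real (f x)) has_vector_derivative complex_of_real f') (at x within S)"
  using bounded_linear.has_vector_derivative[OF bounded_linear_of_real,
    OF assms[unfolded has_real_derivative_iff_has_vector_derivative]] .

locale regular_curve =
  fixes \<gamma> :: "real \<Rightarrow> complex"
  assumes smooth: "smooth_on UNIV \<gamma>"
    and periodic: "\<And>u. \<gamma> (u + 1) = \<gamma> u"
    and regular: "\<And>u. vector_derivative \<gamma> (at u) \<noteq> 0"
begin

definition "p u = vector_derivative \<gamma> (at u)"
definition "p' u = vector_derivative p (at u)"
definition "p'' u = vector_derivative p' (at u)"
abbreviation "\<sigma> \<equiv> speed \<gamma>"
abbreviation "k \<equiv> curvature \<gamma>"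
abbreviation "T \<equiv> tangent \<gamma>"

lemma smooth_p: "smooth_on UNIV p"
  using smooth_on_real_vector_derivative[OF smooth] by (simp add: p_def[abs_def])
lemma smooth_p': "smooth_on UNIV p'"
  using smooth_on_real_vector_derivative[OF smooth_p] by (simp add: p'_def[abs_def])
lemma smooth_p'': "smooth_on UNIV p''"
  using smooth_on_real_vector_derivative[OF smooth_p'] by (simp add: p''_def[abs_def])

lemma deriv_\<gamma>: "(\<gamma> has_vector_derivative p u) (at u within S)"
  using smooth_on_real_has_vector_derivative[OF smooth] has_vector_derivative_at_within
  unfolding p_def by blast
lemma deriv_p: "(p has_vector_derivative p' u) (at u within S)"
  using smooth_on_real_has_vector_derivative[OF smooth_p] has_vector_derivative_at_within
  unfolding p'_def by blast
lemma deriv_p': "(p' has_vector_derivative p'' u) (at u within S)"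
  using smooth_on_real_has_vector_derivative[OF smooth_p'] has_vector_derivative_at_within
  unfolding p''_def by blast

lemma cont_\<gamma>: "continuous_on S \<gamma>"
  using smooth_on_continuous_on[OF smooth] continuous_on_subset by blast
lemma cont_p: "continuous_on S p"
  using smooth_on_continuous_on[OF smooth_p] continuous_on_subset by blast
lemma cont_p': "continuous_on S p'"
  using smooth_on_continuous_on[OF smooth_p'] continuous_on_subset by blast

lemma p_nz [simp]: "p u \<noteq> 0" using regular by (simp add: p_def)
lemma speed_eq: "\<sigma> u = norm (p u)" by (simp add: speed_def p_def)
lemma speed_pos [simp]: "\<sigma> u > 0" by (simp add: speed_eq)
lemma speed_nz [simp]: "\<sigma> u \<noteq> 0" using speed_pos[of u] by linarith
lemma cont_speed: "continuous_on S \<sigma>"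
  unfolding speed_eq[abs_def] by (intro continuous_intros cont_p)

lemma tangent_eq: "T u = p u / \<sigma> u"
  by (simp add: tangent_def arc_deriv_def p_def scaleR_conv_of_real field_simps)
lemma p_eq: "p u = \<sigma> u * T u" by (simp add: tangent_eq)
lemma norm_tangent [simp]: "norm (T u) = 1"
  by (simp add: tangent_eq norm_divide speed_eq)
lemma tangent_cnj [simp]: "T u * cnj (T u) = 1" "cnj (T u) * T u = 1"
  by (metis complex_norm_square norm_tangent of_real_1 power_one mult.commute)+

lemma deriv_speed: "(\<sigma> has_real_derivative Re (cnj (p u) * p' u) / \<sigma> u) (at u within S)"
  unfolding speed_eq[abs_def] by (rule has_vector_derivative_cmod[OF deriv_p p_nz])

lemma deriv_tangent_aux: "(T has_vector_derivative
    (\<sigma> u * p' u - (Re (cnj (p u) * p' u) / \<sigma> u) * p u) / (\<sigma> u)\<^sup>2) (at u within S)"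
proof -
  have 1: "((\<lambda>u. inverse (\<sigma> u)) has_real_derivative - (Re (cnj (p u) * p' u) / \<sigma> u) / (\<sigma> u)\<^sup>2) (at u within S)"
    using DERIV_inverse_fun[OF deriv_speed[of u S]] by (simp add: field_simps power2_eq_square)
  show ?thesis unfolding tangent_eq[abs_def] divide_inverse of_real_inverse[symmetric]
    by (rule has_vector_derivative_eq_rhs[OF has_vector_derivative_complex_mult[OF deriv_p has_vector_derivative_of_real_complex[OF 1]]])
     (simp add: field_simps power2_eq_square)
qed

lemma curvature_eq: "k u = Im (cnj (p u) * p' u) / \<sigma> u ^ 3"
proof -
  have "arc_deriv \<gamma> (arc_deriv \<gamma> \<gamma>) u = vector_derivative T (at u) /\<^sub>R \<sigma> u"
    by (simp add: arc_deriv_def tangent_def)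
  also have "vector_derivative T (at u) = (\<sigma> u * p' u - (Re (cnj (p u) * p' u) / \<sigma> u) * p u) / (\<sigma> u)\<^sup>2"
    by (rule vector_derivative_at[OF deriv_tangent_aux])
  finally show ?thesis
    unfolding curvature_def tangent_def[symmetric] det2_def tangent_eq
    by (simp add: field_simps power2_eq_square power3_eq_cube Re_divide_of_real Im_divide_of_real)
qed

lemma Im_p: "Im (cnj (p u) * p' u) = k u * \<sigma> u ^ 3"
  by (simp add: curvature_eq)

text \<open>Multiplication by \<open>cnj (T u)\<close> rotates the tangent to the real axis, so real
  and imaginary part of \<open>cnj (p u) * p' u\<close> are, up to a factor \<sigma>, the tangential
  and the normal component of \<open>p'\<close>. The tangential one is the derivative of the
  speed.\<close>

lemma p'_eq: "p' u = (Re (cnj (p u) * p' u) / \<sigma> u + \<i> * k u * (\<sigma> u)\<^sup>2) * T u"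
proof -
  have "cnj (p u) * p' u = Re (cnj (p u) * p' u) + \<i> * (k u * \<sigma> u ^ 3)"
    using Im_p[of u] by (metis complex_eq)
  then have *: "\<sigma> u * (cnj (T u) * p' u) * T u = (Re (cnj (p u) * p' u) + \<i> * (k u * \<sigma> u ^ 3)) * T u"
    by (simp add: p_eq mult.assoc)
  have "\<sigma> u * p' u = (Re (cnj (p u) * p' u) + \<i> * (k u * \<sigma> u ^ 3)) * T u"
  proof -
    have "\<sigma> u * (cnj (T u) * p' u) * T u = \<sigma> u * p' u * (cnj (T u) * T u)"
      by (simp only: mult_ac)
    with * show ?thesis by simp
  qed
  then show ?thesis by (simp add: field_simps power2_eq_square power3_eq_cube)
qed

text \<open>The Frenet equation in an arbitrary parameter: a unit vector can only rotate, and it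
  does so at the rate \<sigma> k per unit of \<open>u\<close>.\<close>

lemma deriv_tangent: "(T has_vector_derivative \<i> * (\<sigma> u * k u) * T u) (at u within S)"
proof -
  have "(\<sigma> u * p' u - (Re (cnj (p u) * p' u) / \<sigma> u) * p u) / (\<sigma> u)\<^sup>2 = \<i> * (\<sigma> u * k u) * T u"
    by (subst (1) p'_eq, subst p_eq) (simp add: field_simps power2_eq_square)
  then show ?thesis using deriv_tangent_aux[of u S] by simp
qed

lemma cont_curvature: "continuous_on S k"
  unfolding curvature_eq[abs_def] by (intro continuous_intros cont_p cont_p' cont_speed) auto

text \<open>The maximum principle uses the second derivative of \<open>k\<close> only through its
  sign at a minimum, so existence suffices and no formula is exported.\<close>

lemma curvature_twice_differentiable:
  obtains k1 k2 where "\<And>u. (k has_real_derivative k1 u) (at u)" "\<And>u. (k1 has_real_derivative k2 u) (at u)"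
proof -
  define m where "m u = Im (cnj (p u) * p' u)" for u
  define n where "n u = Re (cnj (p u) * p' u)" for u
  define m1 where "m1 u = Im (cnj (p u) * p'' u)" for u
  have dc: "((\<lambda>u. cnj (p u)) has_vector_derivative cnj (p' u)) (at u)" for u
    using bounded_linear.has_vector_derivative[OF bounded_linear_cnj deriv_p] .
  have m: "(m has_real_derivative m1 u) (at u)" for u
    unfolding m_def[abs_def] m1_def
    by (rule DERIV_cong[OF has_vector_derivative_Im[OF has_vector_derivative_complex_mult[OF dc deriv_p']]])
      (simp add: algebra_simps)
  have "\<exists>d. (n has_real_derivative d) (at u)" for u
    unfolding n_def[abs_def]
    using has_vector_derivative_Re[OF has_vector_derivative_complex_mult[OF dc deriv_p']] by blast
  then obtain n1 where n: "\<And>u. (n has_real_derivative n1 u) (at u)" by metis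
  have d3: "(p'' has_vector_derivative vector_derivative p'' (at u)) (at u)" for u
    using smooth_on_real_has_vector_derivative[OF smooth_p''] .
  have "\<exists>d. (m1 has_real_derivative d) (at u)" for u
    unfolding m1_def[abs_def]
    using has_vector_derivative_Im[OF has_vector_derivative_complex_mult[OF dc d3]] by blast
  then obtain m2 where m1: "\<And>u. (m1 has_real_derivative m2 u) (at u)" by metis
  define k1 where "k1 u = (m1 u * \<sigma> u ^ 3 - m u * (3 * \<sigma> u ^ 2 * (n u / \<sigma> u))) / (\<sigma> u ^ 3 * \<sigma> u ^ 3)" for u
  have s: "(\<sigma> has_real_derivative n u / \<sigma> u) (at u)" for u
    using deriv_speed by (simp add: n_def)
  have "(k has_real_derivative k1 u) (at u)" for u
    unfolding curvature_eq[abs_def] m_def[symmetric] k1_def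
    by (rule derivative_eq_intros m s | simp)+
  moreover have "\<exists>d. (k1 has_real_derivative d) (at u)" for u
    unfolding k1_def[abs_def]
    by (rule exI, (rule derivative_intros m s n m1 | simp)+)
  ultimately show ?thesis using that by metis
qed

lemma periodic_deriv:
  fixes f :: "real \<Rightarrow> 'b::real_normed_vector"
  assumes "\<And>u. f (u + 1) = f u"
  shows "vector_derivative f (at (u + 1)) = vector_derivative f (at u)"
proof -
  have "(f has_vector_derivative d) (at (v + c))" if "(f has_vector_derivative d) (at v)"
    "f \<circ> (\<lambda>x. x - c) = f" for d v c
  proof -
    have "((\<lambda>x. x - c) has_vector_derivative 1) (at (v + c))"
      by (auto intro!: derivative_eq_intros)
    from vector_diff_chain_at[OF this, of f d] show ?thesis using that by simp
  qed
  moreover have "f \<circ> (\<lambda>x. x - 1) = f" "f \<circ> (\<lambda>x. x - (-1)) = f"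
    using assms[of "_ - 1"] assms by (auto simp: fun_eq_iff)
  \<comment> \<open>\<open>f\<close> may fail to be differentiable: both points have the same set of
    derivatives, so the choice made by \<open>vector_derivative\<close> agrees as well.\<close>
  ultimately have "(f has_vector_derivative d) (at (u + 1)) \<longleftrightarrow> (f has_vector_derivative d) (at u)" for d
    by (metis add_diff_cancel_right' diff_conv_add_uminus)
  then show ?thesis by (simp add: vector_derivative_def)
qed

end

section \<open>The rotation index\<close>

lemma antiderivative_on_UNIV:
  fixes f :: "real \<Rightarrow> 'a::euclidean_space"
  assumes "continuous_on UNIV f"
  obtains F where "\<And>u. (F has_vector_derivative f u) (at u)"
proof -
  have "\<exists>F. \<forall>x::real. (-\<infinity>::ereal) < x \<longrightarrow> x < (\<infinity>::ereal) \<longrightarrow> (F has_vector_derivative f x) (at x)"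
    by (rule einterval_antiderivative) (use assms in \<open>auto simp: continuous_on_eq_continuous_at\<close>)
  then show ?thesis using that by auto
qed

text \<open>The values of \<open>h\<close> lie in the discrete set of multiples of
  \<open>2 * pi\<close>. Passing from one to another would cross an odd multiple of
  \<open>pi\<close>, where the cosine is -1.\<close>

lemma continuous_cos_1_constant:
  fixes h :: "real \<Rightarrow> real"
  assumes "continuous_on {a..b} h" "\<And>x. x \<in> {a..b} \<Longrightarrow> cos (h x) = 1" "a \<le> b"
  shows "h b = h a"
proof (rule ccontr)
  assume ne: "h b \<noteq> h a"
  define y where "y = (if h a < h b then h a + min pi (h b - h a) else h a - min pi (h a - h b))"
  have "connected (h ` {a..b})" by (intro connected_continuous_image assms) auto
  then have iv: "{min (h a) (h b)..max (h a) (h b)} \<subseteq> h ` {a..b}"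
    using assms(3) by (auto simp: connected_contains_Icc min_def max_def)
  obtain m n where mn: "h a = of_int m * 2 * pi" "h b = of_int n * 2 * pi"
    using assms(2)[of a] assms(2)[of b] assms(3) by (auto simp: cos_one_2pi_int)
  have "\<exists>c\<in>{min (h a) (h b)..max (h a) (h b)}. cos c = -1"
  proof (cases "h a < h b")
    case True
    then have "m + 1 \<le> n" using mn by simp
    then have "real_of_int (m + 1) \<le> real_of_int n" by (simp only: of_int_le_iff)
    from mult_right_mono[OF this, of "2 * pi"] have "h a + 2 * pi \<le> h b"
      using mn by (simp add: distrib_right)
    then have "h a + pi \<le> h b" using pi_gt_zero by linarith
    moreover have "cos (h a + pi) = -1" using assms(2)[of a] assms(3) by simp
    ultimately show ?thesis by (intro bexI[of _ "h a + pi"]) (auto simp: min_le_iff_disj le_max_iff_disj)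
  next
    case False
    then have "n + 1 \<le> m" using mn ne by auto
    then have "real_of_int (n + 1) \<le> real_of_int m" by (simp only: of_int_le_iff)
    from mult_right_mono[OF this, of "2 * pi"] have "h b + 2 * pi \<le> h a"
      using mn by (simp add: distrib_right)
    then have "h b + pi \<le> h a" using pi_gt_zero by linarith
    moreover have "cos (h b + pi) = -1" using assms(2)[of b] assms(3) by simp
    ultimately show ?thesis by (intro bexI[of _ "h b + pi"]) (auto simp: min_le_iff_disj le_max_iff_disj)
  qed
  then show False using iv assms(2) by force
qed

text \<open>Shifted to start at 0, the angle never meets \<open>- pi / 2\<close> or
  \<open>3 * pi / 2\<close>, where the sine is -1. It is trapped between them, and the only angle
  there with cosine -1 is \<open>pi\<close>.\<close>

lemma half_turn:
  fixes h :: "real \<Rightarrow> real"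
  assumes "continuous_on {a..b} h" "\<And>x. x \<in> {a..b} \<Longrightarrow> sin (h x) \<ge> 0" "a \<le> b"
    and "cos (h a) = 1" "cos (h b) = -1"
  shows "h b - h a = pi"
proof -
  obtain m where m: "h a = of_int m * 2 * pi" using assms(4) by (auto simp: cos_one_2pi_int)
  define f where "f x = h x - h a" for x
  have sf: "sin (f x) = sin (h x)" "cos (f x) = cos (h x)" for x
  proof -
    have "f x = h x - (2 * pi) * of_int m" by (simp add: f_def m)
    then show "sin (f x) = sin (h x)" "cos (f x) = cos (h x)"
      by (simp_all add: sin_diff cos_diff del: mult.assoc)
  qed
  have cf: "continuous_on {a..b} f" unfolding f_def[abs_def] by (intro continuous_intros assms)
  have conn: "connected (f ` {a..b})" by (intro connected_continuous_image cf) auto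
  have s1: "sin (3 * pi / 2) = -1" "sin (- pi / 2) = -1"
    using sin_periodic_pi[of "pi/2"] sin_minus[of "pi/2"] by (simp_all add: field_simps)
  have "c \<notin> f ` {a..b}" if "sin c = -1" for c
  proof
    assume "c \<in> f ` {a..b}"
    then obtain x where "x \<in> {a..b}" "f x = c" by blast
    with assms(2)[of x] sf(1)[of x] that show False by simp
  qed
  note avoid = this[OF s1(1)] this[OF s1(2)]
  have ends: "f b \<in> f ` {a..b}" "0 \<in> f ` {a..b}"
    using assms(3) by (auto simp: f_def image_iff intro: bexI[of _ a])
  have sub: "{0..f b} \<subseteq> f ` {a..b}" "{f b..0} \<subseteq> f ` {a..b}"
    using connected_contains_Icc[OF conn] ends by blast+
  have "3 * pi / 2 \<notin> {0..f b}" "- pi / 2 \<notin> {f b..0}" using sub avoid by blast+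
  then have bd: "f b < 3 * pi / 2" "- pi / 2 < f b" by simp_all
  have "cos (f b - pi) = 1" using assms(5) sf by simp
  then obtain n where n: "f b - pi = of_int n * 2 * pi" using cos_one_2pi_int by blast
  have "\<bar>of_int n * 2 * pi\<bar> < 2 * pi" unfolding n[symmetric] using bd pi_gt_zero by linarith
  then have "\<bar>real_of_int n\<bar> < 1" by (simp add: abs_mult)
  then have "n = 0" by linarith
  then show ?thesis using n by (simp add: f_def)
qed

locale jordan_curve =
  fixes \<gamma> :: "real \<Rightarrow> complex"
  assumes embedded: "embedded_closed_curve \<gamma>"

sublocale jordan_curve \<subseteq> regular_curve \<gamma>
  using embedded unfolding embedded_closed_curve_def by unfold_locales auto

context regular_curve
begin

lemma p_periodic [simp]: "p (u + 1) = p u"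
  unfolding p_def by (rule periodic_deriv[of \<gamma>, OF periodic])
lemma p'_periodic [simp]: "p' (u + 1) = p' u"
  unfolding p'_def by (rule periodic_deriv[of p, OF p_periodic])
lemma speed_periodic [simp]: "\<sigma> (u + 1) = \<sigma> u" by (simp add: speed_eq)
lemma tangent_periodic [simp]: "T (u + 1) = T u" by (simp add: tangent_eq)
lemma curvature_periodic [simp]: "k (u + 1) = k u" by (simp add: curvature_eq)

lemma curvature_frac: "k (frac u) = k u"
proof -
  have "k (v + of_int n) = k v" for v n
  proof (induction n rule: int_induct[of _ 0])
    case (step1 i)
    then show ?case using curvature_periodic[of "v + of_int i"] by (simp add: add.assoc)
  next
    case (step2 i)
    then show ?case using curvature_periodic[of "v + of_int (i - 1)"] by simp
  qed simp
  from this[of "frac u" "\<lfloor>u\<rfloor>"] show ?thesis by (simp add: frac_def)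
qed

text \<open>The lift is built from the curvature and not from a covering argument: if
  \<open>F\<close> is an antiderivative of \<sigma> k, then \<open>T * cis (- F)\<close> has
  derivative 0 by the Frenet equation.\<close>

lemma angle_exists:
  obtains \<theta> where "\<And>u. (\<theta> has_real_derivative \<sigma> u * k u) (at u)" "\<And>u. T u = cis (\<theta> u)"
proof -
  have "continuous_on UNIV (\<lambda>u. \<sigma> u * k u)" by (intro continuous_intros cont_speed cont_curvature)
  then obtain F where F: "\<And>u. (F has_real_derivative \<sigma> u * k u) (at u)"
    using antiderivative_on_UNIV unfolding has_real_derivative_iff_has_vector_derivative by blast
  have dc: "((\<lambda>u. cis (- F u)) has_vector_derivative - (\<i> * (\<sigma> u * k u)) * cis (- F u)) (at u)" for u
    using F[of u]
    by (auto intro!: derivative_eq_intros simp: has_vector_derivative_def has_field_derivative_def  fun_eq_iff scaleR_conv_of_real algebra_simps)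
  have "((\<lambda>u. T u * cis (- F u)) has_vector_derivative 0) (at u)" for u
    by (rule has_vector_derivative_eq_rhs[OF has_vector_derivative_complex_mult[OF deriv_tangent dc]])
      (simp add: algebra_simps)
  then obtain c where c: "\<And>u. T u * cis (- F u) = c"
    using has_vector_derivative_zero_constant[of UNIV "\<lambda>u. T u * cis (- F u)"] by auto
  have "norm c = 1" using c[of 0] by (metis norm_mult norm_tangent norm_cis mult_1)
  then obtain b where b: "c = cis b" by (metis rcis_cmod_Arg rcis_def mult_1 of_real_1)
  show ?thesis
  proof (rule that[of "\<lambda>u. b + F u"])
    show "((\<lambda>u. b + F u) has_real_derivative \<sigma> u * k u) (at u)" for u
      using F[of u] by (auto intro!: derivative_eq_intros)
    fix u
    have "T u = T u * cis (- F u) * cis (F u)" by (simp add: mult.assoc cis_mult)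
    then show "T u = cis (b + F u)" by (simp add: c b cis_mult)
  qed
qed

text \<open>The difference quotient of \<gamma>, written as the mean of its derivative over the
  segment from \<open>u\<close> to \<open>v\<close>. In this form it is continuous across the
  diagonal without a case distinction.\<close>

definition secant :: "real \<times> real \<Rightarrow> complex" where
  "secant z = integral (cbox 0 1) (\<lambda>\<tau>. p (fst z + \<tau> * (snd z - fst z)))"

lemma secant_mult: "complex_of_real (v - u) * secant (u, v) = \<gamma> v - \<gamma> u"
proof -
  have "((\<lambda>\<tau>. \<gamma> (u + \<tau> * (v - u))) has_vector_derivative complex_of_real (v - u) * p (u + \<tau> * (v - u))) (at \<tau> within {0..1})" for \<tau>
  proof -
    have "((\<lambda>\<tau>. u + \<tau> * (v - u)) has_vector_derivative (v - u)) (at \<tau> within {0..1})"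
      by (auto intro!: derivative_eq_intros)
    from vector_diff_chain_within[OF this deriv_\<gamma>] show ?thesis
      by (simp add: o_def scaleR_conv_of_real)
  qed
  then have "((\<lambda>\<tau>. complex_of_real (v - u) * p (u + \<tau> * (v - u))) has_integral (\<gamma> v - \<gamma> u)) {0..1}"
    using fundamental_theorem_of_calculus[of 0 1 "\<lambda>\<tau>. \<gamma> (u + \<tau> * (v - u))" "\<lambda>\<tau>. complex_of_real (v - u) * p (u + \<tau> * (v - u))"]
    by simp
  then have "integral {0..1} (\<lambda>\<tau>. complex_of_real (v - u) * p (u + \<tau> * (v - u))) = \<gamma> v - \<gamma> u"
    by (rule integral_unique)
  then show ?thesis unfolding secant_def by simp
qed

lemma secant_diag [simp]: "secant (u, u) = p u" by (simp add: secant_def)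

lemma cont_secant: "continuous_on UNIV secant"
  unfolding secant_def[abs_def]
proof (rule integral_continuous_on_param)
  show "continuous_on (UNIV \<times> cbox 0 1) (\<lambda>(z, \<tau>). p (fst z + \<tau> * (snd z - fst z)))"
    unfolding split_beta by (rule continuous_on_compose2[OF cont_p[of UNIV]]) (auto intro!: continuous_intros)
qed

text \<open>\<open>chord (u, v) = (\<gamma> v - \<gamma> u) / ((v - u) (1 - (v - u)))\<close> for \<open>0 < v - u < 1\<close>, written so that it visibly
  extends continuously to \<open>v - u = 0\<close>, where it is \<open>p u\<close>, and \<open>v - u = 1\<close>, where it is \<open>- p u\<close>.\<close>
definition chord :: "real \<times> real \<Rightarrow> complex" where
  "chord z = secant z - secant (fst z, snd z - 1)"

lemma cont_chord: "continuous_on S chord"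
proof -
  have "continuous_on UNIV (\<lambda>z::real\<times>real. secant (fst z, snd z - 1))"
    by (rule continuous_on_compose2[OF cont_secant]) (auto intro!: continuous_intros)
  then have "continuous_on UNIV chord"
    unfolding chord_def[abs_def] by (intro continuous_intros cont_secant)
  then show ?thesis using continuous_on_subset by blast
qed

text \<open>Partial fractions: \<open>1 / (s (1 - s)) = 1 / s + 1 / (1 - s)\<close> for
  \<open>s = v - u\<close>. By periodicity the second summand is a secant as well, ending at
  \<open>v - 1\<close>.\<close>

lemma chord_mult: "complex_of_real ((v - u) * (1 - (v - u))) * chord (u, v) = \<gamma> v - \<gamma> u"
proof -
  have 1: "complex_of_real (v - u) * secant (u, v) = \<gamma> v - \<gamma> u" by (rule secant_mult)
  have 2: "complex_of_real (v - 1 - u) * secant (u, v - 1) = \<gamma> v - \<gamma> u"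
    using secant_mult[of "v - 1" u] periodic[of "v - 1"] by simp
  have "complex_of_real ((v - u) * (1 - (v - u))) * chord (u, v) =
     complex_of_real (1 - (v - u)) * (complex_of_real (v - u) * secant (u, v))
      + complex_of_real (v - u) * (complex_of_real (v - 1 - u) * secant (u, v - 1))"
    by (simp add: chord_def algebra_simps)
  then show ?thesis by (simp only: 1 2) (simp add: algebra_simps)
qed

lemma chord_diag: "chord (u, u) = p u"
  using secant_mult[of "u - 1" u] periodic[of "u - 1"] by (simp add: chord_def)
lemma chord_diag1: "chord (u, u + 1) = - p u"
  using secant_mult[of "u + 1" u] periodic[of "u"] by (simp add: chord_def)

end

context jordan_curve
begin

lemma simple: "simple_path \<gamma>" using embedded unfolding embedded_closed_curve_def by auto

lemma inward: "\<forall>\<^sub>F \<epsilon> in at_right 0. \<gamma> u + \<epsilon> *\<^sub>R unit_normal \<gamma> u \<in> inside (path_image \<gamma>)"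
  using embedded unfolding embedded_closed_curve_def by auto

lemma periodic_int: "\<gamma> (u + of_int n) = \<gamma> u"
proof (induction n rule: int_induct[of _ 0])
  case (step1 i)
  then show ?case using periodic[of "u + of_int i"] by (simp add: add.assoc)
next
  case (step2 i)
  then show ?case using periodic[of "u + of_int (i - 1)"] by simp
qed simp

lemma eq_frac: "\<gamma> u = \<gamma> (frac u)"
  using periodic_int[of "frac u" "\<lfloor>u\<rfloor>"] by (simp add: frac_def)

lemma range_eq: "range \<gamma> = path_image \<gamma>"
proof -
  have "\<gamma> u \<in> \<gamma> ` {0..1}" for u
    unfolding eq_frac[of u] using frac_lt_1[of u] frac_ge_0[of u] by (intro imageI) simp
  then show ?thesis unfolding path_image_def by auto
qed

lemma inj_mod: "\<gamma> u = \<gamma> v \<longleftrightarrow> u - v \<in> \<int>"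
proof
  assume "\<gamma> u = \<gamma> v"
  then have "\<gamma> (frac u) = \<gamma> (frac v)" using eq_frac by metis
  \<comment> \<open>A simple path may identify the parameters 0 and 1; \<open>frac\<close> takes
    values in the half-open period, where this exception cannot occur.\<close>
  then have "frac u = frac v"
    using simple frac_lt_1[of u] frac_lt_1[of v] frac_ge_0[of u] frac_ge_0[of v]
    unfolding simple_path_def loop_free_def
    by (metis atLeastAtMost_iff less_imp_le less_irrefl)
  then have "u - v = of_int (\<lfloor>u\<rfloor> - \<lfloor>v\<rfloor>)" by (simp add: frac_def)
  then show "u - v \<in> \<int>" by simp
next
  assume "u - v \<in> \<int>"
  then obtain n where "u = v + of_int n" by (metis Ints_cases add.commute diff_add_cancel)
  then show "\<gamma> u = \<gamma> v" by (simp add: periodic_int)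
qed

lemma inj_lt: assumes "u < v" "v < u + 1" shows "\<gamma> u \<noteq> \<gamma> v"
proof
  assume "\<gamma> u = \<gamma> v"
  then obtain n where "u - v = of_int n" by (metis inj_mod Ints_cases)
  with assms have "real_of_int n < real_of_int 0" "real_of_int (- 1) < real_of_int n" by simp_all
  then have "n < 0" "- 1 < n" by (simp_all only: of_int_less_iff)
  then show False by linarith
qed

lemma chord_nz: assumes "u \<le> v" "v \<le> u + 1" shows "chord (u, v) \<noteq> 0"
proof -
  consider "v = u" | "v = u + 1" | "u < v" "v < u + 1" using assms by linarith
  then show ?thesis
  proof cases
    case 3
    then show ?thesis using chord_mult[of v u] inj_lt[OF 3] by auto
  qed (auto simp: chord_diag chord_diag1)
qed

lemma bounded_range: "bounded (path_image \<gamma>)"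
  using simple simple_path_imp_path bounded_path_image by blast

lemma below_lowest_outside:
  assumes "\<And>u. Im (\<gamma> a) \<le> Im (\<gamma> u)" "Im z < Im (\<gamma> a)"
  shows "z \<in> outside (path_image \<gamma>)"
proof -
  have "path_image \<gamma> \<subseteq> {z. Im z \<ge> Im (\<gamma> a)}"
    unfolding range_eq[symmetric] using assms(1) by auto
  then have "- {z. Im z \<ge> Im (\<gamma> a)} \<subseteq> outside (path_image \<gamma>)"
    by (intro outside_subset_convex convex_halfspace_Im_ge)
  then show ?thesis using assms(2) by auto
qed

text \<open>The place where the orientation is decided. The tangent at a lowest point is 1 or -1; in
  the second case the normal would point straight down, into a half plane that lies outside the
  curve.\<close>

lemma lowest_point:
  obtains a where "\<And>u. Im (\<gamma> a) \<le> Im (\<gamma> u)" "T a = 1"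
proof -
  have "continuous_on (path_image \<gamma>) Im" by (intro continuous_intros)
  then obtain z where z: "z \<in> path_image \<gamma>" "\<And>w. w \<in> path_image \<gamma> \<Longrightarrow> Im z \<le> Im w"
    using continuous_attains_inf[OF compact_path_image[OF simple_path_imp_path[OF simple]]
      path_image_nonempty, of Im] by blast
  then obtain a where a: "\<And>u. Im (\<gamma> a) \<le> Im (\<gamma> u)"
    unfolding range_eq[symmetric] by blast
  have d: "((\<lambda>u. Im (\<gamma> u)) has_real_derivative Im (p a)) (at a)"
    by (rule has_vector_derivative_Im[OF deriv_\<gamma>])
  have "Im (p a) = 0"
    by (rule DERIV_local_min[OF d, of 1]) (auto intro: a)
  then have im: "Im (T a) = 0" by (simp add: tangent_eq Im_divide_of_real)
  then have "\<bar>Re (T a)\<bar> = 1" using norm_tangent[of a] by (simp add: cmod_def)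
  then have "T a = 1 \<or> T a = -1" using im by (auto simp: complex_eq_iff abs_if split: if_splits)
  moreover have "T a \<noteq> -1"
  proof
    assume "T a = -1"
    then have N: "unit_normal \<gamma> a = -\<i>" by (simp add: unit_normal_def)
    have "\<forall>\<^sub>F \<epsilon> in at_right 0. \<gamma> a + \<epsilon> *\<^sub>R unit_normal \<gamma> a \<in> inside (path_image \<gamma>) \<and> \<epsilon> > 0"
      using inward[of a] eventually_at_right_less[of 0] by (rule eventually_conj)
    then obtain \<epsilon> where e: "\<gamma> a + \<epsilon> *\<^sub>R (-\<i>) \<in> inside (path_image \<gamma>)" "\<epsilon> > 0"
      using eventually_happens'[of "at_right (0::real)"] N by (auto simp: trivial_limit_at_right_real)
    have "\<gamma> a + \<epsilon> *\<^sub>R (-\<i>) \<in> outside (path_image \<gamma>)"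
      by (rule below_lowest_outside[OF a]) (use e(2) in simp)
    then show False using e(1) inside_Int_outside[of "path_image \<gamma>"] by blast
  qed
  ultimately show ?thesis using that a by blast
qed

text \<open>Hopf's argument: a continuous logarithm of the chord on the triangle \<open>a \<le> u \<le> v \<le> a + 1\<close> compares
  the turning of the tangent along the diagonal with the turning along the two other sides. If \<open>\<gamma> a\<close> is
  a lowest point, the chord stays in a closed half plane on each of them and makes a half turn.\<close>
lemma rotation_index:
  assumes \<theta>: "\<And>u. (\<theta> has_real_derivative \<sigma> u * k u) (at u)" "\<And>u. T u = cis (\<theta> u)"
  shows "\<theta> (u + 1) = \<theta> u + 2 * pi"
proof -
  obtain a where a: "\<And>u. Im (\<gamma> a) \<le> Im (\<gamma> u)" "T a = 1" using lowest_point by blast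
  define \<Delta> where "\<Delta> = {z::real\<times>real. a \<le> fst z \<and> fst z \<le> snd z \<and> snd z \<le> a + 1}"
  have "convex \<Delta>"
  proof (rule convexI)
    fix x y :: "real \<times> real" and r s :: real
    assume *: "x \<in> \<Delta>" "y \<in> \<Delta>" "0 \<le> r" "0 \<le> s" "r + s = 1"
    have "r * a + s * a \<le> r * fst x + s * fst y" "r * fst x + s * fst y \<le> r * snd x + s * snd y"
      "r * snd x + s * snd y \<le> r * (a + 1) + s * (a + 1)"
      using * by (auto intro!: add_mono mult_left_mono simp: \<Delta>_def)
    moreover have "r * a + s * a = a" "r * (a + 1) + s * (a + 1) = a + 1"
      using *(5) by (metis distrib_right mult_1)+
    ultimately show "r *\<^sub>R x + s *\<^sub>R y \<in> \<Delta>" by (simp add: \<Delta>_def)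
  qed
  then have "contractible \<Delta>" by (rule convex_imp_contractible)
  moreover have nz: "chord z \<noteq> 0" if "z \<in> \<Delta>" for z
    using that chord_nz[of "fst z" "snd z"] by (auto simp: \<Delta>_def)
  ultimately obtain g where g: "continuous_on \<Delta> g" "\<And>z. z \<in> \<Delta> \<Longrightarrow> chord z = exp (g z)"
    using continuous_logarithm_on_contractible[OF cont_chord] by metis
  define h where "h u v = Im (g (u, v))" for u v
  have conth: "continuous_on {a..a+1} (\<lambda>x. h (f x) (f' x))"
    if "continuous_on {a..a+1} f" "continuous_on {a..a+1} f'" "\<And>x. x \<in> {a..a+1} \<Longrightarrow> (f x, f' x) \<in> \<Delta>" for f f'
    unfolding h_def
    by (intro continuous_on_Im continuous_on_compose2[OF g(1)] continuous_on_Pair that) (use that in auto)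
  have chord_cis: "chord (u, v) = norm (chord (u, v)) * cis (h u v)" if "(u, v) \<in> \<Delta>" for u v
    using g(2)[OF that] by (simp add: h_def exp_eq_polar norm_mult)
  have cancel: "- \<sigma> a = \<sigma> a * x \<longleftrightarrow> x = -1" for x
    using mult_cancel_left[of "\<sigma> a" "-1" x] by auto
  have pa: "p a = \<sigma> a" using a(2) p_eq[of a] by simp
  have 1: "h a (a + 1) - h a a = pi"
  proof (rule half_turn[of a "a + 1" "h a"])
    show "continuous_on {a..a+1} (h a)" by (rule conth) (auto simp: \<Delta>_def)
    fix v assume v: "v \<in> {a..a+1}"
    then have D: "(a, v) \<in> \<Delta>" by (auto simp: \<Delta>_def)
    have "Im (chord (a, v)) \<ge> 0"
    proof (cases "v = a \<or> v = a + 1")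
      case True
      then show ?thesis by (auto simp: chord_diag chord_diag1 pa)
    next
      case False
      with v have pos: "(v - a) * (1 - (v - a)) > 0" by auto
      have "Im (complex_of_real ((v - a) * (1 - (v - a))) * chord (a, v)) = Im (\<gamma> v) - Im (\<gamma> a)"
        using chord_mult[of v a] by simp
      then have "(v - a) * (1 - (v - a)) * Im (chord (a, v)) \<ge> 0"
        using a(1)[of v] by simp
      with pos show ?thesis by (simp add: zero_le_mult_iff)
    qed
    then show "0 \<le> sin (h a v)"
      by (subst (asm) chord_cis[OF D]) (use nz[OF D] in \<open>simp add: zero_le_mult_iff\<close>)
  next
    have D: "(a, a) \<in> \<Delta>" "(a, a + 1) \<in> \<Delta>" by (auto simp: \<Delta>_def)
    show "cos (h a a) = 1" using chord_cis[OF D(1)] by (simp add: chord_diag pa complex_eq_iff abs_of_pos)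
    show "cos (h a (a + 1)) = -1" using chord_cis[OF D(2)]
      by (simp add: chord_diag1 pa complex_eq_iff abs_of_pos cancel)
  qed simp
  \<comment> \<open>On this side the chord ends at the lowest point, so it stays in the lower half
    plane; adding \<open>pi\<close> to its argument restores the hypotheses of
    \<open>half_turn\<close>.\<close>
  have 2: "(h (a + 1) (a + 1) + pi) - (h a (a + 1) + pi) = pi"
  proof (rule half_turn[of a "a + 1" "\<lambda>u. h u (a + 1) + pi"])
    show "continuous_on {a..a+1} (\<lambda>u. h u (a + 1) + pi)"
      by (intro continuous_intros conth) (auto simp: \<Delta>_def)
    fix v assume v: "v \<in> {a..a+1}"
    then have D: "(v, a + 1) \<in> \<Delta>" by (auto simp: \<Delta>_def)
    have "Im (chord (v, a + 1)) \<le> 0"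
    proof (cases "v = a \<or> v = a + 1")
      case True
      then show ?thesis by (auto simp: chord_diag chord_diag1 pa)
    next
      case False
      with v have pos: "(a + 1 - v) * (1 - (a + 1 - v)) > 0" by auto
      have "Im (complex_of_real ((a + 1 - v) * (1 - (a + 1 - v))) * chord (v, a + 1)) = Im (\<gamma> a) - Im (\<gamma> v)"
        using chord_mult[of "a + 1" v] periodic[of a] by simp
      then have "(a + 1 - v) * (1 - (a + 1 - v)) * Im (chord (v, a + 1)) \<le> 0"
        using a(1)[of v] by simp
      then show ?thesis using mult_pos_pos[OF pos, of "Im (chord (v, a + 1))"] by linarith
    qed
    then show "0 \<le> sin (h v (a + 1) + pi)"
      by (subst (asm) chord_cis[OF D]) (use nz[OF D] in \<open>simp add: mult_le_0_iff\<close>)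
  next
    have D: "(a + 1, a + 1) \<in> \<Delta>" "(a, a + 1) \<in> \<Delta>" by (auto simp: \<Delta>_def)
    show "cos (h (a + 1) (a + 1) + pi) = -1" using chord_cis[OF D(1)] by (simp add: chord_diag pa complex_eq_iff abs_of_pos)
    show "cos (h a (a + 1) + pi) = 1" using chord_cis[OF D(2)]
      by (simp add: chord_diag1 pa complex_eq_iff abs_of_pos cancel)
  qed simp
  have cont\<theta>: "continuous_on S \<theta>" for S
    by (intro continuous_at_imp_continuous_on ballI DERIV_isCont[OF \<theta>(1)])
  \<comment> \<open>On the diagonal the chord is \<open>p u\<close>, so both angles are arguments of
    the same vector and their difference is a continuous multiple of \<open>2 * pi\<close>.\<close>
  have 3: "h (a + 1) (a + 1) - \<theta> (a + 1) = h a a - \<theta> a"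
  proof (rule continuous_cos_1_constant[of a "a + 1" "\<lambda>u. h u u - \<theta> u"])
    show "continuous_on {a..a+1} (\<lambda>u. h u u - \<theta> u)"
      by (intro continuous_intros conth cont\<theta>) (auto simp: \<Delta>_def)
    fix u assume "u \<in> {a..a+1}"
    then have "(u, u) \<in> \<Delta>" by (auto simp: \<Delta>_def)
    from chord_cis[OF this] have "p u = \<sigma> u * cis (h u u)" by (simp add: chord_diag speed_eq)
    then have "cis (h u u) = cis (\<theta> u)" using p_eq[of u] \<theta>(2)[of u] by simp
    then show "cos (h u u - \<theta> u) = 1"
      by (simp add: complex_eq_iff cos_diff)
  qed simp
  \<comment> \<open>The turning over one period is independent of where the period starts, so its
    value at the lowest point is the value everywhere.\<close>
  have "((\<lambda>u. \<theta> (u + 1) - \<theta> u) has_vector_derivative 0) (at u)" for u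
  proof -
    have "((\<lambda>u. \<theta> (u + 1)) has_real_derivative \<sigma> (u + 1) * k (u + 1)) (at u)"
      using \<theta>(1)[of "u + 1"] DERIV_shift[of \<theta> _ u 1] by simp
    from DERIV_diff[OF this \<theta>(1)[of u]]
    have "((\<lambda>u. \<theta> (u + 1) - \<theta> u) has_real_derivative 0) (at u)" by simp
    then show ?thesis by (simp add: has_real_derivative_iff_has_vector_derivative)
  qed
  then obtain c where "\<And>u. \<theta> (u + 1) - \<theta> u = c"
    using has_vector_derivative_zero_constant[of UNIV "\<lambda>u. \<theta> (u + 1) - \<theta> u"] by auto
  then have "\<theta> (u + 1) - \<theta> u = \<theta> (a + 1) - \<theta> a" by simp
  then show ?thesis using 1 2 3 by simp
qed

end

section \<open>Winding numbers and the enclosed area\<close>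

lemma integral_periodic_shift:
  fixes f :: "real \<Rightarrow> 'a::euclidean_space"
  assumes "continuous_on UNIV f" "\<And>u. f (u + 1) = f u"
  shows "integral {a..a+1} f = integral {0..1} f"
proof -
  obtain F where F: "\<And>u. (F has_vector_derivative f u) (at u)"
    using antiderivative_on_UNIV[OF assms(1)] by blast
  have "((\<lambda>u. F (u + 1) - F u) has_vector_derivative 0) (at u)" for u
  proof -
    have "((\<lambda>u. u + 1) has_vector_derivative 1) (at u)" by (auto intro!: derivative_eq_intros)
    from vector_diff_chain_at[OF this F] have "((\<lambda>u. F (u + 1)) has_vector_derivative f u) (at u)"
      by (simp add: o_def assms(2))
    from has_vector_derivative_diff[OF this F] show ?thesis by simp
  qed
  then obtain c where c: "\<And>u. F (u + 1) - F u = c"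
    using has_vector_derivative_zero_constant[of UNIV "\<lambda>u. F (u + 1) - F u"] by auto
  have "integral {u..u+1} f = F (u + 1) - F u" for u
    by (intro integral_unique fundamental_theorem_of_calculus)
      (auto intro: has_vector_derivative_at_within F)
  from this[of a] this[of 0] show ?thesis by (simp only: c) simp
qed

context jordan_curve
begin

lemma valid: "valid_path \<gamma>"
  unfolding valid_path_def
proof (rule C1_differentiable_imp_piecewise)
  show "\<gamma> C1_differentiable_on {0..1}"
    unfolding C1_differentiable_on_def using deriv_\<gamma> cont_p by blast
qed

lemma closed: "pathfinish \<gamma> = pathstart \<gamma>"
  using periodic[of 0] by (simp add: pathfinish_def pathstart_def)

lemma contour_integral_eq: "contour_integral \<gamma> f = integral {0..1} (\<lambda>u. f (\<gamma> u) * p u)"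
  unfolding contour_integral_integral p_def ..

text \<open>The start \<open>a\<close> is free so that a period can begin at a crossing of a branch
  cut, which puts the jump of the logarithm at the ends of the interval.\<close>

lemma winding_number_eq:
  assumes "z \<notin> path_image \<gamma>"
  shows "winding_number \<gamma> z = 1 / (2 * pi * \<i>) * integral {a..a+1} (\<lambda>u. p u / (\<gamma> u - z))"
proof -
  have "\<gamma> u - z \<noteq> 0" for u using assms range_eq by (metis eq_iff_diff_eq_0 rangeI)
  then have "integral {a..a+1} (\<lambda>u. p u / (\<gamma> u - z)) = integral {0..1} (\<lambda>u. p u / (\<gamma> u - z))"
    by (intro integral_periodic_shift continuous_intros cont_p cont_\<gamma>) (auto simp: periodic)
  then show ?thesis
    unfolding winding_number_valid_path[OF valid assms] contour_integral_eq by simp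
qed

text \<open>Along the curve \<open>1 / (w - zp) - 1 / (w - zm)\<close> has the primitive \<open>Ln ((w - zp) / (w - zm))\<close>: the
  quotient is negative exactly on the open segment between \<open>zm\<close> and \<open>zp\<close>, which the curve meets only at
  \<open>\<gamma> a\<close>. There the primitive jumps from \<open>\<i> \<pi>\<close> to \<open>- \<i> \<pi>\<close>.\<close>
lemma winding_number_jump:
  assumes a: "T a = 1" and d: "\<delta> > 0"
    and crossing: "\<And>u t. \<gamma> u = \<gamma> a + \<i> * complex_of_real t \<Longrightarrow> \<bar>t\<bar> \<le> \<delta> \<Longrightarrow> t = 0"
  shows "winding_number \<gamma> (\<gamma> a + \<i> * \<delta>) = winding_number \<gamma> (\<gamma> a - \<i> * \<delta>) + 1"
proof -
  define zp where "zp = \<gamma> a + \<i> * \<delta>"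
  define zm where "zm = \<gamma> a - \<i> * \<delta>"
  have nz: "\<gamma> u \<noteq> zp" "\<gamma> u \<noteq> zm" for u
    using crossing[of u \<delta>] crossing[of u "-\<delta>"] d by (auto simp: zp_def zm_def)
  then have np: "zp \<notin> path_image \<gamma>" "zm \<notin> path_image \<gamma>"
    unfolding range_eq[symmetric] by auto
  define q where "q u = (\<gamma> u - zp) / (\<gamma> u - zm)" for u
  have q_nz: "q u \<noteq> 0" for u using nz by (simp add: q_def)
  have q_eq: "q u * (\<gamma> u - zm) = \<gamma> u - zp" for u using nz by (simp add: q_def)
  have q_cut: "q u \<notin> \<real>\<^sub>\<le>\<^sub>0" if "a < u" "u < a + 1" for u
  proof
    assume "q u \<in> \<real>\<^sub>\<le>\<^sub>0"
    then obtain s where s: "q u = - complex_of_real s" "s \<ge> 0"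
      by (metis nonpos_Reals_cases minus_minus neg_0_le_iff_le of_real_minus)
    \<comment> \<open>Solving for \<open>\<gamma> u\<close> puts it on the vertical segment, at
      height \<open>\<delta> * (1 - s) / (1 + s)\<close> relative to \<open>\<gamma> a\<close>.
      Since \<open>s\<close> is nonnegative, this height is at most \<delta> in absolute
      value.\<close>
    have "complex_of_real (1 + s) * (\<gamma> u - \<gamma> a) = \<i> * \<delta> * complex_of_real (1 - s)"
      using q_eq[of u] unfolding s(1) zp_def zm_def by (simp add: algebra_simps)
    moreover have "complex_of_real (1 + s) \<noteq> 0" using s(2) by (metis add_nonneg_eq_0_iff of_real_eq_0_iff zero_le_one zero_neq_one)
    ultimately have "\<gamma> u = \<gamma> a + \<i> * complex_of_real (\<delta> * (1 - s) / (1 + s))"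
      by (simp add: field_simps)
    moreover have "\<bar>\<delta> * (1 - s) / (1 + s)\<bar> \<le> \<delta>"
    proof -
      have "\<bar>1 - s\<bar> \<le> 1 + s" using s(2) by linarith
      then have "\<delta> * \<bar>1 - s\<bar> \<le> \<delta> * (1 + s)" using d by (intro mult_left_mono) auto
      then show ?thesis using s(2) d by (simp add: abs_mult divide_le_eq)
    qed
    ultimately have "\<gamma> u = \<gamma> a" using crossing[of u] by (metis add.right_neutral mult_zero_right of_real_0)
    then show False using inj_lt[of a u] that by simp
  qed
  \<comment> \<open>The sign tells on which side of the cut the quotient lies: below it when the
    curve is to the right of \<open>\<gamma> a\<close>, above it when the curve is to the
    left.\<close>
  have Imq: "Im (q u) = - 2 * \<delta> * Re (\<gamma> u - \<gamma> a) / (cmod (\<gamma> u - zm))\<^sup>2" for u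
    unfolding q_def zp_def zm_def
    by (simp add: Im_divide cmod_power2 algebra_simps)
  have q_deriv: "(q has_vector_derivative q u * (p u / (\<gamma> u - zp) - p u / (\<gamma> u - zm))) (at u)" for u
  proof -
    have "((\<lambda>z. (z - zp) / (z - zm)) has_field_derivative (zp - zm) / (\<gamma> u - zm)^2) (at (\<gamma> u))"
      using nz[of u] by (auto intro!: derivative_eq_intros simp: field_simps power2_eq_square)
    from field_vector_diff_chain_at[OF deriv_\<gamma> this]
    have "(q has_vector_derivative p u * ((zp - zm) / (\<gamma> u - zm)^2)) (at u)"
      by (simp add: o_def q_def[abs_def])
    moreover have "p u * ((zp - zm) / (\<gamma> u - zm)^2) = q u * (p u / (\<gamma> u - zp) - p u / (\<gamma> u - zm))"
    proof -
      have "P * ((B - A) / B\<^sup>2) = A / B * (P / A - P / B)" if "A \<noteq> 0" "B \<noteq> 0" for P A B :: complex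
        using that by (simp add: field_simps power2_eq_square)
      from this[of "\<gamma> u - zp" "\<gamma> u - zm" "p u"] show ?thesis using nz[of u] by (simp add: q_def)
    qed
    ultimately show ?thesis by simp
  qed
  have q_cont: "isCont q u" for u using q_deriv has_vector_derivative_continuous by blast
  have "q a = -1" using d by (simp add: q_def zp_def zm_def)
  moreover have "q (a + 1) = q a" by (simp add: q_def periodic)
  ultimately have q_end: "q a = -1" "q (a + 1) = -1" by simp_all
  define \<Lambda> where "\<Lambda> u = (if u \<le> a then - \<i> * pi else if u \<ge> a + 1 then \<i> * pi else Ln (q u))" for u
  have dRe: "((\<lambda>u. Re (\<gamma> u - \<gamma> a)) has_real_derivative \<sigma> b) (at b)" if "T b = 1" for b
  proof -
    have "p b = \<sigma> b" using p_eq[of b] that by simp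
    with has_vector_derivative_Re[OF has_vector_derivative_diff[OF deriv_\<gamma>[of b UNIV] has_vector_derivative_const]]
    show ?thesis by simp
  qed
  \<comment> \<open>\<open>Ln\<close> is discontinuous at -1, but \<open>Ln (- q)\<close> is
    continuous near the crossing and differs from \<open>Ln q\<close> by \<open>\<i> * pi\<close>,
    with a sign read off from \<open>Imq\<close>.\<close>
  have lnq: "((\<lambda>u. Ln (- q u)) \<longlongrightarrow> 0) (at b)" if "q b = -1" for b
  proof -
    have "isCont (\<lambda>u. Ln (- q u)) b"
      by (intro continuous_intros q_cont) (simp add: that)
    then show ?thesis by (simp add: isCont_def that)
  qed
  have lim1: "(\<Lambda> \<longlongrightarrow> - \<i> * pi) (at_right a)"
  proof -
    obtain e where e: "e > 0" "\<And>h. h > 0 \<Longrightarrow> h < e \<Longrightarrow> Re (\<gamma> (a + h) - \<gamma> a) > 0"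
      using DERIV_pos_inc_right[OF dRe[OF a] speed_pos] by auto
    have "\<forall>\<^sub>F u in at_right a. u < a + min e 1" using e(1) by (intro eventually_at_right_less eventually_at_rightI[of a "a + min e 1"]) auto
    then have "\<forall>\<^sub>F u in at_right a. Ln (- q u) - \<i> * pi = \<Lambda> u"
      using eventually_at_right_less[of a]
    proof eventually_elim
      case (elim u)
      have "Re (\<gamma> u - \<gamma> a) > 0" using e(2)[of "u - a"] elim by auto
      then have "Im (q u) < 0" using d nz(2)[of u] by (simp add: Imq divide_less_0_iff mult_less_0_iff)
      then show ?case using elim Ln_minus[of "q u"] q_nz[of u] by (auto simp: \<Lambda>_def)
    qed
    moreover have "((\<lambda>u. Ln (- q u) - \<i> * pi) \<longlongrightarrow> 0 - \<i> * pi) (at_right a)"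
      by (intro tendsto_intros tendsto_within_subset[OF lnq[OF q_end(1)]]) auto
    ultimately show ?thesis by (simp add: tendsto_cong)
  qed
  have lim2: "(\<Lambda> \<longlongrightarrow> \<i> * pi) (at_left (a + 1))"
  proof -
    have a': "T (a + 1) = 1" using a by simp
    obtain e where e: "e > 0" "\<And>h. h > 0 \<Longrightarrow> h < e \<Longrightarrow> Re (\<gamma> (a + 1 - h) - \<gamma> a) < 0"
      using DERIV_pos_inc_left[OF dRe[OF a'] speed_pos] by (auto simp: periodic)
    have "\<forall>\<^sub>F u in at_left (a + 1). u > a + 1 - min e 1" using e(1) by (intro eventually_at_leftI[of "a + 1 - min e 1"]) auto
    moreover have "\<forall>\<^sub>F u in at_left (a + 1). u < a + 1" by (simp add: eventually_at_filter)
    ultimately have "\<forall>\<^sub>F u in at_left (a + 1). Ln (- q u) + \<i> * pi = \<Lambda> u"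
    proof eventually_elim
      case (elim u)
      have "Re (\<gamma> u - \<gamma> a) < 0" using e(2)[of "a + 1 - u"] elim by auto
      then have "Im (q u) > 0" using d nz(2)[of u] mult_pos_neg[of \<delta> "Re (\<gamma> u - \<gamma> a)"]
        by (simp add: Imq divide_less_0_iff)
      then show ?case using elim Ln_minus[of "q u"] q_nz[of u] by (auto simp: \<Lambda>_def)
    qed
    moreover have "((\<lambda>u. Ln (- q u) + \<i> * pi) \<longlongrightarrow> 0 + \<i> * pi) (at_left (a + 1))"
      by (intro tendsto_intros tendsto_within_subset[OF lnq[OF q_end(2)]]) auto
    ultimately show ?thesis by (simp add: tendsto_cong)
  qed
  have der: "(\<Lambda> has_vector_derivative p u / (\<gamma> u - zp) - p u / (\<gamma> u - zm)) (at u)" if "a < u" "u < a + 1" for u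
  proof -
    have "(Ln has_field_derivative inverse (q u)) (at (q u))" by (rule has_field_derivative_Ln[OF q_cut[OF that]])
    from field_vector_diff_chain_at[OF q_deriv this]
    have "((\<lambda>u. Ln (q u)) has_vector_derivative p u / (\<gamma> u - zp) - p u / (\<gamma> u - zm)) (at u)"
      using q_nz[of u] by (simp add: o_def divide_inverse[symmetric])
    then show ?thesis
      by (rule has_vector_derivative_transform_within_open[of _ _ _ "{a<..<a+1}"]) (use that in \<open>auto simp: \<Lambda>_def\<close>)
  qed
  have "continuous_on {a..a+1} \<Lambda>"
    unfolding continuous_on_def
  proof
    fix x assume x: "x \<in> {a..a+1}"
    consider "x = a" | "x = a + 1" | "a < x" "x < a + 1" using x by fastforce
    then show "(\<Lambda> \<longlongrightarrow> \<Lambda> x) (at x within {a..a+1})"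
    proof cases
      case 1
      have "at a within {a..a+1} = at_right a" by (rule at_within_Icc_at_right) simp
      then show ?thesis using lim1 1 by (simp add: \<Lambda>_def)
    next
      case 2
      have "at (a+1) within {a..a+1} = at_left (a+1)" by (rule at_within_Icc_at_left) simp
      then show ?thesis using lim2 2 by (simp add: \<Lambda>_def)
    next
      case 3
      then show ?thesis using has_vector_derivative_continuous[OF der]
        by (meson continuous_within isCont_def tendsto_within_subset subset_UNIV)
    qed
  qed
  then have "((\<lambda>u. p u / (\<gamma> u - zp) - p u / (\<gamma> u - zm)) has_integral \<Lambda> (a + 1) - \<Lambda> a) {a..a+1}"
    by (intro fundamental_theorem_of_calculus_interior der) auto
  then have I: "integral {a..a+1} (\<lambda>u. p u / (\<gamma> u - zp) - p u / (\<gamma> u - zm)) = 2 * pi * \<i>"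
    by (simp add: \<Lambda>_def integral_unique)
  have "(\<lambda>u. p u / (\<gamma> u - z)) integrable_on {a..a+1}" if "\<And>u. \<gamma> u \<noteq> z" for z
    by (intro integrable_continuous_real continuous_intros cont_p cont_\<gamma>) (simp add: that)
  from integral_diff[OF this this, of zp zm] nz I
  have I: "integral {a..a+1} (\<lambda>u. p u / (\<gamma> u - zp)) = integral {a..a+1} (\<lambda>u. p u / (\<gamma> u - zm)) + 2 * pi * \<i>"
    by (simp add: algebra_simps)
  have "winding_number \<gamma> zp = winding_number \<gamma> zm + 1"
    unfolding winding_number_eq[OF np(1), of a] winding_number_eq[OF np(2), of a] I
    by (simp add: field_simps)
  then show ?thesis by (simp add: zp_def zm_def)
qed

text \<open>Just above a lowest point the inward normal leads inside, and just below it the winding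
  number is 0, so the jump produces one inside point with winding number 1. On the inside of a
  simple closed path the winding number is constantly 1 or constantly -1, and this point excludes
  -1.\<close>

lemma winding_number_inside:
  assumes "z \<in> inside (path_image \<gamma>)"
  shows "winding_number \<gamma> z = 1"
proof -
  obtain a where a: "\<And>u. Im (\<gamma> a) \<le> Im (\<gamma> u)" "T a = 1" using lowest_point by blast
  have "\<forall>\<^sub>F \<epsilon> in at_right 0. \<gamma> a + \<i> * complex_of_real \<epsilon> \<in> inside (path_image \<gamma>)"
    using inward[of a] by (simp add: unit_normal_def a(2) scaleR_conv_of_real mult.commute)
  then obtain b where b: "b > 0" "\<And>\<epsilon>. 0 < \<epsilon> \<Longrightarrow> \<epsilon> < b \<Longrightarrow> \<gamma> a + \<i> * complex_of_real \<epsilon> \<in> inside (path_image \<gamma>)"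
    unfolding eventually_at_right_field by auto
  \<comment> \<open>\<open>winding_number_jump\<close> wants a closed segment, whereas points
    strictly below height \<open>b\<close> are known to be inside.\<close>
  define \<delta> where "\<delta> = b / 2"
  have d: "\<delta> > 0" "\<delta> < b" using b(1) by (auto simp: \<delta>_def)
  have "winding_number \<gamma> (\<gamma> a + \<i> * \<delta>) = winding_number \<gamma> (\<gamma> a - \<i> * \<delta>) + 1"
  proof (rule winding_number_jump[OF a(2) d(1)])
    fix u t assume t: "\<gamma> u = \<gamma> a + \<i> * complex_of_real t" "\<bar>t\<bar> \<le> \<delta>"
    have "Im (\<gamma> u) = Im (\<gamma> a) + t" using t(1) by simp
    then have "t \<ge> 0" using a(1)[of u] by linarith
    moreover have "\<not> t > 0"
    proof
      assume "t > 0"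
      then have "\<gamma> u \<in> inside (path_image \<gamma>)" unfolding t(1) by (rule b(2)) (use t(2) d in linarith)
      moreover have "\<gamma> u \<in> path_image \<gamma>" unfolding range_eq[symmetric] by simp
      ultimately show False using inside_no_overlap by blast
    qed
    ultimately show "t = 0" by linarith
  qed
  moreover have "winding_number \<gamma> (\<gamma> a - \<i> * \<delta>) = 0"
    by (rule winding_number_zero_in_outside[OF valid_path_imp_path[OF valid] closed below_lowest_outside[OF a(1)]])
      (use d in simp)
  ultimately have 1: "winding_number \<gamma> (\<gamma> a + \<i> * \<delta>) = 1" by simp
  have ins: "\<gamma> a + \<i> * \<delta> \<in> inside (path_image \<gamma>)" by (rule b(2)[OF d])
  from simple_closed_path_winding_number_inside[OF simple]
  show ?thesis
  proof (cases)
    case 1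
    then show ?thesis using assms by blast
  next
    case 2
    then show ?thesis using 1 ins by force
  qed
qed

end

section \<open>Iterated integrals over the plane and the kernel
  \<open>1 / (\<zeta> - z)\<close>\<close>

lemma Complex_measurable [measurable]:
  "(\<lambda>z. Complex (fst z) (snd z)) \<in> borel_measurable (lborel \<Otimes>\<^sub>M lborel)"
  unfolding lborel_prod by (auto intro!: borel_measurable_continuous_onI continuous_intros simp: Complex_eq)

lemma lborel_complex:
  "(lborel :: complex measure) = distr (lborel \<Otimes>\<^sub>M lborel) borel (\<lambda>z. Complex (fst z) (snd z))"
proof (rule lborel_eqI)
  fix l u :: complex assume le: "\<And>b. b \<in> Basis \<Longrightarrow> l \<bullet> b \<le> u \<bullet> b"
  have "Re l \<le> Re u" "Im l \<le> Im u" using le[of 1] le[of \<i>] by (auto simp: Basis_complex_def)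
  have "(\<lambda>z. Complex (fst z) (snd z)) -` box l u \<inter> space (lborel \<Otimes>\<^sub>M lborel)
      = {Re l<..<Re u} \<times> {Im l<..<Im u}"
    by (auto simp: box_def Basis_complex_def space_pair_measure)
  then show "emeasure (distr (lborel \<Otimes>\<^sub>M lborel) borel (\<lambda>z. Complex (fst z) (snd z))) (box l u)
      = (\<Prod>b\<in>Basis. (u - l) \<bullet> b)"
    using \<open>Re l \<le> Re u\<close> \<open>Im l \<le> Im u\<close>
    by (simp add: emeasure_distr lborel.emeasure_pair_measure_Times Basis_complex_def ennreal_mult[symmetric])
qed simp

text \<open>Since \<open>Im w\<close> is nonzero, the primitive \<open>- Ln (w - x)\<close> never
  meets the cut. Trading \<open>Ln (w - R)\<close> for \<open>Ln (R - w)\<close> leaves two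
  logarithms that are holomorphic in the strip where the real part is below \<open>R\<close> in
  absolute value, and collects the whole jump across the line in the \<open>sgn\<close>
  term.\<close>

lemma inverse_line_integral:
  assumes "\<bar>Re \<zeta>\<bar> < R" "Im \<zeta> \<noteq> y"
  shows "((\<lambda>x. 1 / (\<zeta> - Complex x y)) has_integral
    (Ln (R + (\<zeta> - \<i> * y)) - Ln (R - (\<zeta> - \<i> * y)) - \<i> * pi * sgn (Im \<zeta> - y))) {-R..R}"
proof -
  define w where "w = \<zeta> - \<i> * y"
  have w: "Im w \<noteq> 0" "\<bar>Re w\<bar> < R" "\<zeta> - Complex x y = w - x" for x
    using assms by (auto simp: w_def complex_eq_iff)
  have "((\<lambda>x. - Ln (w - complex_of_real x)) has_vector_derivative 1 / (w - complex_of_real x)) (at x within {-R..R})" for x :: real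
  proof -
    have n: "w - complex_of_real x \<notin> \<real>\<^sub>\<le>\<^sub>0" using w by (simp add: complex_nonpos_Reals_iff)
    have "((\<lambda>x. w - complex_of_real x) has_vector_derivative -1) (at x within {-R..R})"
      by (auto intro!: derivative_eq_intros)
    from field_vector_diff_chain_within[OF this has_field_derivative_at_within[OF has_field_derivative_Ln[OF n]]]
    have "((\<lambda>x. Ln (w - complex_of_real x)) has_vector_derivative - 1 * inverse (w - complex_of_real x)) (at x within {-R..R})"
      by (simp add: o_def)
    from has_vector_derivative_minus[OF this] show ?thesis by (simp add: divide_inverse)
  qed
  then have I: "((\<lambda>x. 1 / (w - complex_of_real x)) has_integral - Ln (w - R) - - Ln (w - - R)) {-R..R}"
    using assms by (intro fundamental_theorem_of_calculus) auto
  have "w - R \<noteq> 0" using w by (auto simp: complex_eq_iff)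
  then have "R - w \<noteq> 0" by auto
  from Ln_minus[OF this] have "Ln (w - R) = Ln (R - w) + \<i> * pi * sgn (Im w)"
    using w(1) by (auto simp: sgn_if)
  with I show ?thesis unfolding w(3) w_def[symmetric]
    by (simp add: w_def algebra_simps)
qed

lemma nn_integral_inverse_sqrt_finite:
  "(\<integral>\<^sup>+x. ennreal (indicator {-c..c} x / sqrt \<bar>x\<bar>) \<partial>lborel) < \<infinity>"
proof (cases "c > 0")
  case True
  have d: "((\<lambda>x. 2 * sqrt x) has_real_derivative 1 / sqrt x) (at x)" if "x > 0" for x
    using that by (auto intro!: derivative_eq_intros simp: field_simps)
  have I1: "((\<lambda>x. 1 / sqrt \<bar>x\<bar>) has_integral 2 * sqrt c - 2 * sqrt 0) {0..c}"
  proof (rule fundamental_theorem_of_calculus_interior)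
    show "((\<lambda>x. 2 * sqrt x) has_vector_derivative 1 / sqrt \<bar>x\<bar>) (at x)" if "x \<in> {0<..<c}" for x
      using d[of x] that by (simp add: has_real_derivative_iff_has_vector_derivative)
  qed (use True in \<open>auto intro!: continuous_intros\<close>)
  have I2: "((\<lambda>x. 1 / sqrt \<bar>x\<bar>) has_integral 2 * sqrt c - 2 * sqrt 0) {-c..0}"
    using has_integral_reflect_real[where f = "\<lambda>x. 1 / sqrt \<bar>x\<bar>" and a = 0 and b = c] I1 by simp
  have "((\<lambda>x. 1 / sqrt \<bar>x\<bar>) has_integral (2 * sqrt c - 2 * sqrt 0) + (2 * sqrt c - 2 * sqrt 0)) {-c..c}"
    by (rule has_integral_combine[OF _ _ I2 I1]) (use True in auto)
  then have "((\<lambda>x. indicator {-c..c} x / sqrt \<bar>x\<bar>) has_integral 4 * sqrt c) UNIV"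
    by (subst (asm) has_integral_restrict_UNIV[symmetric])
      (auto simp: indicator_def elim!: back_subst[of "\<lambda>f. (f has_integral _) _"])
  from nn_integral_has_integral_lborel[OF _ _ this] show ?thesis by simp
next
  case False
  then have "(\<lambda>x. ennreal (indicator {-c..c} x / sqrt \<bar>x\<bar>)) = (\<lambda>_. 0)"
    by (auto simp: fun_eq_iff indicator_def)
  then show ?thesis by simp
qed

text \<open>Separates the variables: the planar singularity is dominated by a product of two
  integrable one-dimensional ones, which makes its integrability a matter of Tonelli instead of
  polar coordinates.\<close>

lemma inverse_norm_le: "1 / cmod (Complex a b) \<le> (1 / sqrt \<bar>a\<bar>) * (1 / sqrt \<bar>b\<bar>)" if "a \<noteq> 0" "b \<noteq> 0"
proof -
  have "\<bar>a\<bar> * \<bar>b\<bar> \<le> a\<^sup>2 + b\<^sup>2"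
  proof -
    have "2 * (\<bar>a\<bar> * \<bar>b\<bar>) \<le> a\<^sup>2 + b\<^sup>2"
      using sum_squares_bound[of "\<bar>a\<bar>" "\<bar>b\<bar>"] by (simp add: mult.assoc)
    moreover have "0 \<le> \<bar>a\<bar> * \<bar>b\<bar>" by simp
    ultimately show ?thesis by linarith
  qed
  then have "sqrt \<bar>a\<bar> * sqrt \<bar>b\<bar> \<le> cmod (Complex a b)"
    by (simp add: real_sqrt_mult[symmetric] cmod_def)
  then show ?thesis using that by (simp add: frac_le)
qed

text \<open>The bound has to be uniform in \<zeta>, because \<zeta> will run along the curve.
  Differences of coordinates bounded by \<open>R\<close> are bounded by \<open>2 * R\<close>, hence
  the doubled window.\<close>

lemma nn_integral_inverse_distance_le:
  assumes "\<bar>Re \<zeta>\<bar> \<le> R" "\<bar>Im \<zeta>\<bar> \<le> R"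
  shows "(\<integral>\<^sup>+z. ennreal (indicator {z. \<bar>Re z\<bar> \<le> R \<and> \<bar>Im z\<bar> \<le> R} z / cmod (\<zeta> - z)) \<partial>lborel)
    \<le> (\<integral>\<^sup>+x. ennreal (indicator {-(2*R)..2*R} x / sqrt \<bar>x\<bar>) \<partial>lborel) ^ 2" (is "?L \<le> ?H ^ 2")
proof -
  define h :: "real \<Rightarrow> real" where "h = (\<lambda>x. indicator {-(2*R)..2*R} x / sqrt \<bar>x\<bar>)"
  define Q where "Q = {z. \<bar>Re z\<bar> \<le> R \<and> \<bar>Im z\<bar> \<le> R}"
  have [measurable]: "h \<in> borel_measurable borel" unfolding h_def by measurable
  have "closed Q" unfolding Q_def by (intro closed_Collect_conj closed_Collect_le continuous_intros)
  then have [measurable]: "Q \<in> sets borel" by simp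
  have H: "?H = (\<integral>\<^sup>+x. ennreal (h x) \<partial>lborel)" by (simp add: h_def)
  have shift: "(\<integral>\<^sup>+x. ennreal (h (c - x)) \<partial>lborel) = ?H" for c
    using nn_integral_real_affine[of "\<lambda>x. ennreal (h x)" "-1" c] unfolding H by simp
  have h_nonneg: "h x \<ge> 0" for x by (simp add: h_def)
  have "?L = (\<integral>\<^sup>+z. ennreal (indicator Q (Complex (fst z) (snd z)) / cmod (\<zeta> - Complex (fst z) (snd z))) \<partial>(lborel \<Otimes>\<^sub>M lborel))"
    unfolding Q_def[symmetric] by (subst lborel_complex, subst nn_integral_distr) auto
  also have "\<dots> = (\<integral>\<^sup>+x. \<integral>\<^sup>+y. ennreal (indicator Q (Complex x y) / cmod (\<zeta> - Complex x y)) \<partial>lborel \<partial>lborel)"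
    by (subst lborel.nn_integral_fst[symmetric]) auto
  also have "\<dots> \<le> (\<integral>\<^sup>+x. \<integral>\<^sup>+y. ennreal (h (Re \<zeta> - x)) * ennreal (h (Im \<zeta> - y)) \<partial>lborel \<partial>lborel)"
  proof (rule nn_integral_mono_AE)
    have "AE x in lborel. x \<noteq> Re \<zeta>" by (rule AE_lborel_singleton)
    then show "AE x in lborel. (\<integral>\<^sup>+y. ennreal (indicator Q (Complex x y) / cmod (\<zeta> - Complex x y)) \<partial>lborel)
        \<le> (\<integral>\<^sup>+y. ennreal (h (Re \<zeta> - x)) * ennreal (h (Im \<zeta> - y)) \<partial>lborel)"
    proof eventually_elim
      case x: (elim x)
      show ?case
      proof (rule nn_integral_mono_AE)
        have "AE y in lborel. y \<noteq> Im \<zeta>" by (rule AE_lborel_singleton)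
        then show "AE y in lborel. ennreal (indicator Q (Complex x y) / cmod (\<zeta> - Complex x y))
           \<le> ennreal (h (Re \<zeta> - x)) * ennreal (h (Im \<zeta> - y))"
        proof eventually_elim
          case y: (elim y)
          show ?case
          proof (cases "Complex x y \<in> Q")
            case True
            have "1 / cmod (\<zeta> - Complex x y) \<le> (1 / sqrt \<bar>Re \<zeta> - x\<bar>) * (1 / sqrt \<bar>Im \<zeta> - y\<bar>)"
              using inverse_norm_le[of "Re \<zeta> - x" "Im \<zeta> - y"] x y complex_eq_iff[of "\<zeta> - Complex x y" "Complex (Re \<zeta> - x) (Im \<zeta> - y)"] by simp
            also have "\<dots> = h (Re \<zeta> - x) * h (Im \<zeta> - y)"
              using True assms by (auto simp: h_def Q_def indicator_def)
            finally show ?thesis using True by (simp add: ennreal_mult''[symmetric] h_nonneg)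
          qed simp
        qed
      qed
    qed
  qed
  also have "\<dots> = (\<integral>\<^sup>+x. ennreal (h (Re \<zeta> - x)) * ?H \<partial>lborel)"
    by (subst nn_integral_cmult) (auto simp: shift)
  also have "\<dots> = ?H ^ 2"
    by (subst nn_integral_multc) (auto simp: shift power2_eq_square)
  finally show ?thesis .
qed

lemma has_integral_sgn:
  fixes \<eta> :: real
  assumes "\<bar>\<eta>\<bar> \<le> R"
  shows "((\<lambda>y. sgn (\<eta> - y)) has_integral 2 * \<eta>) {-R..R}"
proof -
  have le: "- R \<le> \<eta>" "\<eta> \<le> R" using assms by auto
  have 1: "((\<lambda>y. sgn (\<eta> - y)) has_integral (\<eta> + R)) {-R..\<eta>}"
    by (rule has_integral_spike[of "{\<eta>}" _ _ "\<lambda>_. 1"]) (use le has_integral_const_real[of "1::real" "-R" \<eta>] in auto)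
  have 2: "((\<lambda>y. sgn (\<eta> - y)) has_integral (\<eta> - R)) {\<eta>..R}"
    by (rule has_integral_spike[of "{\<eta>}" _ _ "\<lambda>_. -1"]) (use le has_integral_const_real[of "-1::real" \<eta> R] in \<open>auto simp: algebra_simps\<close>)
  show ?thesis using has_integral_combine[OF _ _ 1 2] assms by simp
qed

context jordan_curve
begin

lemma path_image_null: "path_image \<gamma> \<in> null_sets lborel"
proof -
  have "negligible (\<gamma> ` {0..1})"
    by (rule negligible_differentiable_image_lowdim)
      (use deriv_\<gamma> in \<open>auto simp: differentiable_on_def differentiable_def has_vector_derivative_def\<close>)
  moreover have "compact (path_image \<gamma>)"
    by (intro compact_path_image simple_path_imp_path simple)
  ultimately show ?thesis
    unfolding negligible_iff_null_sets path_image_def null_sets_def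
    using borel_compact by (auto dest: )
qed

text \<open>The area is the integral of the winding number. By Fubini the integral of \<open>1 / (\<zeta> - z)\<close> over the
  square is computed first; as a function of \<open>\<zeta>\<close> it is \<open>- 2 \<pi> \<i> Im \<zeta>\<close> plus a holomorphic function, and the
  latter does not contribute to the integral along the closed curve.\<close>
lemma enclosed_area_eq: "enclosed_area \<gamma> = - integral {0..1} (\<lambda>u. Im (\<gamma> u) * Re (p u))"
proof -
  obtain R where R0: "\<And>z. z \<in> path_image \<gamma> \<Longrightarrow> cmod z \<le> R - 1"
  proof -
    obtain b where "\<And>z. z \<in> path_image \<gamma> \<Longrightarrow> cmod z \<le> b"
      using bounded_range unfolding bounded_iff by blast
    then show ?thesis by (intro that[of "b + 1"]) simp
  qed
  have R: "\<bar>Re (\<gamma> u)\<bar> < R" "\<bar>Im (\<gamma> u)\<bar> < R" for u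
    using R0[of "\<gamma> u"] abs_Re_le_cmod[of "\<gamma> u"] abs_Im_le_cmod[of "\<gamma> u"] unfolding range_eq[symmetric] by auto
  have Rpos: "R > 0" using R[of 0] by linarith
  define Q where "Q = {z. \<bar>Re z\<bar> \<le> R \<and> \<bar>Im z\<bar> \<le> R}"
  have Qbox: "Q = cbox (Complex (-R) (-R)) (Complex R R)"
    by (auto simp: Q_def cbox_def Basis_complex_def)
  have [measurable]: "Q \<in> sets borel" unfolding Qbox by simp
  have inQ: "inside (path_image \<gamma>) \<subseteq> Q"
  proof -
    have "path_image \<gamma> \<subseteq> Q" by (auto simp: range_eq[symmetric] Q_def R less_imp_le)
    then have "- Q \<subseteq> outside (path_image \<gamma>)"
      unfolding Qbox by (intro outside_subset_convex convex_box)
    then show ?thesis using inside_Int_outside by blast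
  qed
  have cont [measurable]: "p \<in> borel_measurable borel" "\<gamma> \<in> borel_measurable borel"
    by (auto intro!: borel_measurable_continuous_onI cont_p cont_\<gamma>)
  have "compact (p ` {0..1})" by (intro compact_continuous_image cont_p) auto
  from compact_imp_bounded[OF this] obtain C where "\<forall>z\<in>p ` {0..1}. cmod z \<le> C"
    unfolding bounded_iff by blast
  then have C: "\<And>u. u \<in> {0..1} \<Longrightarrow> cmod (p u) \<le> C" by blast
  have C0: "C \<ge> 0" using order_trans[OF norm_ge_zero C[of 0]] by simp
  define H where "H = (\<integral>\<^sup>+x. ennreal (indicator {-(2*R)..2*R} x / sqrt \<bar>x\<bar>) \<partial>lborel)"
  have Hfin: "H < \<infinity>" unfolding H_def by (rule nn_integral_inverse_sqrt_finite)
  \<comment> \<open>Both domains are built into the integrand, so that Fubini applies to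
    \<open>lborel\<close> on the whole spaces. On the curve itself, where the kernel is singular,
    division by zero supplies the value 0.\<close>
  define g where "g u z = indicator {0..1} u *\<^sub>R (indicator Q z *\<^sub>R (p u / (\<gamma> u - z)))" for u z
  have [measurable]: "case_prod g \<in> borel_measurable (lborel \<Otimes>\<^sub>M lborel)"
    unfolding g_def split_beta' by measurable
  have [measurable]: "g u \<in> borel_measurable borel" for u
    unfolding g_def by measurable
  have gn: "(\<integral>\<^sup>+z. norm (g u z) \<partial>lborel) \<le> ennreal C * H^2 * indicator {0..1} u" for u
  proof (cases "u \<in> {0..1}")
    case True
    have "(\<integral>\<^sup>+z. norm (g u z) \<partial>lborel) = (\<integral>\<^sup>+z. ennreal (cmod (p u)) * ennreal (indicator Q z / cmod (\<gamma> u - z)) \<partial>lborel)"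
      using True by (intro nn_integral_cong) (auto simp: g_def norm_divide ennreal_mult'[symmetric])
    also have "\<dots> = ennreal (cmod (p u)) * (\<integral>\<^sup>+z. ennreal (indicator Q z / cmod (\<gamma> u - z)) \<partial>lborel)"
      by (rule nn_integral_cmult) measurable
    also have "\<dots> \<le> ennreal C * H^2"
      unfolding Q_def H_def by (intro mult_mono nn_integral_inverse_distance_le ennreal_leI C True)
        (use R[of u] in auto)
    finally show ?thesis using True by simp
  qed (simp add: g_def)
  have int_g: "integrable (lborel \<Otimes>\<^sub>M lborel) (case_prod g)"
  proof (rule integrableI_bounded)
    have "(\<integral>\<^sup>+w. norm (case_prod g w) \<partial>(lborel \<Otimes>\<^sub>M lborel)) = (\<integral>\<^sup>+u. \<integral>\<^sup>+z. norm (g u z) \<partial>lborel \<partial>lborel)"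
      by (subst lborel.nn_integral_fst[symmetric]) auto
    also have "\<dots> \<le> (\<integral>\<^sup>+u. ennreal C * H^2 * indicator {0..1::real} u \<partial>lborel)"
      by (intro nn_integral_mono gn)
    also have "\<dots> = ennreal C * H^2" by (subst nn_integral_cmult_indicator) auto
    also have "\<dots> < \<infinity>" using Hfin by (simp add: ennreal_mult_less_top power_less_top_ennreal)
    finally show "(\<integral>\<^sup>+w. norm (case_prod g w) \<partial>(lborel \<Otimes>\<^sub>M lborel)) < \<infinity>" .
  qed simp
  have int_gu: "integrable lborel (g u)" for u
  proof (rule integrableI_bounded)
    have "ennreal C * H^2 * indicator {0..1::real} u < \<infinity>"
      using Hfin by (auto simp: ennreal_mult_less_top power_less_top_ennreal indicator_def)
    then show "(\<integral>\<^sup>+z. norm (g u z) \<partial>lborel) < \<infinity>" using gn[of u] le_less_trans by blast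
  qed simp
  have open_inside: "open (inside (path_image \<gamma>))"
    by (intro open_inside closed_path_image simple_path_imp_path simple)
  have fubini: "(\<integral>z. (\<integral>u. g u z \<partial>lborel) \<partial>lborel) = (\<integral>u. (\<integral>z. g u z \<partial>lborel) \<partial>lborel)"
    by (rule lborel_pair.Fubini_integral[OF int_g])
  have left: "(\<integral>z. (\<integral>u. g u z \<partial>lborel) \<partial>lborel) = 2 * pi * \<i> * enclosed_area \<gamma>"
  proof -
    have "AE z in lborel. z \<notin> path_image \<gamma>" by (rule AE_not_in[OF path_image_null])
    then have "AE z in lborel. (\<integral>u. g u z \<partial>lborel) = indicator (inside (path_image \<gamma>)) z *\<^sub>R (2 * pi * \<i>)"
    proof eventually_elim
      case (elim z)
      then have nz: "\<gamma> u - z \<noteq> 0" for u using range_eq by (metis eq_iff_diff_eq_0 rangeI)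
      have "(\<integral>u. g u z \<partial>lborel) = indicator Q z *\<^sub>R (LINT u:{0..1}|lborel. p u / (\<gamma> u - z))"
        unfolding set_lebesgue_integral_def integral_scaleR_right[symmetric]
        by (intro Bochner_Integration.integral_cong) (auto simp: g_def indicator_def)
      also have "(LINT u:{0..1}|lborel. p u / (\<gamma> u - z)) = integral {0..1} (\<lambda>u. p u / (\<gamma> u - z))"
        by (intro set_borel_integral_eq_integral borel_integrable_atLeastAtMost' continuous_intros cont_p cont_\<gamma>)
          (use nz in auto)
      also have "\<dots> = 2 * pi * \<i> * winding_number \<gamma> z"
        using winding_number_eq[OF elim, of 0] by simp
      finally have *: "(\<integral>u. g u z \<partial>lborel) = indicator Q z *\<^sub>R (2 * pi * \<i> * winding_number \<gamma> z)" .
      show ?case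
      proof (cases "z \<in> inside (path_image \<gamma>)")
        case True
        then show ?thesis using * winding_number_inside[OF True] inQ by auto
      next
        case False
        then have "z \<in> outside (path_image \<gamma>)" using elim inside_Un_outside by blast
        then have "winding_number \<gamma> z = 0"
          by (rule winding_number_zero_in_outside[OF valid_path_imp_path[OF valid] closed])
        then show ?thesis using False * by simp
      qed
    qed
    then have "(\<integral>z. (\<integral>u. g u z \<partial>lborel) \<partial>lborel) = (\<integral>z. indicator (inside (path_image \<gamma>)) z *\<^sub>R (2 * pi * \<i>) \<partial>lborel)"
      using open_inside by (intro integral_cong_AE) auto
    also have "\<dots> = measure lborel (inside (path_image \<gamma>)) *\<^sub>R (2 * pi * \<i>)"
    proof -
      have "bounded (inside (path_image \<gamma>))" using bounded_subset[OF bounded_cbox inQ[unfolded Qbox]] .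
      then have "emeasure lborel (inside (path_image \<gamma>)) < \<infinity>" by (rule emeasure_bounded_finite)
      then show ?thesis using open_inside by (subst integral_scaleR_left) (auto simp: less_top)
    qed
    finally show ?thesis using open_inside by (simp add: enclosed_area_def scaleR_conv_of_real mult.commute)
  qed
  define \<Phi> where "\<Phi> w = Ln (R + w) - Ln (R - w)" for w :: complex
  define S where "S = {w::complex. \<bar>Re w\<bar> < R}"
  have \<Phi>hol: "\<Phi> holomorphic_on S"
    unfolding \<Phi>_def[abs_def] S_def by (intro holomorphic_intros) (auto simp: complex_nonpos_Reals_iff)
  have \<Phi>cont: "continuous_on S \<Phi>" by (rule holomorphic_on_imp_continuous_on[OF \<Phi>hol])
  define J where "J u = integral {-R..R} (\<lambda>y. \<Phi> (\<gamma> u - \<i> * complex_of_real y))" for u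
  have \<Phi>int: "(\<lambda>y. \<Phi> (\<gamma> u - \<i> * complex_of_real y)) integrable_on {-R..R}" for u
    by (intro integrable_continuous_real continuous_on_compose2[OF \<Phi>cont] continuous_intros) (use R in \<open>auto simp: S_def\<close>)
  have right: "(\<integral>z. g u z \<partial>lborel) = indicator {0..1} u *\<^sub>R (p u * J u - 2 * pi * \<i> * (Im (\<gamma> u) * p u))" for u
  proof (cases "u \<in> {0..1}")
    case True
    define G where "G x y = g u (Complex x y)" for x y
    have int_G: "integrable (lborel \<Otimes>\<^sub>M lborel) (\<lambda>(x, y). G x y)"
      using int_gu[of u] unfolding G_def split_beta'
      by (subst (asm) lborel_complex, subst (asm) integrable_distr_eq) auto
    have 1: "(\<integral>z. g u z \<partial>lborel) = (\<integral>y. (\<integral>x. G x y \<partial>lborel) \<partial>lborel)"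
      unfolding lborel_pair.integral_snd[OF int_G] unfolding G_def split_beta'
      by (subst lborel_complex, subst integral_distr) auto
    have "AE y in lborel. y \<noteq> Im (\<gamma> u)" by (rule AE_lborel_singleton)
    then have AE: "AE y in lborel. (\<integral>x. G x y \<partial>lborel) =
       indicator {-R..R} y *\<^sub>R (p u * (\<Phi> (\<gamma> u - \<i> * complex_of_real y) - \<i> * pi * sgn (Im (\<gamma> u) - y)))"
    proof eventually_elim
      case (elim y)
      then have nz: "\<gamma> u - Complex x y \<noteq> 0" for x by (auto simp: complex_eq_iff)
      have "(\<integral>x. G x y \<partial>lborel) = indicator {-R..R} y *\<^sub>R (p u * (LINT x:{-R..R}|lborel. 1 / (\<gamma> u - Complex x y)))"
        unfolding set_lebesgue_integral_def integral_scaleR_right[symmetric] integral_mult_right_zero[symmetric]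
        by (intro Bochner_Integration.integral_cong) (use True in \<open>auto simp: G_def g_def Q_def indicator_def\<close>)
      also have "(LINT x:{-R..R}|lborel. 1 / (\<gamma> u - Complex x y)) = integral {-R..R} (\<lambda>x. 1 / (\<gamma> u - Complex x y))"
        by (intro set_borel_integral_eq_integral borel_integrable_atLeastAtMost')
          (use nz in \<open>auto intro!: continuous_intros simp: Complex_eq\<close>)
      also have "\<dots> = \<Phi> (\<gamma> u - \<i> * complex_of_real y) - \<i> * pi * sgn (Im (\<gamma> u) - y)"
        unfolding \<Phi>_def using R[of u] elim by (intro integral_unique inverse_line_integral) auto
      finally show ?case .
    qed
    have meas: "(\<lambda>y. indicator {-R..R} y *\<^sub>R (p u * (\<Phi> (\<gamma> u - \<i> * complex_of_real y) - \<i> * pi * sgn (Im (\<gamma> u) - y)))) \<in> borel_measurable lborel"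
      unfolding \<Phi>_def by measurable
    have I: "integrable lborel (\<lambda>y. \<integral>x. G x y \<partial>lborel)"
      by (rule lborel_pair.integrable_snd[OF int_G])
    have set: "set_integrable lborel {-R..R} (\<lambda>y. p u * (\<Phi> (\<gamma> u - \<i> * complex_of_real y) - \<i> * pi * sgn (Im (\<gamma> u) - y)))"
      unfolding set_integrable_def
      using I integrable_cong_AE[OF borel_measurable_integrable[OF I] meas AE] by blast
    have "(\<integral>y. (\<integral>x. G x y \<partial>lborel) \<partial>lborel) = (LINT y:{-R..R}|lborel. p u * (\<Phi> (\<gamma> u - \<i> * complex_of_real y) - \<i> * pi * sgn (Im (\<gamma> u) - y)))"
      unfolding set_lebesgue_integral_def
      by (rule integral_cong_AE[OF _ meas AE]) (rule borel_measurable_integrable[OF I])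
    also have "\<dots> = integral {-R..R} (\<lambda>y. p u * (\<Phi> (\<gamma> u - \<i> * complex_of_real y) - \<i> * pi * sgn (Im (\<gamma> u) - y)))"
      by (rule set_borel_integral_eq_integral[OF set])
    also have "\<dots> = p u * (J u - \<i> * pi * (2 * Im (\<gamma> u)))"
    proof (intro integral_unique has_integral_mult_right has_integral_diff)
      show "((\<lambda>y. \<Phi> (\<gamma> u - \<i> * complex_of_real y)) has_integral J u) {-R..R}"
        unfolding J_def by (rule integrable_integral[OF \<Phi>int])
      have "((\<lambda>y. sgn (Im (\<gamma> u) - y)) has_integral 2 * Im (\<gamma> u)) {-R..R}"
        using R[of u] by (intro has_integral_sgn) auto
      from has_integral_of_real[OF this]
      show "((\<lambda>y. complex_of_real (sgn (Im (\<gamma> u) - y))) has_integral (2 * Im (\<gamma> u))) {-R..R}" by simp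
    qed
    finally show ?thesis using 1 True by (simp add: algebra_simps)
  qed (simp add: g_def)
  have contJ': "continuous_on (cbox (0, -R) (1, R)) (\<lambda>(u, y). p u * \<Phi> (\<gamma> u - \<i> * complex_of_real y))"
    unfolding split_beta
    by (intro continuous_intros continuous_on_compose2[OF cont_p[of UNIV]] continuous_on_compose2[OF \<Phi>cont] continuous_on_compose2[OF cont_\<gamma>[of UNIV]])
      (use R in \<open>auto simp: S_def\<close>)
  have "continuous_on {0..1} J"
    unfolding J_def cbox_interval[symmetric]
  proof (rule integral_continuous_on_param)
    show "continuous_on (cbox 0 1 \<times> cbox (- R) R) (\<lambda>(u, y). \<Phi> (\<gamma> u - \<i> * complex_of_real y))"
      unfolding split_beta
      by (intro continuous_intros continuous_on_compose2[OF \<Phi>cont] continuous_on_compose2[OF cont_\<gamma>[of UNIV]])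
        (use R in \<open>auto simp: S_def\<close>)
  qed
  then have contJ: "continuous_on {0..1} (\<lambda>u. p u * J u)" by (intro continuous_intros cont_p)
  \<comment> \<open>The integration over \<open>y\<close> is moved outside; for each fixed
    \<open>y\<close> there remains a contour integral of a function holomorphic in the convex strip
    \<open>S\<close>, which vanishes by Cauchy's theorem.\<close>
  have J0: "integral {0..1} (\<lambda>u. p u * J u) = 0"
  proof -
    have "integral {0..1} (\<lambda>u. p u * J u) = integral (cbox 0 1) (\<lambda>u. integral (cbox (-R) R) (\<lambda>y. p u * \<Phi> (\<gamma> u - \<i> * complex_of_real y)))"
      unfolding J_def by simp
    also have "\<dots> = integral (cbox (-R) R) (\<lambda>y. integral (cbox 0 1) (\<lambda>u. p u * \<Phi> (\<gamma> u - \<i> * complex_of_real y)))"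
      by (rule integral_swap_continuous[OF contJ'])
    also have "\<dots> = integral (cbox (-R) R) (\<lambda>y. 0)"
    proof (rule integral_cong)
      fix y
      have "((\<lambda>w. \<Phi> (w - \<i> * complex_of_real y)) has_contour_integral 0) \<gamma>"
      proof (rule Cauchy_theorem_convex_simple[OF _ _ valid _ closed])
        show "convex S" unfolding S_def abs_less_iff
          using convex_Int[OF convex_halfspace_Re_lt[of R] convex_halfspace_Re_gt[of "-R"]]
          by (rule back_subst[of convex]) auto
        show "(\<lambda>w. \<Phi> (w - \<i> * complex_of_real y)) holomorphic_on S"
          by (rule holomorphic_on_compose_gen[OF _ \<Phi>hol, unfolded o_def]) (auto intro!: holomorphic_intros simp: S_def)
        show "path_image \<gamma> \<subseteq> S" unfolding range_eq[symmetric] S_def using R by auto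
      qed
      from contour_integral_unique[OF this]
      show "integral (cbox 0 1) (\<lambda>u. p u * \<Phi> (\<gamma> u - \<i> * complex_of_real y)) = 0"
        unfolding contour_integral_eq by (simp add: mult.commute)
    qed
    finally show ?thesis by simp
  qed
  define K where "K = integral {0..1} (\<lambda>u. Im (\<gamma> u) * p u)"
  have contK: "continuous_on {0..1} (\<lambda>u. Im (\<gamma> u) * p u)" by (intro continuous_intros cont_p cont_\<gamma>)
  have "(\<integral>u. (\<integral>z. g u z \<partial>lborel) \<partial>lborel) = (LINT u:{0..1}|lborel. p u * J u - 2 * pi * \<i> * (Im (\<gamma> u) * p u))"
    unfolding right set_lebesgue_integral_def ..
  also have "\<dots> = integral {0..1} (\<lambda>u. p u * J u - 2 * pi * \<i> * (Im (\<gamma> u) * p u))"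
    by (intro set_borel_integral_eq_integral borel_integrable_atLeastAtMost' continuous_on_diff contJ continuous_on_mult_left contK)
  also have "\<dots> = - (2 * pi * \<i> * K)"
    unfolding K_def
    by (subst integral_diff) (auto intro!: integrable_continuous_real contJ contK continuous_on_mult_left simp: J0)
  finally have "2 * pi * \<i> * enclosed_area \<gamma> = - (2 * pi * \<i> * K)" using fubini left by simp
  then have "(2 * pi * \<i>) * complex_of_real (enclosed_area \<gamma>) = (2 * pi * \<i>) * (- K)" by simp
  then have "complex_of_real (enclosed_area \<gamma>) = - K" by (subst (asm) mult_cancel_left) auto
  then have "enclosed_area \<gamma> = - Re K" by (simp add: complex_eq_iff)
  also have "Re K = integral {0..1} (\<lambda>u. Re (Im (\<gamma> u) * p u))"
    unfolding K_def
    using integral_linear[OF integrable_continuous_real[OF contK] bounded_linear_Re] by (simp add: o_def)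
  finally show ?thesis by simp
qed

text \<open>The inward normal exhibits a point of the open inside. Boundedness matters too:
  \<open>measure\<close> is 0 on sets of infinite measure.\<close>

lemma enclosed_area_pos: "enclosed_area \<gamma> > 0"
proof -
  have op: "open (inside (path_image \<gamma>))"
    by (intro open_inside closed_path_image simple_path_imp_path simple)
  have "\<exists>z. z \<in> inside (path_image \<gamma>)"
    using eventually_happens'[OF _ inward[of 0]] by (auto simp: trivial_limit_at_right_real)
  then have "\<not> negligible (inside (path_image \<gamma>))" using op open_not_negligible by blast
  moreover have "bounded (inside (path_image \<gamma>))"
    by (intro bounded_inside bounded_range)
  then have "inside (path_image \<gamma>) \<in> lmeasurable" using op by (rule lmeasurable_open)
  ultimately show ?thesis unfolding enclosed_area_def by (simp add: negligible_iff_measure zero_less_measure_iff)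
qed

lemma length_pos: "curve_length \<gamma> > 0"
proof -
  have "integral {0..1} \<sigma> \<noteq> 0"
    using integral_eq_0_iff[of 0 1 \<sigma>] cont_speed by (auto simp: less_imp_le intro: exI[of _ 0])
  moreover have "integral {0..1} \<sigma> \<ge> 0" by (intro integral_nonneg integrable_continuous_real cont_speed) (auto simp: less_imp_le)
  ultimately show ?thesis by (simp add: curve_length_def)
qed

end

section \<open>The isoperimetric inequality\<close>

lemma FTC_real:
  fixes F :: "real \<Rightarrow> real"
  assumes "a \<le> b" "\<And>x. x \<in> {a..b} \<Longrightarrow> (F has_real_derivative f x) (at x)"
  shows "(f has_integral F b - F a) {a..b}"
  by (rule fundamental_theorem_of_calculus[OF assms(1)
        has_vector_derivative_at_within[OF assms(2)[unfolded has_real_derivative_iff_has_vector_derivative]]])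

lemma integral_by_parts_periodic:
  fixes f :: "real \<Rightarrow> real"
  assumes "\<And>u. (f has_real_derivative f' u) (at u)" "f 1 = f 0"
  shows "(f' has_integral 0) {0..1}"
  using FTC_real[of 0 1 f f'] assms by simp

text \<open>The function \<open>W = y\<^sup>2 cot \<phi>\<close> extends by zero to the end points, and
  \<open>y'\<^sup>2 / \<phi>' - y\<^sup>2 \<phi>' - W' = (y' - y \<phi>' cot \<phi>)\<^sup>2 / \<phi>' \<ge> 0\<close>.\<close>
lemma wirtinger_half_turn:
  fixes y \<phi> :: "real \<Rightarrow> real"
  assumes ab: "a < b"
    and dy: "\<And>u. u \<in> {a..b} \<Longrightarrow> (y has_real_derivative y' u) (at u)"
    and d\<phi>: "\<And>u. u \<in> {a..b} \<Longrightarrow> (\<phi> has_real_derivative \<phi>' u) (at u)"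
    and cont: "continuous_on {a..b} y'" "continuous_on {a..b} \<phi>'"
    and pos: "\<And>u. u \<in> {a..b} \<Longrightarrow> \<phi>' u > 0"
    and ends: "\<phi> a = 0" "\<phi> b = pi" "y a = 0" "y b = 0"
  shows "integral {a..b} (\<lambda>u. (y u)\<^sup>2 * \<phi>' u) \<le> integral {a..b} (\<lambda>u. (y' u)\<^sup>2 / \<phi>' u)"
proof -
  have cy: "continuous_on {a..b} y" "continuous_on {a..b} \<phi>"
    using dy d\<phi> DERIV_isCont continuous_at_imp_continuous_on by blast+
  have mono: "\<phi> u < \<phi> v" if "a \<le> u" "u < v" "v \<le> b" for u v
  proof (rule DERIV_pos_imp_increasing[OF that(2)])
    fix x assume "u \<le> x" "x \<le> v"
    then have "x \<in> {a..b}" using that by simp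
    from d\<phi>[OF this] pos[OF this] show "\<exists>l. (\<phi> has_real_derivative l) (at x) \<and> 0 < l" by blast
  qed
  have \<phi>_in: "0 < \<phi> u" "\<phi> u < pi" if "u \<in> {a<..<b}" for u
    using mono[of a u] mono[of u b] that ends by auto
  have s_pos: "sin (\<phi> u) > 0" if "u \<in> {a<..<b}" for u using \<phi>_in[OF that] by (simp add: sin_gt_zero)
  define W where "W u = (y u)\<^sup>2 * cos (\<phi> u) / sin (\<phi> u)" for u
  \<comment> \<open>At an end point numerator and denominator vanish to first order, so their
    quotient tends to the ratio of the derivatives. The remaining factor
    \<open>y u * cos (\<phi> u)\<close> then sends \<open>W\<close> to 0.\<close>
  have lim: "((\<lambda>u. y u / sin (\<phi> u)) \<longlongrightarrow> y' c / (cos (\<phi> c) * \<phi>' c)) (at c within {a..b})"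
    if c: "c \<in> {a..b}" and c0: "y c = 0" "sin (\<phi> c) = 0" for c
  proof -
    have 1: "((\<lambda>u. (y u - y c) / (u - c)) \<longlongrightarrow> y' c) (at c)"
      using dy[OF c] by (simp add: has_field_derivative_iff)
    have "((\<lambda>u. sin (\<phi> u)) has_real_derivative cos (\<phi> c) * \<phi>' c) (at c)"
      using d\<phi>[OF c] by (auto intro!: derivative_eq_intros)
    then have 2: "((\<lambda>u. (sin (\<phi> u) - sin (\<phi> c)) / (u - c)) \<longlongrightarrow> cos (\<phi> c) * \<phi>' c) (at c)"
      by (simp add: has_field_derivative_iff)
    have "cos (\<phi> c) \<noteq> 0" using c0(2) sin_cos_squared_add[of "\<phi> c"] by auto
    then have "((\<lambda>u. ((y u - y c) / (u - c)) / ((sin (\<phi> u) - sin (\<phi> c)) / (u - c))) \<longlongrightarrow> y' c / (cos (\<phi> c) * \<phi>' c)) (at c)"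
      using pos[OF c] by (intro tendsto_divide 1 2) auto
    then have "((\<lambda>u. y u / sin (\<phi> u)) \<longlongrightarrow> y' c / (cos (\<phi> c) * \<phi>' c)) (at c)"
      by (rule Lim_transform_eventually) (auto simp: c0 eventually_at_filter)
    then show ?thesis by (rule tendsto_within_subset) auto
  qed
  have contW: "continuous_on {a..b} W"
    unfolding continuous_on_def
  proof
    fix c assume c: "c \<in> {a..b}"
    have t: "(y \<longlongrightarrow> y c) (at c within {a..b})" "(\<phi> \<longlongrightarrow> \<phi> c) (at c within {a..b})"
      using cy c unfolding continuous_on_def by blast+
    have W_eq: "W = (\<lambda>u. y u * cos (\<phi> u) * (y u / sin (\<phi> u)))"
      by (simp add: W_def power2_eq_square fun_eq_iff)
    show "(W \<longlongrightarrow> W c) (at c within {a..b})"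
    proof (cases "c = a \<or> c = b")
      case True
      then have c0: "y c = 0" "sin (\<phi> c) = 0" using ends by auto
      have "((\<lambda>u. y u * cos (\<phi> u) * (y u / sin (\<phi> u))) \<longlongrightarrow> y c * cos (\<phi> c) * (y' c / (cos (\<phi> c) * \<phi>' c))) (at c within {a..b})"
        by (intro tendsto_mult lim c0 c tendsto_cos t)
      then show ?thesis by (simp add: W_eq c0)
    next
      case False
      then have "sin (\<phi> c) \<noteq> 0" using c s_pos[of c] by auto
      then show ?thesis unfolding W_eq
        by (intro tendsto_mult tendsto_divide tendsto_cos tendsto_sin t)
    qed
  qed
  define g where "g u = (y' u)\<^sup>2 / \<phi>' u - (y u)\<^sup>2 * \<phi>' u" for u
  have contg: "continuous_on {a..b} g"
    unfolding g_def by (intro continuous_intros cont cy) (use pos in force)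
  define F where "F u = integral {a..u} g - W u" for u
  have "F a \<le> F b"
  proof (rule DERIV_nonneg_imp_increasing_open[OF less_imp_le[OF ab]])
    show "continuous_on {a..b} F" unfolding F_def
      by (intro continuous_intros contW indefinite_integral_continuous_1 integrable_continuous_real contg)
    fix u assume u: "a < u" "u < b"
    then have uu: "u \<in> {a..b}" "u \<in> {a<..<b}" by auto
    have "((\<lambda>u. integral {a..u} g) has_vector_derivative g u) (at u within {a..b})"
      by (rule integral_has_vector_derivative[OF contg uu(1)])
    then have I: "((\<lambda>u. integral {a..u} g) has_real_derivative g u) (at u)"
      using u by (simp add: has_real_derivative_iff_has_vector_derivative at_within_Icc_at)
    have s: "sin (\<phi> u) \<noteq> 0" using s_pos[OF uu(2)] by simp
    have dc: "((\<lambda>u. cos (\<phi> u)) has_real_derivative - sin (\<phi> u) * \<phi>' u) (at u)"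
      by (rule DERIV_fun_cos[OF d\<phi>[OF uu(1)]])
    have ds: "((\<lambda>u. sin (\<phi> u)) has_real_derivative cos (\<phi> u) * \<phi>' u) (at u)"
      by (rule DERIV_fun_sin[OF d\<phi>[OF uu(1)]])
    have dn: "((\<lambda>u. (y u)\<^sup>2 * cos (\<phi> u)) has_real_derivative
        2 * y u * y' u * cos (\<phi> u) - (y u)\<^sup>2 * sin (\<phi> u) * \<phi>' u) (at u)"
      by (rule derivative_eq_intros dy[OF uu(1)] dc refl)+ simp
    have dW: "(W has_real_derivative ((2 * y u * y' u * cos (\<phi> u) - (y u)\<^sup>2 * sin (\<phi> u) * \<phi>' u) * sin (\<phi> u)
        - (y u)\<^sup>2 * cos (\<phi> u) * (cos (\<phi> u) * \<phi>' u)) / (sin (\<phi> u))\<^sup>2) (at u)"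
      using DERIV_divide[OF dn ds s] unfolding W_def[abs_def] by (simp only: power2_eq_square[of "sin _"])
    have ph: "\<phi>' u > 0" by (rule pos[OF uu(1)])
    have "g u - ((2 * y u * y' u * cos (\<phi> u) - (y u)\<^sup>2 * sin (\<phi> u) * \<phi>' u) * sin (\<phi> u)
        - (y u)\<^sup>2 * cos (\<phi> u) * (cos (\<phi> u) * \<phi>' u)) / (sin (\<phi> u))\<^sup>2
        = (y' u * sin (\<phi> u) - y u * \<phi>' u * cos (\<phi> u))\<^sup>2 / (\<phi>' u * (sin (\<phi> u))\<^sup>2)"
      using s ph unfolding g_def by (simp add: field_simps power2_eq_square)
    also have "\<dots> \<ge> 0" using ph by simp
    finally show "\<exists>l. (F has_real_derivative l) (at u) \<and> 0 \<le> l"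
      unfolding F_def[abs_def] using DERIV_diff[OF I dW] by blast
  qed
  then have "0 \<le> integral {a..b} g" using ends by (simp add: F_def W_def)
  also have "integral {a..b} g = integral {a..b} (\<lambda>u. (y' u)\<^sup>2 / \<phi>' u) - integral {a..b} (\<lambda>u. (y u)\<^sup>2 * \<phi>' u)"
    unfolding g_def by (rule integral_diff; intro integrable_continuous_real continuous_intros cont cy) (use pos in force)+
  finally show ?thesis by simp
qed

text \<open>The half circle over its diameter is extremal. For \<open>d > 0\<close> one has
  \<open>- 2 * y * x' \<le> y^2 * d + x'^2 / d\<close>. Take \<open>d = c * \<sigma>\<close> with
  \<open>c = pi / l\<close>, so that the phase \<open>c * (S u - S a)\<close> makes exactly a half
  turn. Once \<open>x'^2\<close> is replaced by \<open>\<sigma>^2 - y'^2\<close>, the terms in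
  \<open>y\<close> are nonpositive in total by \<open>wirtinger_half_turn\<close>, and
  \<open>l / (2 * c)\<close> is left.\<close>

lemma arc_area_bound:
  fixes x y \<sigma> S :: "real \<Rightarrow> real"
  assumes ab: "a < b"
    and dx: "\<And>u. u \<in> {a..b} \<Longrightarrow> (x has_real_derivative x' u) (at u)"
    and dy: "\<And>u. u \<in> {a..b} \<Longrightarrow> (y has_real_derivative y' u) (at u)"
    and dS: "\<And>u. u \<in> {a..b} \<Longrightarrow> (S has_real_derivative \<sigma> u) (at u)"
    and cont: "continuous_on {a..b} x'" "continuous_on {a..b} y'" "continuous_on {a..b} \<sigma>"
    and pos: "\<And>u. u \<in> {a..b} \<Longrightarrow> \<sigma> u > 0"
    and speed: "\<And>u. u \<in> {a..b} \<Longrightarrow> (x' u)\<^sup>2 + (y' u)\<^sup>2 = (\<sigma> u)\<^sup>2"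
    and ends: "y a = 0" "y b = 0"
  shows "- integral {a..b} (\<lambda>u. y u * x' u) \<le> (S b - S a)\<^sup>2 / (2 * pi)"
proof -
  define l where "l = S b - S a"
  have "S a < S b"
    using pos dS by (intro DERIV_pos_imp_increasing[OF ab]) force
  then have l: "l > 0" by (simp add: l_def)
  define c where "c = pi / l"
  have c: "c > 0" using l by (simp add: c_def)
  have cy: "continuous_on {a..b} y"
    using dy DERIV_isCont continuous_at_imp_continuous_on by blast
  have W: "integral {a..b} (\<lambda>u. (y u)\<^sup>2 * (c * \<sigma> u)) \<le> integral {a..b} (\<lambda>u. (y' u)\<^sup>2 / (c * \<sigma> u))"
  proof (rule wirtinger_half_turn[OF ab dy])
    show "((\<lambda>u. c * (S u - S a)) has_real_derivative c * \<sigma> u) (at u)" if "u \<in> {a..b}" for u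
      using dS[OF that] by (auto intro!: derivative_eq_intros)
  qed (use l c pos in \<open>auto intro!: continuous_intros cont simp: ends c_def l_def\<close>)
  have int: "(\<lambda>u. (y u)\<^sup>2 * (c * \<sigma> u)) integrable_on {a..b}" "(\<lambda>u. (y' u)\<^sup>2 / (c * \<sigma> u)) integrable_on {a..b}"
    "\<sigma> integrable_on {a..b}" "(\<lambda>u. - (y u * x' u)) integrable_on {a..b}"
    by (intro integrable_continuous_real continuous_intros cont cy; use pos c in force)+
  have "- integral {a..b} (\<lambda>u. y u * x' u) = integral {a..b} (\<lambda>u. - (y u * x' u))" by simp
  also have "\<dots> \<le> integral {a..b} (\<lambda>u. ((y u)\<^sup>2 * (c * \<sigma> u) - (y' u)\<^sup>2 / (c * \<sigma> u) + \<sigma> u / c) / 2)"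
  proof (rule integral_le[OF int(4)])
    show "(\<lambda>u. ((y u)\<^sup>2 * (c * \<sigma> u) - (y' u)\<^sup>2 / (c * \<sigma> u) + \<sigma> u / c) / 2) integrable_on {a..b}"
      by (intro integrable_continuous_real continuous_intros cont cy) (use pos c in force)+
    fix u assume u: "u \<in> {a..b}"
    define d where "d = c * \<sigma> u"
    have d: "d > 0" using c pos[OF u] by (simp add: d_def)
    have "\<sigma> u / c = (\<sigma> u)\<^sup>2 / d" using c pos[OF u] by (simp add: d_def power2_eq_square)
    also have "\<dots> = ((x' u)\<^sup>2 + (y' u)\<^sup>2) / d" by (simp add: speed[OF u])
    finally have "(y u)\<^sup>2 * d - (y' u)\<^sup>2 / d + \<sigma> u / c = (y u)\<^sup>2 * d + (x' u)\<^sup>2 / d"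
      by (simp add: add_divide_distrib)
    also have "\<dots> = (y u * d + x' u)\<^sup>2 / d - 2 * (y u * x' u)"
      using d by (simp add: field_simps power2_eq_square)
    also have "\<dots> \<ge> - 2 * (y u * x' u)" using d by simp
    finally show "- (y u * x' u) \<le> ((y u)\<^sup>2 * (c * \<sigma> u) - (y' u)\<^sup>2 / (c * \<sigma> u) + \<sigma> u / c) / 2"
      by (simp add: d_def)
  qed
  also have "\<dots> = (integral {a..b} (\<lambda>u. (y u)\<^sup>2 * (c * \<sigma> u)) - integral {a..b} (\<lambda>u. (y' u)\<^sup>2 / (c * \<sigma> u))
      + integral {a..b} \<sigma> / c) / 2"
    by (intro integral_unique has_integral_divide has_integral_add has_integral_diff integrable_integral int)
  also have "integral {a..b} \<sigma> = l"
    unfolding l_def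
    by (rule integral_unique[OF fundamental_theorem_of_calculus[OF less_imp_le[OF ab]
        has_vector_derivative_at_within[OF dS[unfolded has_real_derivative_iff_has_vector_derivative]]]])
  also have "(integral {a..b} (\<lambda>u. (y u)\<^sup>2 * (c * \<sigma> u)) - integral {a..b} (\<lambda>u. (y' u)\<^sup>2 / (c * \<sigma> u))
      + l / c) / 2 \<le> (l / c) / 2"
    using W by (intro divide_right_mono) auto
  also have "(l / c) / 2 = l\<^sup>2 / (2 * pi)" using l by (simp add: c_def power2_eq_square)
  finally show ?thesis by (simp add: l_def)
qed

context jordan_curve
begin

text \<open>The base point \<open>c\<close> is free because the curve is closed: moving it adds an
  exact derivative. The isoperimetric inequality takes it on the curve, Gage's inequality at a
  special centre.\<close>

lemma area_det: "((\<lambda>u. Im (cnj (\<gamma> u - c) * p u)) has_integral 2 * enclosed_area \<gamma>) {0..1}"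
proof -
  have "((\<lambda>u. Re (\<gamma> u) * Im (\<gamma> u) - Re c * Im (\<gamma> u) + Im c * Re (\<gamma> u)) has_real_derivative
      Im (cnj (\<gamma> u - c) * p u) + 2 * (Im (\<gamma> u) * Re (p u))) (at u)" for u
    by (rule derivative_eq_intros has_vector_derivative_Re[OF deriv_\<gamma>] has_vector_derivative_Im[OF deriv_\<gamma>] refl)+
      (simp add: algebra_simps)
  from integral_by_parts_periodic[OF this] have
    1: "((\<lambda>u. Im (cnj (\<gamma> u - c) * p u) + 2 * (Im (\<gamma> u) * Re (p u))) has_integral 0) {0..1}"
    using periodic[of 0] by simp
  have "((\<lambda>u. Im (\<gamma> u) * Re (p u)) has_integral - enclosed_area \<gamma>) {0..1}"
    unfolding enclosed_area_eq minus_minus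
    by (intro integrable_integral integrable_continuous_real continuous_intros cont_p cont_\<gamma>)
  from has_integral_diff[OF 1 has_integral_mult_right[OF this, of 2]] show ?thesis by simp
qed

lemma arc_length_function:
  obtains S where "\<And>u. (S has_real_derivative \<sigma> u) (at u)" "S 0 = 0" "S 1 = curve_length \<gamma>"
proof -
  obtain F where F: "\<And>u. (F has_vector_derivative \<sigma> u) (at u)"
    using antiderivative_on_UNIV[OF cont_speed] by blast
  have "(\<sigma> has_integral F 1 - F 0) {0..1}"
    by (rule fundamental_theorem_of_calculus[OF _ has_vector_derivative_at_within[OF F]]) simp
  then have "F 1 - F 0 = curve_length \<gamma>" by (simp add: curve_length_def integral_unique)
  moreover have "((\<lambda>u. F u - F 0) has_real_derivative \<sigma> u) (at u)" for u
    using F[of u] by (auto intro!: derivative_eq_intros simp: has_real_derivative_iff_has_vector_derivative[symmetric])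
  ultimately show ?thesis by (intro that[of "\<lambda>u. F u - F 0"]) auto
qed

text \<open>The curve is cut at half its length, and the line through the two cut points becomes the
  real axis, so each arc meets the end conditions of \<open>arc_area_bound\<close>. Two arcs of
  length \<open>L / 2\<close> contribute \<open>L^2 / (8 * pi)\<close> each.\<close>

lemma isoperimetric_inequality: "4 * pi * enclosed_area \<gamma> \<le> (curve_length \<gamma>)\<^sup>2"
proof -
  obtain S where S: "\<And>u. (S has_real_derivative \<sigma> u) (at u)" "S 0 = 0" "S 1 = curve_length \<gamma>"
    by (rule arc_length_function) (rule that)
  define L where "L = curve_length \<gamma>"
  have L: "L > 0" using length_pos by (simp add: L_def)
  have S1: "S 1 = L" by (simp add: L_def S(3))
  have "\<exists>m\<ge>0. m \<le> 1 \<and> S m = L / 2"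
    by (rule IVT) (use L in \<open>simp_all add: S(2) S1 DERIV_isCont[OF S(1)]\<close>)
  then obtain m where m: "0 \<le> m" "m \<le> 1" "S m = L / 2" by (elim exE conjE)
  have "m \<noteq> 0" "m \<noteq> 1" using S(2) S1 m(3) L by (intro notI; simp)+
  then have m01: "0 < m" "m < 1" using m(1,2) by simp_all
  \<comment> \<open>The rotation that takes the direction from \<open>\<gamma> 0\<close> to
    \<open>\<gamma> m\<close> to the positive real axis.\<close>
  define e where "e = cnj (sgn (\<gamma> m - \<gamma> 0))"
  have "\<gamma> 0 \<noteq> \<gamma> m" using inj_lt[of 0 m] m01 by simp
  then have ne: "norm e = 1" by (simp add: e_def norm_sgn)
  define X where "X u = e * (\<gamma> u - \<gamma> 0)" for u
  have Xm: "Im (X m) = 0"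
  proof -
    have "cnj (sgn D) * D = complex_of_real (cmod D)" for D
      by (cases "D = 0") (simp_all add: sgn_eq complex_norm_square[symmetric] mult.commute[of "cnj D"] power2_eq_square)
    from this[of "\<gamma> m - \<gamma> 0"] show ?thesis by (simp add: X_def e_def del: complex_cnj_diff)
  qed
  have "\<gamma> 1 = \<gamma> 0" using periodic[of 0] by simp
  then have X01: "X 0 = 0" "X 1 = 0" by (simp_all add: X_def)
  have dX: "(X has_vector_derivative e * p u) (at u)" for u
  proof -
    have "((\<lambda>u. \<gamma> u - \<gamma> 0) has_vector_derivative p u) (at u)"
      using has_vector_derivative_diff[OF deriv_\<gamma>[of u UNIV] has_vector_derivative_const[of "\<gamma> 0"]] by simp
    from has_vector_derivative_mult_right[OF this, of e] show ?thesis by (simp add: X_def[abs_def])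
  qed
  have dRe: "((\<lambda>u. Re (X u)) has_real_derivative Re (e * p u)) (at u)"
    and dIm: "((\<lambda>u. Im (X u)) has_real_derivative Im (e * p u)) (at u)" for u
    by (rule has_vector_derivative_Re[OF dX], rule has_vector_derivative_Im[OF dX])
  have "((\<lambda>u. Re (X u) * Im (X u)) has_real_derivative Im (cnj (X u) * (e * p u)) + 2 * (Im (X u) * Re (e * p u))) (at u)" for u
    by (rule DERIV_cong[OF DERIV_mult[OF dRe dIm]]) (simp add: algebra_simps)
  from integral_by_parts_periodic[OF this] X01 have
    1: "((\<lambda>u. Im (cnj (X u) * (e * p u)) + 2 * (Im (X u) * Re (e * p u))) has_integral 0) {0..1}" by simp
  have eq: "cnj (X u) * (e * p u) = cnj (\<gamma> u - \<gamma> 0) * p u" for u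
  proof -
    have "cnj (X u) * (e * p u) = (e * cnj e) * (cnj (\<gamma> u - \<gamma> 0) * p u)" by (simp add: X_def mult_ac)
    also have "e * cnj e = 1" using ne by (metis complex_norm_square of_real_1 power_one)
    finally show ?thesis by simp
  qed
  have 2: "((\<lambda>u. Im (cnj (X u) * (e * p u))) has_integral 2 * enclosed_area \<gamma>) {0..1}"
    unfolding eq by (rule area_det)
  have cX: "continuous_on A X" for A
    unfolding X_def[abs_def] by (intro continuous_intros cont_\<gamma>)
  have bound: "- integral {a..b} (\<lambda>u. Im (X u) * Re (e * p u)) \<le> (S b - S a)\<^sup>2 / (2 * pi)"
    if "a < b" "Im (X a) = 0" "Im (X b) = 0" for a b
  proof (rule arc_area_bound[OF that(1) dRe dIm S(1) _ _ cont_speed speed_pos _ that(2,3)])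
    show "(Re (e * p u))\<^sup>2 + (Im (e * p u))\<^sup>2 = (\<sigma> u)\<^sup>2" for u
      unfolding cmod_power2[symmetric] by (simp add: norm_mult ne speed_eq)
  qed (intro continuous_intros cont_p)+
  from has_integral_diff[OF 1 2] have "((\<lambda>u. 2 * (Im (X u) * Re (e * p u))) has_integral - (2 * enclosed_area \<gamma>)) {0..1}"
    by simp
  from has_integral_mult_right[OF this, of "-1/2"]
  have "enclosed_area \<gamma> = - integral {0..1} (\<lambda>u. Im (X u) * Re (e * p u))"
    by (simp add: integral_unique has_integral_neg_iff)
  also have "\<dots> = - integral {0..m} (\<lambda>u. Im (X u) * Re (e * p u)) + - integral {m..1} (\<lambda>u. Im (X u) * Re (e * p u))"
    by (subst Henstock_Kurzweil_Integration.integral_combine[OF m(1,2), symmetric])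
      (auto intro!: integrable_continuous_real continuous_intros cX cont_p)
  also have "\<dots> \<le> (S m - S 0)\<^sup>2 / (2 * pi) + (S 1 - S m)\<^sup>2 / (2 * pi)"
    using bound[of 0 m] bound[of m 1] m01 Xm X01 by simp
  also have "\<dots> = L\<^sup>2 / (4 * pi)" using S(2) S1 m(3) by (simp add: field_simps power2_eq_square)
  finally show ?thesis by (simp add: L_def field_simps)
qed

end

section \<open>Gage's inequality\<close>

text \<open>The value is tuned to \<open>mult_sin_le_2\<close>: together with
  \<open>sqrt 3 \<le> 26 / 15\<close> it gives \<open>2 * pi / 3 + sqrt 3 \<le> 4\<close> with
  nothing to spare. A larger \<open>pi\<close> would make \<open>sin (17/30)\<close> at most
  \<open>sin (pi / 6)\<close>, against the linear Taylor polynomial with its cubic error.\<close>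

lemma pi_le_17_5: "pi \<le> 17 / 5"
proof (rule ccontr)
  assume "\<not> pi \<le> 17 / 5"
  then have lt: "17 / 30 \<le> pi / 6" by simp
  have "\<bar>sin (17/30) - (\<Sum>m<3. sin_coeff m * (17/30) ^ m)\<bar> \<le> inverse (fact 3) * \<bar>17/30\<bar> ^ 3"
    by (rule Maclaurin_sin_bound)
  then have "\<bar>sin (17/30) - 17/30\<bar> \<le> (4913/162000 :: real)"
    by (simp add: sin_coeff_def eval_nat_numeral fact_numeral)
  from abs_le_D2[OF this] have "sin (17/30 :: real) > 1 / 2" by simp
  moreover have "sin (17/30) \<le> sin (pi / 6)"
    using lt pi_ge_two by (intro sin_monotone_2pi_le) auto
  ultimately show False by (simp add: sin_30)
qed

text \<open>Concavity of the sine on \<open>{0..pi}\<close>. The point of tangency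
  \<open>pi / 3\<close> lies close to the maximum of \<open>(pi - z) * sin z\<close>, and sine and
  cosine are explicit there.\<close>

lemma sin_le_tangent:
  assumes "0 \<le> z" "z \<le> pi"
  shows "sin z \<le> sqrt 3 / 2 + (z - pi / 3) / 2"
proof -
  define f where "f x = x / 2 - sin x" for x :: real
  have d: "(f has_real_derivative 1 / 2 - cos x) (at x)" for x
    unfolding f_def[abs_def] by (auto intro!: derivative_eq_intros)
  have "f (pi / 3) \<le> f z"
  proof (cases "z \<le> pi / 3")
    case True
    show ?thesis
    proof (rule DERIV_nonpos_imp_nonincreasing[OF True])
      fix x assume x: "z \<le> x" "x \<le> pi / 3"
      have "cos (pi / 3) \<le> cos x" using x assms pi_ge_zero by (subst cos_mono_le_eq) auto
      then show "\<exists>y. (f has_real_derivative y) (at x) \<and> y \<le> 0"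
        using d[of x] by (auto simp: cos_60)
    qed
  next
    case False
    then have le: "pi / 3 \<le> z" by simp
    show ?thesis
    proof (rule DERIV_nonneg_imp_nondecreasing[OF le])
      fix x assume x: "pi / 3 \<le> x" "x \<le> z"
      have "cos x \<le> cos (pi / 3)" using x assms pi_ge_zero by (subst cos_mono_le_eq) auto
      then show "\<exists>y. (f has_real_derivative y) (at x) \<and> y \<ge> 0"
        using d[of x] by (auto simp: cos_60)
    qed
  qed
  then show ?thesis by (simp add: f_def sin_60 field_simps)
qed

text \<open>The linear majorant of the sine turns the product into a quadratic in \<open>z\<close>
  with zeros \<open>pi\<close> and \<open>- q\<close>, and completing the square bounds it by
  \<open>(pi + q)^2 / 8\<close>. The constant 2 is what keeps \<open>gage_kernel\<close> below
  \<open>1 / pi\<close>.\<close>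

lemma mult_sin_le_2:
  assumes "0 \<le> z" "z \<le> pi"
  shows "(pi - z) * sin z \<le> 2"
proof -
  define q where "q = sqrt 3 - pi / 3"
  have q2: "pi + q \<le> 4"
  proof -
    have "sqrt 3 \<le> 26 / 15" by (rule real_le_lsqrt) (auto simp: power2_eq_square)
    then show ?thesis using pi_le_17_5 by (simp add: q_def)
  qed
  have "sqrt 3 \<ge> 3 / 2" by (rule real_le_rsqrt) (simp add: power2_eq_square)
  then have q0: "q \<ge> 0" using pi_le_17_5 by (simp add: q_def)
  have "(pi - z) * sin z \<le> (pi - z) * (sqrt 3 / 2 + (z - pi / 3) / 2)"
    using assms sin_le_tangent by (intro mult_left_mono) auto
  also have "\<dots> = ((pi + q)\<^sup>2 - (pi - 2 * z - q)\<^sup>2) / 8"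
    by (simp add: q_def power2_eq_square field_simps)
  also have "\<dots> \<le> (pi + q)\<^sup>2 / 8" by simp
  also have "(pi + q)\<^sup>2 \<le> 4\<^sup>2" using q0 q2 by (intro power_mono) auto
  finally show ?thesis by simp
qed

text \<open>Restricted to \<open>{0..2 * pi}\<close>, this is up to a multiple of the cosine the Green function of
  \<open>h \<mapsto> h + h''\<close> on the circle: it recovers a support function, up to translation, from the radius
  of curvature.\<close>
definition gage_kernel :: "real \<Rightarrow> real" where
  "gage_kernel x = (1 - \<bar>x\<bar> / pi) * sin \<bar>x\<bar> / 2"

text \<open>The kernel takes values between 0 and \<open>1 / pi\<close>, so subtracting the midpoint
  halves the bound. Arguments beyond \<open>pi\<close> are reflected by
  \<open>2 * pi - x\<close>.\<close>

lemma gage_kernel_bound: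
  assumes "\<bar>x\<bar> \<le> 2 * pi"
  shows "\<bar>1 / (2 * pi) - gage_kernel x\<bar> \<le> 1 / (2 * pi)"
proof -
  have main: "0 \<le> (1 - z / pi) * sin z / 2 \<and> (1 - z / pi) * sin z / 2 \<le> 1 / pi" if "0 \<le> z" "z \<le> pi" for z
  proof -
    have "(1 - z / pi) * sin z / 2 = ((pi - z) * sin z) / (2 * pi)" by (simp add: field_simps)
    moreover have "0 \<le> (pi - z) * sin z" using that by (simp add: sin_ge_zero)
    moreover have "((pi - z) * sin z) / (2 * pi) \<le> 2 / (2 * pi)"
      using mult_sin_le_2[OF that] by (intro divide_right_mono) auto
    ultimately show ?thesis by simp
  qed
  have "0 \<le> gage_kernel x \<and> gage_kernel x \<le> 1 / pi"
  proof (cases "\<bar>x\<bar> \<le> pi")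
    case True
    then show ?thesis using main[of "\<bar>x\<bar>"] by (simp add: gage_kernel_def)
  next
    case False
    have "gage_kernel x = (1 - (2 * pi - \<bar>x\<bar>) / pi) * sin (2 * pi - \<bar>x\<bar>) / 2"
      by (simp add: gage_kernel_def sin_diff field_simps)
    then show ?thesis using main[of "2 * pi - \<bar>x\<bar>"] False assms by simp
  qed
  then show ?thesis by (simp add: abs_le_iff)
qed

text \<open>Cauchy-Schwarz with weight \<open>w\<close>, in the form that the variance of the
  absolute value of \<open>f\<close> about its weighted mean \<open>m\<close> is
  nonnegative.\<close>

lemma integral_abs_square_le:
  fixes f w :: "real \<Rightarrow> real"
  assumes "a \<le> b" "continuous_on {a..b} f" "continuous_on {a..b} w" "\<And>x. x \<in> {a..b} \<Longrightarrow> w x \<ge> 0"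
    and "integral {a..b} w > 0"
  shows "(integral {a..b} (\<lambda>x. \<bar>f x\<bar> * w x))\<^sup>2 \<le> integral {a..b} w * integral {a..b} (\<lambda>x. (f x)\<^sup>2 * w x)"
proof -
  define W where "W = integral {a..b} w"
  define M where "M = integral {a..b} (\<lambda>x. \<bar>f x\<bar> * w x)"
  define Q where "Q = integral {a..b} (\<lambda>x. (f x)\<^sup>2 * w x)"
  define m where "m = M / W"
  have int: "w integrable_on {a..b}" "(\<lambda>x. \<bar>f x\<bar> * w x) integrable_on {a..b}" "(\<lambda>x. (f x)\<^sup>2 * w x) integrable_on {a..b}"
    by (intro integrable_continuous_real continuous_intros assms)+
  have "0 \<le> integral {a..b} (\<lambda>x. (\<bar>f x\<bar> - m)\<^sup>2 * w x)"
    by (intro integral_nonneg integrable_continuous_real continuous_intros assms) (use assms(4) in auto)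
  also have "(\<lambda>x. (\<bar>f x\<bar> - m)\<^sup>2 * w x) = (\<lambda>x. (f x)\<^sup>2 * w x - 2 * m * (\<bar>f x\<bar> * w x) + m\<^sup>2 * w x)"
    by (auto simp: power2_diff algebra_simps)
  also have "integral {a..b} \<dots> = Q - 2 * m * M + m\<^sup>2 * W"
    unfolding Q_def M_def W_def
    by (intro integral_unique has_integral_add has_integral_diff has_integral_mult_right integrable_integral int)
  also have "\<dots> = Q - M\<^sup>2 / W" using assms(5) by (simp add: m_def W_def[symmetric] field_simps power2_eq_square)
  finally have "M\<^sup>2 / W \<le> Q" by simp
  then have "M\<^sup>2 \<le> W * Q" using assms(5) by (simp add: W_def[symmetric] divide_le_eq mult.commute[of W])
  then show ?thesis by (simp only: W_def M_def Q_def)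
qed

context jordan_curve
begin

lemma total_curvature: "((\<lambda>u. k u * \<sigma> u) has_integral 2 * pi) {0..1}"
proof -
  obtain \<theta> where \<theta>: "\<And>u. (\<theta> has_real_derivative \<sigma> u * k u) (at u)" "\<And>u. T u = cis (\<theta> u)"
    by (rule angle_exists) (rule that)
  show ?thesis
    using FTC_real[OF _ \<theta>(1), of 0 1] rotation_index[OF \<theta>, of 0] by (simp add: mult.commute)
qed

text \<open>With \<open>g\<close> the support function with respect to the point \<open>c0\<close>, the kernel represents \<open>L / (2 \<pi>) - g\<close> by
  the function \<open>f = 1 - c k\<close>, which gives \<open>\<bar>L / (2 \<pi>) - g\<bar> \<le> (\<integral> \<bar>f\<bar> ds) / (2 \<pi>)\<close>. Integrating this against
  \<open>f\<close> yields \<open>L\<^sup>2 - 4 \<pi> A \<le> (\<integral> \<bar>f\<bar> ds)\<^sup>2 \<le> L \<integral> f\<^sup>2 ds\<close>, and the choice of \<open>c\<close> minimizes the right-hand side.\<close>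
lemma gage_inequality:
  assumes convex: "convex_curve \<gamma>"
  shows "pi * curve_length \<gamma> \<le> enclosed_area \<gamma> * integral {0..1} (\<lambda>u. (k u)\<^sup>2 * \<sigma> u)"
proof -
  obtain \<theta> where \<theta>: "\<And>u. (\<theta> has_real_derivative \<sigma> u * k u) (at u)" "\<And>u. T u = cis (\<theta> u)"
    by (rule angle_exists) (rule that)
  have k_pos: "k u > 0" for u using convex by (simp add: convex_curve_def)
  have \<theta>1: "\<theta> 1 = \<theta> 0 + 2 * pi" using rotation_index[OF \<theta>, of 0] by simp
  have mono: "\<theta> u \<le> \<theta> v" if "u \<le> v" for u v
  proof (rule DERIV_nonneg_imp_nondecreasing[OF that])
    show "\<exists>y. (\<theta> has_real_derivative y) (at x) \<and> 0 \<le> y" for x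
      using \<theta>(1)[of x] mult_pos_pos[OF speed_pos[of x] k_pos[of x]] less_imp_le by blast
  qed
  have cont\<theta>: "continuous_on A \<theta>" for A
    by (intro continuous_at_imp_continuous_on ballI DERIV_isCont[OF \<theta>(1)])
  define L where "L = curve_length \<gamma>"
  define A where "A = enclosed_area \<gamma>"
  have L: "(\<sigma> has_integral L) {0..1}" "L > 0"
    unfolding L_def using length_pos
    by (auto simp: curve_length_def intro!: integrable_integral integrable_continuous_real cont_speed)
  define C where "C = integral {0..1} (\<lambda>u. \<theta> u * p u)"
  have C: "((\<lambda>u. \<theta> u * p u) has_integral C) {0..1}"
    unfolding C_def by (intro integrable_integral integrable_continuous_real continuous_intros cont_p cont\<theta>)
  \<comment> \<open>The kernel reproduces the support function only up to a term
    \<open>Im (cnj C * T u) / (2 * pi)\<close>. Such a term is a translation, and this centre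
    absorbs it.\<close>
  define c0 where "c0 = \<gamma> 0 - C / (2 * pi)"
  define g where "g u = Im (cnj (\<gamma> u - c0) * T u)" for u
  have cp: "cnj (p v) * T u = \<sigma> v * cis (\<theta> u - \<theta> v)" for u v
    by (simp add: p_eq \<theta>(2) cis_cnj cis_mult mult_ac)
  have Im_cp: "Im (cnj (p v) * T u) = sin (\<theta> u - \<theta> v) * \<sigma> v" for u v
    unfolding cp by simp
  have dIm: "((\<lambda>v. Im (cnj (\<gamma> v) * T u)) has_real_derivative sin (\<theta> u - \<theta> v) * \<sigma> v) (at v)" for u v
  proof -
    have "((\<lambda>v. cnj (\<gamma> v)) has_vector_derivative cnj (p v)) (at v)"
      by (rule bounded_linear.has_vector_derivative[OF bounded_linear_cnj deriv_\<gamma>])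
    from has_vector_derivative_Im[OF has_vector_derivative_mult_left[OF this, of "T u"]]
    show ?thesis by (simp only: Im_cp)
  qed
  have kernel1: "((\<lambda>v. gage_kernel (\<theta> u - \<theta> v) * \<sigma> v) has_integral g u) {0..1}" if u: "u \<in> {0..1}" for u
  proof -
    define J where "J = Im (cnj (\<gamma> u - \<gamma> 0) * T u)"
    define s where "s v = sin (\<theta> u - \<theta> v) * \<sigma> v" for v
    have J1: "(s has_integral J) {0..u}"
      using FTC_real[OF _ dIm[of u], of 0 u] u unfolding s_def J_def by (simp add: algebra_simps)
    have \<gamma>1: "\<gamma> 1 = \<gamma> 0" using periodic[of 0] by simp
    have J2: "(s has_integral - J) {u..1}"
      using FTC_real[OF _ dIm[of u], of u 1] u unfolding s_def J_def by (simp add: algebra_simps \<gamma>1)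
    have I0: "(s has_integral 0) {0..1}" using has_integral_combine[OF _ _ J1 J2] u by simp
    \<comment> \<open>\<open>gage_kernel x\<close> equals
      \<open>sin \<bar>x\<bar> / 2 - x * sin x / (2 * pi)\<close>, so only the first summand feels
      the absolute value. As the integral of \<open>s\<close> over the closed curve is 0, both sides
      of \<open>u\<close> contribute the same \<open>J\<close>.\<close>
    have I1: "((\<lambda>v. if v \<le> u then s v else - s v) has_integral (J + J)) {0..1}"
    proof (rule has_integral_combine[of 0 u 1])
      show "((\<lambda>v. if v \<le> u then s v else - s v) has_integral J) {0..u}"
        by (rule has_integral_eq[OF _ J1]) auto
      show "((\<lambda>v. if v \<le> u then s v else - s v) has_integral J) {u..1}"
      proof (rule has_integral_eq)
        show "((\<lambda>v. - s v) has_integral J) {u..1}" using has_integral_neg[OF J2] by simp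
      qed (auto simp: s_def)
    qed (use u in auto)
    have bl: "bounded_linear (\<lambda>z. Im (cnj z * T u))"
      by (intro bounded_linear_compose[OF bounded_linear_Im] bounded_linear_compose[OF bounded_linear_mult_left] bounded_linear_cnj)
    have "((\<lambda>v. Im (cnj (\<theta> v * p v) * T u)) has_integral Im (cnj C * T u)) {0..1}"
      using has_integral_linear[OF C bl] by (simp add: o_def)
    moreover have "Im (cnj (\<theta> v * p v) * T u) = \<theta> v * s v" for v
    proof -
      have "cnj (\<theta> v * p v) * T u = complex_of_real (\<theta> v) * (cnj (p v) * T u)" by simp
      moreover have "Im (complex_of_real r * w) = r * Im w" for r w by simp
      ultimately show ?thesis by (simp only: Im_cp s_def)
    qed
    ultimately have I2: "((\<lambda>v. \<theta> v * s v) has_integral Im (cnj C * T u)) {0..1}" by simp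
    have "((\<lambda>v. (if v \<le> u then s v else - s v) / 2 - (\<theta> u * s v - \<theta> v * s v) / (2 * pi)) has_integral
        (J + J) / 2 - (\<theta> u * 0 - Im (cnj C * T u)) / (2 * pi)) {0..1}"
      by (intro has_integral_diff has_integral_divide I1 I2 has_integral_mult_right I0)
    also have "(J + J) / 2 - (\<theta> u * 0 - Im (cnj C * T u)) / (2 * pi) = g u"
      by (simp add: g_def J_def c0_def field_simps)
    finally show ?thesis
    proof (rule has_integral_eq[rotated])
      fix v :: real
      show "(if v \<le> u then s v else - s v) / 2 - (\<theta> u * s v - \<theta> v * s v) / (2 * pi) = gage_kernel (\<theta> u - \<theta> v) * \<sigma> v"
      proof (cases "v \<le> u")
        case True
        then show ?thesis using mono[of v u] by (simp add: gage_kernel_def s_def field_simps)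
      next
        case False
        then have "\<bar>\<theta> u - \<theta> v\<bar> = \<theta> v - \<theta> u" using mono[of u v] by simp
        moreover have "sin (\<theta> v - \<theta> u) = - sin (\<theta> u - \<theta> v)" by (metis minus_diff_eq sin_minus)
        ultimately show ?thesis using False by (simp add: gage_kernel_def s_def field_simps)
      qed
    qed
  qed
  \<comment> \<open>A primitive of the kernel on \<open>{0..2 * pi}\<close>. Its antisymmetry under
    \<open>2 * pi - x\<close> and \<open>P 0 = - 1 / 2\<close> make the total mass of the kernel in
    the angle equal to 1.\<close>
  define P where "P x = - (1 - x / pi) * cos x / 2 - sin x / (2 * pi)" for x :: real
  have dP: "(P has_real_derivative (1 - x / pi) * sin x / 2) (at x)" for x
    unfolding P_def[abs_def] by (auto intro!: derivative_eq_intros simp: field_simps)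
  have kernel2: "((\<lambda>v. gage_kernel (\<theta> u - \<theta> v) * (k v * \<sigma> v)) has_integral 1) {0..1}" if u: "u \<in> {0..1}" for u
  proof -
    have d1: "((\<lambda>v. P (\<theta> u - \<theta> v)) has_real_derivative
        ((1 - (\<theta> u - \<theta> v) / pi) * sin (\<theta> u - \<theta> v) / 2) * (- (\<sigma> v * k v))) (at v)" for v
      by (rule DERIV_chain2[OF dP]) (auto intro!: derivative_eq_intros \<theta>(1))
    have d2: "((\<lambda>v. P (\<theta> v - \<theta> u)) has_real_derivative
        ((1 - (\<theta> v - \<theta> u) / pi) * sin (\<theta> v - \<theta> u) / 2) * (\<sigma> v * k v)) (at v)" for v
      by (rule DERIV_chain2[OF dP]) (auto intro!: derivative_eq_intros \<theta>(1))
    have 1: "((\<lambda>v. gage_kernel (\<theta> u - \<theta> v) * (k v * \<sigma> v)) has_integral - (P (\<theta> u - \<theta> u) - P (\<theta> u - \<theta> 0))) {0..u}"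
    proof (rule has_integral_eq[OF _ has_integral_neg[OF FTC_real[OF _ d1]]])
      fix v assume "v \<in> {0..u}"
      then show "- (((1 - (\<theta> u - \<theta> v) / pi) * sin (\<theta> u - \<theta> v) / 2) * (- (\<sigma> v * k v))) = gage_kernel (\<theta> u - \<theta> v) * (k v * \<sigma> v)"
        using mono[of v u] by (simp add: gage_kernel_def)
    qed (use u in auto)
    have 2: "((\<lambda>v. gage_kernel (\<theta> u - \<theta> v) * (k v * \<sigma> v)) has_integral P (\<theta> 1 - \<theta> u) - P (\<theta> u - \<theta> u)) {u..1}"
    proof (rule has_integral_eq[OF _ FTC_real[OF _ d2]])
      fix v assume "v \<in> {u..1}"
      then have "\<bar>\<theta> u - \<theta> v\<bar> = \<theta> v - \<theta> u" using mono[of u v] by simp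
      then show "((1 - (\<theta> v - \<theta> u) / pi) * sin (\<theta> v - \<theta> u) / 2) * (\<sigma> v * k v) = gage_kernel (\<theta> u - \<theta> v) * (k v * \<sigma> v)"
        by (simp add: gage_kernel_def)
    qed (use u in auto)
    have refl: "P (2 * pi - b) = - P b" for b
      by (simp add: P_def cos_diff sin_diff field_simps)
    have "P (\<theta> 1 - \<theta> u) = - P (\<theta> u - \<theta> 0)"
      using refl[of "\<theta> u - \<theta> 0"] unfolding \<theta>1 by (simp add: algebra_simps)
    moreover have "P 0 = - 1 / 2" by (simp add: P_def)
    ultimately show ?thesis using has_integral_combine[OF _ _ 1 2] u by simp
  qed
  have gint: "((\<lambda>u. g u * \<sigma> u) has_integral 2 * A) {0..1}"
    using area_det[of c0] unfolding A_def g_def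
    by (rule has_integral_eq[rotated]) (simp add: p_eq algebra_simps)
  \<comment> \<open>A Minkowski formula: the tangential component of the position vector is periodic
    with derivative \<open>\<sigma> - g k \<sigma>\<close>.\<close>
  have gkint: "((\<lambda>u. g u * (k u * \<sigma> u)) has_integral L) {0..1}"
  proof -
    have "((\<lambda>u. Re (cnj (\<gamma> u - c0) * T u)) has_real_derivative \<sigma> u - g u * (k u * \<sigma> u)) (at u)" for u
    proof -
      have "((\<lambda>v. cnj (\<gamma> v - c0)) has_vector_derivative cnj (p u - 0)) (at u)"
        by (rule bounded_linear.has_vector_derivative[OF bounded_linear_cnj
            has_vector_derivative_diff[OF deriv_\<gamma> has_vector_derivative_const]])
      note 1 = has_vector_derivative_Re[OF has_vector_derivative_complex_mult[OF this deriv_tangent]]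
      have 2: "cnj (p u - 0) * T u + cnj (\<gamma> u - c0) * (\<i> * (\<sigma> u * k u) * T u)
          = \<sigma> u + \<i> * complex_of_real (\<sigma> u * k u) * (cnj (\<gamma> u - c0) * T u)"
        using cp[of u u] by (simp add: mult_ac)
      have 3: "Re (complex_of_real a + \<i> * complex_of_real r * w) = a - r * Im w" for a r w by simp
      show ?thesis by (rule DERIV_cong[OF 1]) (simp only: 2 3 g_def, simp only: mult_ac)
    qed
    from integral_by_parts_periodic[OF this]
    have "((\<lambda>u. \<sigma> u - g u * (k u * \<sigma> u)) has_integral 0) {0..1}"
      using periodic[of 0] tangent_periodic[of 0] by simp
    from has_integral_diff[OF L(1) this] show ?thesis by simp
  qed
  define I where "I = integral {0..1} (\<lambda>u. (k u)\<^sup>2 * \<sigma> u)"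
  have I: "((\<lambda>u. (k u)\<^sup>2 * \<sigma> u) has_integral I) {0..1}"
    unfolding I_def by (intro integrable_integral integrable_continuous_real continuous_intros cont_curvature cont_speed)
  note K = total_curvature
  have "I \<noteq> 0"
  proof
    assume "I = 0"
    then have "\<forall>u\<in>{0..1}. (k u)\<^sup>2 * \<sigma> u = 0"
      unfolding I_def by (subst (asm) integral_eq_0_iff) (auto intro!: continuous_intros cont_curvature cont_speed simp: less_imp_le)
    then have "(k 0)\<^sup>2 * \<sigma> 0 = 0" by simp
    then show False using k_pos[of 0] by simp
  qed
  moreover have "I \<ge> 0" by (rule has_integral_nonneg[OF I]) (simp add: less_imp_le)
  ultimately have I_pos: "I > 0" by simp
  define c where "c = 2 * pi / I"
  define f where "f u = 1 - c * k u" for u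
  define M where "M = integral {0..1} (\<lambda>u. \<bar>f u\<bar> * \<sigma> u)"
  have M: "((\<lambda>u. \<bar>f u\<bar> * \<sigma> u) has_integral M) {0..1}"
    unfolding M_def f_def by (intro integrable_integral integrable_continuous_real continuous_intros cont_curvature cont_speed)
  have support: "\<bar>L / (2 * pi) - g u\<bar> \<le> M / (2 * pi)" if u: "u \<in> {0..1}" for u
  proof -
    have "((\<lambda>v. (\<sigma> v - c * (k v * \<sigma> v)) / (2 * pi) - (gage_kernel (\<theta> u - \<theta> v) * \<sigma> v - c * (gage_kernel (\<theta> u - \<theta> v) * (k v * \<sigma> v))))
        has_integral (L - c * (2 * pi)) / (2 * pi) - (g u - c * 1)) {0..1}"
      by (intro has_integral_diff has_integral_divide has_integral_mult_right L K kernel1 kernel2 u)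
    then have 1: "((\<lambda>v. (1 / (2 * pi) - gage_kernel (\<theta> u - \<theta> v)) * (f v * \<sigma> v)) has_integral L / (2 * pi) - g u) {0..1}"
      by (rule has_integral_eq_rhs[OF has_integral_eq[rotated]]) (auto simp: f_def field_simps)
    have 2: "((\<lambda>v. \<bar>f v\<bar> * \<sigma> v / (2 * pi)) has_integral M / (2 * pi)) {0..1}"
      by (rule has_integral_divide[OF M])
    have "norm (L / (2 * pi) - g u) \<le> M / (2 * pi)"
      unfolding integral_unique[OF 1, symmetric] integral_unique[OF 2, symmetric]
    proof (rule integral_norm_bound_integral)
      fix v :: real assume v: "v \<in> {0..1}"
      have "\<bar>\<theta> u - \<theta> v\<bar> \<le> 2 * pi" using mono[of 0 u] mono[of u 1] mono[of 0 v] mono[of v 1] \<theta>1 u v by simp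
      then have "\<bar>1 / (2 * pi) - gage_kernel (\<theta> u - \<theta> v)\<bar> * (\<bar>f v\<bar> * \<sigma> v) \<le> 1 / (2 * pi) * (\<bar>f v\<bar> * \<sigma> v)"
        by (intro mult_right_mono gage_kernel_bound) (auto simp: less_imp_le)
      then show "norm ((1 / (2 * pi) - gage_kernel (\<theta> u - \<theta> v)) * (f v * \<sigma> v)) \<le> \<bar>f v\<bar> * \<sigma> v / (2 * pi)"
        by (simp add: abs_mult abs_of_pos)
    qed (use 1 2 in \<open>auto simp: has_integral_integrable\<close>)
    then show ?thesis by simp
  qed
  \<comment> \<open>With respect to \<open>k ds\<close> the function \<open>L / (2 * pi) - g\<close>
    has mean 0, so testing it against \<open>f\<close> gives the same as testing it against
    1.\<close>
  have "((\<lambda>u. L / (2 * pi) * \<sigma> u - g u * \<sigma> u - c * (L / (2 * pi) * (k u * \<sigma> u) - g u * (k u * \<sigma> u)))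
      has_integral L / (2 * pi) * L - 2 * A - c * (L / (2 * pi) * (2 * pi) - L)) {0..1}"
    by (intro has_integral_diff has_integral_mult_right L K gint gkint)
  then have 1: "((\<lambda>u. (L / (2 * pi) - g u) * (f u * \<sigma> u)) has_integral L\<^sup>2 / (2 * pi) - 2 * A) {0..1}"
    by (rule has_integral_eq_rhs[OF has_integral_eq[rotated]]) (auto simp: f_def algebra_simps power2_eq_square)
  have 2: "((\<lambda>u. M / (2 * pi) * (\<bar>f u\<bar> * \<sigma> u)) has_integral M / (2 * pi) * M) {0..1}"
    by (rule has_integral_mult_right[OF M])
  have "L\<^sup>2 / (2 * pi) - 2 * A \<le> M / (2 * pi) * M"
  proof (rule has_integral_le[OF 1 2])
    fix u :: real assume u: "u \<in> {0..1}"
    have "(L / (2 * pi) - g u) * (f u * \<sigma> u) \<le> \<bar>L / (2 * pi) - g u\<bar> * (\<bar>f u\<bar> * \<sigma> u)"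
      by (metis abs_ge_self abs_mult abs_of_pos speed_pos)
    also have "\<dots> \<le> M / (2 * pi) * (\<bar>f u\<bar> * \<sigma> u)"
      by (intro mult_right_mono support u) (simp add: less_imp_le)
    finally show "(L / (2 * pi) - g u) * (f u * \<sigma> u) \<le> M / (2 * pi) * (\<bar>f u\<bar> * \<sigma> u)" .
  qed
  moreover have "L\<^sup>2 / (2 * pi) - 2 * A = (L\<^sup>2 - 4 * pi * A) / (2 * pi)" by (simp add: diff_divide_distrib)
  moreover have "M / (2 * pi) * M = M\<^sup>2 / (2 * pi)" by (simp add: power2_eq_square)
  ultimately have iso: "L\<^sup>2 - 4 * pi * A \<le> M\<^sup>2" by (simp only: divide_le_cancel) simp
  have "M\<^sup>2 \<le> integral {0..1} \<sigma> * integral {0..1} (\<lambda>u. (f u)\<^sup>2 * \<sigma> u)"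
    unfolding M_def
    by (rule integral_abs_square_le) (use L in \<open>auto simp: f_def integral_unique less_imp_le intro!: continuous_intros cont_curvature cont_speed\<close>)
  also have "integral {0..1} \<sigma> = L" by (rule integral_unique[OF L(1)])
  also have "integral {0..1} (\<lambda>u. (f u)\<^sup>2 * \<sigma> u) = L - 2 * c * (2 * pi) + c\<^sup>2 * I"
  proof (rule integral_unique)
    have "((\<lambda>u. \<sigma> u - 2 * c * (k u * \<sigma> u) + c\<^sup>2 * ((k u)\<^sup>2 * \<sigma> u)) has_integral L - 2 * c * (2 * pi) + c\<^sup>2 * I) {0..1}"
      by (intro has_integral_add has_integral_diff has_integral_mult_right L K I)
    then show "((\<lambda>u. (f u)\<^sup>2 * \<sigma> u) has_integral L - 2 * c * (2 * pi) + c\<^sup>2 * I) {0..1}"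
      by (rule has_integral_eq[rotated]) (simp add: f_def power2_eq_square algebra_simps)
  qed
  also have "L - 2 * c * (2 * pi) + c\<^sup>2 * I = L - 4 * pi\<^sup>2 / I"
    using I_pos by (simp add: c_def field_simps power2_eq_square)
  finally have "L\<^sup>2 - 4 * pi * A \<le> L * (L - 4 * pi\<^sup>2 / I)" using iso by simp
  then have "4 * pi * (pi * L / I) \<le> 4 * pi * A" by (simp add: algebra_simps power2_eq_square)
  then have "pi * L / I \<le> A" by (subst (asm) mult_le_cancel_left_pos) auto
  then have "pi * L \<le> A * I" using I_pos by (simp add: divide_le_eq)
  then show ?thesis by (simp add: L_def A_def I_def)
qed

end

section \<open>Differentiation in time\<close>

lemma time_interval_convex: "convex (time_interval T)"
proof -
  have "is_interval (time_interval T)"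
    unfolding is_interval_1 time_interval_def
    by (auto intro: le_less_trans[of "ereal _" "ereal _"])
  then show ?thesis by (simp add: is_interval_convex_1)
qed

lemma time_interval_down: "t \<in> time_interval T \<Longrightarrow> 0 \<le> s \<Longrightarrow> s \<le> t \<Longrightarrow> s \<in> time_interval T"
  unfolding time_interval_def by (auto intro: le_less_trans[of "ereal _" "ereal _"])

lemma time_interval_later:
  assumes "t \<in> time_interval T"
  obtains b where "t < b" "b \<in> time_interval T"
proof -
  have "ereal t < T" using assms by (simp add: time_interval_def)
  then obtain b where "ereal t < ereal b" "ereal b < T" using ereal_dense2 by blast
  then show ?thesis using that[of b] assms by (simp add: time_interval_def)
qed

text \<open>Carries the fundamental theorem of calculus from a compact interval to the half-open
  time interval; at time 0 both filters are one-sided.\<close>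

lemma at_within_time_interval:
  assumes "b \<in> time_interval T" "t < b"
  shows "at t within time_interval T = at t within {0..b}"
proof (rule at_within_nhd[of _ "{..<b}"])
  show "time_interval T \<inter> {..<b} - {t} = {0..b} \<inter> {..<b} - {t}"
    using time_interval_down[OF assms(1)] by (auto simp: time_interval_def)
qed (use assms in auto)

lemma time_interval_nontrivial:
  assumes "t \<in> time_interval T"
  shows "at t within time_interval T \<noteq> bot"
proof -
  obtain b where b: "t < b" "b \<in> time_interval T" using time_interval_later[OF assms] .
  have "0 \<le> t" using assms by (simp add: time_interval_def)
  then have "t islimpt {0..b}" using b(1) by (simp add: islimpt_Icc)
  then show ?thesis unfolding at_within_time_interval[OF b(2,1)] by (simp add: trivial_limit_within)
qed

section \<open>Partial derivatives of functions that are smooth up to the initial time\<close>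

lemma Ck_on_cong:
  assumes "\<And>p. p \<in> S \<Longrightarrow> f p = g p" "Ck_on k S f"
  shows "Ck_on k S g"
proof (cases k)
  case 0
  then show ?thesis using assms continuous_on_cong[of S S f g] by simp
next
  case (Suc n)
  then obtain f' where f': "\<forall>p\<in>S. (f has_derivative f' p) (at p within S)" "\<forall>v. Ck_on n S (\<lambda>p. f' p v)"
    using assms(2) by auto
  have "(g has_derivative f' p) (at p within S)" if "p \<in> S" for p
    by (rule has_derivative_transform[OF that _ f'(1)[rule_format, OF that]]) (use assms(1) in simp)
  then show ?thesis using f'(2) Suc by auto
qed

lemma has_derivative_partials:
  fixes f :: "real \<times> real \<Rightarrow> 'b::real_normed_vector"
  assumes f: "(f has_derivative f') (at (t, u) within I \<times> UNIV)"
  shows "((\<lambda>\<tau>. f (\<tau>, u)) has_vector_derivative f' (1, 0)) (at t within I)"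
    and "t \<in> I \<Longrightarrow> ((\<lambda>v. f (t, v)) has_vector_derivative f' (0, 1)) (at u)"
proof -
  interpret bounded_linear f' by (rule has_derivative_bounded_linear[OF f])
  have "((\<lambda>\<tau>. (\<tau>, u)) has_derivative (\<lambda>h. (h, 0))) (at t within I)"
    by (intro has_derivative_Pair has_derivative_ident has_derivative_const)
  moreover have "(f has_derivative f') (at (t, u) within (\<lambda>\<tau>. (\<tau>, u)) ` I)"
    by (rule has_derivative_subset[OF f]) auto
  ultimately have "((\<lambda>\<tau>. f (\<tau>, u)) has_derivative (\<lambda>h. f' (h, 0))) (at t within I)"
    by (rule has_derivative_in_compose[of "\<lambda>\<tau>. (\<tau>, u)" "\<lambda>h. (h, 0)" t I f f'])
  moreover have "(\<lambda>h. f' (h, 0)) = (\<lambda>h. h *\<^sub>R f' (1, 0))"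
  proof
    fix h :: real
    from scaleR[of h "(1, 0)"] show "f' (h, 0) = h *\<^sub>R f' (1, 0)"
      by (simp only: scaleR_Pair real_scaleR_def mult_1_right mult_zero_right)
  qed
  ultimately show "((\<lambda>\<tau>. f (\<tau>, u)) has_vector_derivative f' (1, 0)) (at t within I)"
    by (simp only: has_vector_derivative_def)
  assume "t \<in> I"
  have "((\<lambda>v. (t, v)) has_derivative (\<lambda>h. (0, h))) (at u)"
    by (intro has_derivative_Pair has_derivative_ident has_derivative_const)
  moreover have "(f has_derivative f') (at (t, u) within range (Pair t))"
    by (rule has_derivative_subset[OF f]) (use \<open>t \<in> I\<close> in auto)
  ultimately have "((\<lambda>v. f (t, v)) has_derivative (\<lambda>h. f' (0, h))) (at u)"
    by (rule has_derivative_in_compose[of "\<lambda>v. (t, v)" "\<lambda>h. (0, h)" u UNIV f f'])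
  moreover have "(\<lambda>h. f' (0, h)) = (\<lambda>h. h *\<^sub>R f' (0, 1))"
  proof
    fix h :: real
    from scaleR[of h "(0, 1)"] show "f' (0, h) = h *\<^sub>R f' (0, 1)"
      by (simp only: scaleR_Pair real_scaleR_def mult_1_right mult_zero_right)
  qed
  ultimately show "((\<lambda>v. f (t, v)) has_vector_derivative f' (0, 1)) (at u)"
    by (simp only: has_vector_derivative_def)
qed

lemma smooth_on_space_derivative:
  fixes f :: "real \<times> real \<Rightarrow> 'b::real_normed_vector"
  assumes "smooth_on (I \<times> UNIV) f"
  shows "smooth_on (I \<times> UNIV) (\<lambda>(t, u). vector_derivative (\<lambda>v. f (t, v)) (at u))"
    and "t \<in> I \<Longrightarrow> ((\<lambda>v. f (t, v)) has_vector_derivative vector_derivative (\<lambda>v. f (t, v)) (at u)) (at u)"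
proof -
  have C: "Ck_on (Suc k) (I \<times> UNIV) f" for k using assms unfolding smooth_on_def by blast
  show "smooth_on (I \<times> UNIV) (\<lambda>(t, u). vector_derivative (\<lambda>v. f (t, v)) (at u))"
    unfolding smooth_on_def
  proof
    fix k
    obtain f' where f': "\<forall>p\<in>I \<times> UNIV. (f has_derivative f' p) (at p within I \<times> UNIV)"
      "\<forall>v. Ck_on k (I \<times> UNIV) (\<lambda>p. f' p v)" using C[of k] by auto
    show "Ck_on k (I \<times> UNIV) (\<lambda>(t, u). vector_derivative (\<lambda>v. f (t, v)) (at u))"
    proof (rule Ck_on_cong)
      show "Ck_on k (I \<times> UNIV) (\<lambda>p. f' p (0, 1))" using f'(2) by blast
      fix p assume "p \<in> I \<times> (UNIV :: real set)"
      then obtain t u where p: "p = (t, u)" "t \<in> I" by auto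
      then have "(f has_derivative f' (t, u)) (at (t, u) within I \<times> UNIV)" using f'(1) by auto
      from has_derivative_partials(2)[OF this p(2)]
      show "f' p (0, 1) = (case p of (t, u) \<Rightarrow> vector_derivative (\<lambda>v. f (t, v)) (at u))"
        by (simp add: p(1) vector_derivative_at)
    qed
  qed
  assume t: "t \<in> I"
  obtain f' where "\<forall>p\<in>I \<times> UNIV. (f has_derivative f' p) (at p within I \<times> UNIV)" using C[of 0] by auto
  then have "(f has_derivative f' (t, u)) (at (t, u) within I \<times> UNIV)" using t by auto
  from has_derivative_partials(2)[OF this t]
  show "((\<lambda>v. f (t, v)) has_vector_derivative vector_derivative (\<lambda>v. f (t, v)) (at u)) (at u)"
    by (simp add: vector_derivative_at)
qed

text \<open>Uniqueness of derivatives within \<open>I\<close> identifies \<open>g\<close> with the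
  derivative of \<open>f\<close> in the direction \<open>(1, 0)\<close>; nontriviality of the filter
  provides this uniqueness also at a boundary time.\<close>

lemma smooth_on_time_derivative:
  fixes f :: "real \<times> real \<Rightarrow> 'b::real_normed_vector"
  assumes "smooth_on (I \<times> UNIV) f" "\<And>t. t \<in> I \<Longrightarrow> at t within I \<noteq> bot"
    and "\<And>t u. t \<in> I \<Longrightarrow> ((\<lambda>\<tau>. f (\<tau>, u)) has_vector_derivative g (t, u)) (at t within I)"
  shows "smooth_on (I \<times> UNIV) g"
  unfolding smooth_on_def
proof
  fix k
  have "Ck_on (Suc k) (I \<times> UNIV) f" using assms unfolding smooth_on_def by blast
  then obtain f' where f': "\<forall>p\<in>I \<times> UNIV. (f has_derivative f' p) (at p within I \<times> UNIV)"
    "\<forall>v. Ck_on k (I \<times> UNIV) (\<lambda>p. f' p v)" by auto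
  show "Ck_on k (I \<times> UNIV) g"
  proof (rule Ck_on_cong)
    show "Ck_on k (I \<times> UNIV) (\<lambda>p. f' p (1, 0))" using f'(2) by blast
    fix p assume "p \<in> I \<times> (UNIV :: real set)"
    then obtain t u where p: "p = (t, u)" "t \<in> I" by auto
    then have "(f has_derivative f' (t, u)) (at (t, u) within I \<times> UNIV)" using f'(1) by auto
    from has_derivative_partials(1)[OF this]
    show "f' p (1, 0) = g p"
      unfolding p(1) using vector_derivative_unique_within[OF assms(2)[OF p(2)] _ assms(3)[OF p(2)]] by blast
  qed
qed

text \<open>Symmetry of the second derivatives up to the boundary time: \<open>f\<close> and \<open>\<partial>\<^sub>uf\<close> are
  recovered by integrating \<open>\<partial>\<^sub>tf\<close> and \<open>\<partial>\<^sub>u\<partial>\<^sub>tf\<close> in time.\<close>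
lemma mixed_partials:
  fixes f :: "real \<Rightarrow> real \<Rightarrow> 'b::euclidean_space"
  assumes ft: "\<And>t u. t \<in> time_interval T \<Longrightarrow> ((\<lambda>\<tau>. f \<tau> u) has_vector_derivative ft t u) (at t within time_interval T)"
    and fu: "\<And>t u. t \<in> time_interval T \<Longrightarrow> (f t has_vector_derivative fu t u) (at u)"
    and ftu: "\<And>t u. t \<in> time_interval T \<Longrightarrow> (ft t has_vector_derivative ftu t u) (at u)"
    and cft: "continuous_on (time_interval T \<times> UNIV) (\<lambda>(t, u). ft t u)"
    and cftu: "continuous_on (time_interval T \<times> UNIV) (\<lambda>(t, u). ftu t u)"
    and t: "t \<in> time_interval T"
  shows "((\<lambda>\<tau>. fu \<tau> u) has_vector_derivative ftu t u) (at t within time_interval T)"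
proof -
  obtain b where b: "t < b" "b \<in> time_interval T" using time_interval_later[OF t] .
  have sub: "{0..s} \<subseteq> time_interval T" if "s \<in> {0..b}" for s
    using time_interval_down[OF b(2)] that by auto
  have cont: "continuous_on {0..s} (\<lambda>\<tau>. h \<tau> v)"
    if s: "s \<in> {0..b}" and h: "continuous_on (time_interval T \<times> UNIV) (\<lambda>(t, u). h t u)"
    for s v and h :: "real \<Rightarrow> real \<Rightarrow> 'b"
  proof -
    have "continuous_on {0..s} (\<lambda>\<tau>. (\<tau>, v))" by (intro continuous_intros)
    moreover have "(\<lambda>\<tau>. (\<tau>, v)) ` {0..s} \<subseteq> time_interval T \<times> UNIV" using sub[OF s] by auto
    ultimately show ?thesis using continuous_on_compose2[OF h, of "{0..s}" "\<lambda>\<tau>. (\<tau>, v)"] by simp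
  qed
  have f_eq: "f s v = f 0 v + integral {0..s} (\<lambda>\<tau>. ft \<tau> v)" if s: "s \<in> {0..b}" for s v
  proof -
    have "((\<lambda>\<tau>. ft \<tau> v) has_integral f s v - f 0 v) {0..s}"
    proof (rule fundamental_theorem_of_calculus)
      fix x assume "x \<in> {0..s}"
      then have "x \<in> time_interval T" using sub[OF s] by blast
      from has_vector_derivative_within_subset[OF ft[OF this] sub[OF s]]
      show "((\<lambda>\<tau>. f \<tau> v) has_vector_derivative ft x v) (at x within {0..s})" .
    qed (use s in auto)
    then show ?thesis by (simp add: integral_unique)
  qed
  have 0: "0 \<in> time_interval T" by (rule time_interval_down[OF t]) (use t in \<open>auto simp: time_interval_def\<close>)
  have fu_eq: "fu s u = fu 0 u + integral {0..s} (\<lambda>\<tau>. ftu \<tau> u)" if s: "s \<in> {0..b}" for s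
  proof -
    have "((\<lambda>v. integral (cbox 0 s) (\<lambda>\<tau>. ft \<tau> v)) has_vector_derivative integral (cbox 0 s) (\<lambda>\<tau>. ftu \<tau> u)) (at u within UNIV)"
    proof (rule leibniz_rule_vector_derivative)
      show "((\<lambda>v. ft \<tau> v) has_vector_derivative ftu \<tau> v) (at v within UNIV)" if "\<tau> \<in> cbox 0 s" for v \<tau>
        using ftu[of \<tau> v] sub[OF s] that by auto
      show "(\<lambda>\<tau>. ft \<tau> v) integrable_on cbox 0 s" for v
        using integrable_continuous_real[OF cont[OF s cft]] by simp
      have "continuous_on (UNIV \<times> cbox 0 s) (\<lambda>z::real\<times>real. (snd z, fst z))" by (intro continuous_intros)
      moreover have "(\<lambda>z::real\<times>real. (snd z, fst z)) ` (UNIV \<times> cbox 0 s) \<subseteq> time_interval T \<times> UNIV"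
        using sub[OF s] by auto
      ultimately have "continuous_on (UNIV \<times> cbox 0 s) (\<lambda>z. case (snd z, fst z) of (t, u) \<Rightarrow> ftu t u)"
        by (rule continuous_on_compose2[OF cftu])
      then show "continuous_on (UNIV \<times> cbox 0 s) (\<lambda>(v, \<tau>). ftu \<tau> v)" by (simp add: split_beta')
    qed auto
    from has_vector_derivative_add[OF fu[OF 0] this]
    have 1: "((\<lambda>v. f 0 v + integral {0..s} (\<lambda>\<tau>. ft \<tau> v)) has_vector_derivative fu 0 u + integral {0..s} (\<lambda>\<tau>. ftu \<tau> u)) (at u)"
      by simp
    have 2: "(\<lambda>v. f 0 v + integral {0..s} (\<lambda>\<tau>. ft \<tau> v)) = f s" by (rule ext) (rule f_eq[OF s, symmetric])
    have "s \<in> time_interval T" using sub[OF s] s by auto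
    from vector_derivative_unique_at[OF fu[OF this] 1[unfolded 2]] show ?thesis .
  qed
  have tb: "t \<in> {0..b}" using t b by (auto simp: time_interval_def)
  then have "b \<in> {0..b}" by auto
  have "((\<lambda>s. integral {0..s} (\<lambda>\<tau>. ftu \<tau> u)) has_vector_derivative ftu t u) (at t within {0..b})"
    by (rule integral_has_vector_derivative[OF cont[OF \<open>b \<in> {0..b}\<close> cftu] tb])
  from has_vector_derivative_add[OF has_vector_derivative_const this]
  have "((\<lambda>s. fu 0 u + integral {0..s} (\<lambda>\<tau>. ftu \<tau> u)) has_vector_derivative ftu t u) (at t within {0..b})"
    by simp
  then have "((\<lambda>s. fu s u) has_vector_derivative ftu t u) (at t within {0..b})"
    by (rule has_vector_derivative_transform[OF tb, rotated]) (rule fu_eq)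
  then show ?thesis unfolding at_within_time_interval[OF b(2,1)] .
qed

text \<open>If \<open>f2\<close> were negative, \<open>f1\<close> would be negative just to the
  right of its zero \<open>x\<close>, and \<open>f\<close> would drop below its minimum. Continuity
  of the second derivative does not enter.\<close>

lemma second_derivative_at_min:
  fixes f :: "real \<Rightarrow> real"
  assumes "\<And>u. (f has_real_derivative f1 u) (at u)" "(f1 has_real_derivative f2) (at x)" "\<And>u. f x \<le> f u"
  shows "f1 x = 0" "f2 \<ge> 0"
proof -
  show 1: "f1 x = 0" by (rule DERIV_local_min[OF assms(1), of 1]) (use assms(3) in auto)
  show "f2 \<ge> 0"
  proof (rule ccontr)
    assume "\<not> f2 \<ge> 0"
    then obtain d where d: "d > 0" "\<And>h. 0 < h \<Longrightarrow> h < d \<Longrightarrow> f1 (x + h) < f1 x"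
      using DERIV_neg_dec_right[OF assms(2)] by auto
    have "f (x + d / 2) < f x"
    proof (rule DERIV_neg_imp_decreasing_open[where f = f and a = x and b = "x + d / 2"])
      show "continuous_on {x..x + d / 2} f"
        by (intro continuous_at_imp_continuous_on ballI DERIV_isCont[OF assms(1)])
      fix y assume y: "x < y" "y < x + d / 2"
      then have "f1 y < 0" using d(2)[of "y - x"] 1 by simp
      then show "\<exists>l. (f has_real_derivative l) (at y) \<and> l < 0" using assms(1) by blast
    qed (use d in auto)
    then show False using assms(3)[of "x + d / 2"] by simp
  qed
qed

context regular_curve
begin

text \<open>The evolution equation \<open>k\<^sub>t = \<beta>\<^sub>s\<^sub>s + \<alpha> k\<^sub>s + k\<^sup>2 \<beta>\<close> of the curvature at a critical point of \<open>k\<close>;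
  the left-hand side is the time derivative of \<open>k = det (p, p\<^sub>u) / \<bar>p\<bar>\<^sup>3\<close> for \<open>p\<^sub>t = V\<^sub>u\<close>.\<close>
lemma curvature_evolution:
  fixes \<alpha> :: "real \<Rightarrow> real" and V1 :: "real \<Rightarrow> complex"
  assumes k1: "\<And>u. (k has_real_derivative k1 u) (at u)" and k2: "(k1 has_real_derivative k2) (at x)"
    and \<alpha>1: "\<And>u. (\<alpha> has_real_derivative \<alpha>1 u) (at u)" and \<alpha>2: "(\<alpha>1 has_real_derivative \<alpha>2) (at x)"
    and V1: "\<And>u. ((\<lambda>u. (k u - c) *\<^sub>R unit_normal \<gamma> u + \<alpha> u *\<^sub>R T u) has_vector_derivative V1 u) (at u)"
    and V2: "(V1 has_vector_derivative V2) (at x)"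
    and crit: "k1 x = 0"
  shows "Im (cnj (V1 x) * p' x + cnj (p x) * V2) / \<sigma> x ^ 3 - 3 * k x * Re (cnj (p x) * V1 x) / (\<sigma> x)\<^sup>2
    = k2 / (\<sigma> x)\<^sup>2 + k x * (k x * (k x - c))"
proof -
  \<comment> \<open>Differentiation in the moving frame: \<open>a\<close> and \<open>b\<close> are
    the normal and the tangential coordinate, and the rotation of the frame couples them at the rate
    \<sigma> k.\<close>
  have rot: "((\<lambda>u. (\<i> * complex_of_real (a u) + complex_of_real (b u)) * T u) has_vector_derivative
      (\<i> * complex_of_real (a' + b u * \<sigma> u * k u) + complex_of_real (b' - a u * \<sigma> u * k u)) * T u) (at u)"
    if "(a has_real_derivative a') (at u)" "(b has_real_derivative b') (at u)" for a b a' b' u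
  proof -
    have "((\<lambda>u. \<i> * complex_of_real (a u) + complex_of_real (b u)) has_vector_derivative \<i> * complex_of_real a' + complex_of_real b') (at u)"
      by (intro has_vector_derivative_add has_vector_derivative_mult_right has_vector_derivative_of_real_complex that)
    from has_vector_derivative_complex_mult[OF this deriv_tangent]
    show ?thesis by (rule has_vector_derivative_eq_rhs) (simp add: algebra_simps)
  qed
  define s where "s u = Re (cnj (p u) * p' u) / \<sigma> u" for u
  have ds: "(\<sigma> has_real_derivative s u) (at u)" for u unfolding s_def by (rule deriv_speed)
  \<comment> \<open>Normal and tangential component of the derivative of the velocity. Under
    \<open>p_t = V_u\<close> the tangent turns in time at the rate
    \<open>\<omega> / \<sigma>\<close>, and the speed grows at the rate \<mu>.\<close>
  define \<omega> where "\<omega> u = k1 u + \<alpha> u * \<sigma> u * k u" for u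
  define \<mu> where "\<mu> u = \<alpha>1 u - (k u - c) * \<sigma> u * k u" for u
  have V1_eq: "V1 = (\<lambda>u. (\<i> * complex_of_real (\<omega> u) + complex_of_real (\<mu> u)) * T u)"
  proof
    fix u
    have "((\<lambda>u. k u - c) has_real_derivative k1 u) (at u)" using k1[of u] by (auto intro!: derivative_eq_intros)
    from rot[OF this \<alpha>1[of u]]
    have "((\<lambda>u. (k u - c) *\<^sub>R unit_normal \<gamma> u + \<alpha> u *\<^sub>R T u) has_vector_derivative
       (\<i> * complex_of_real (\<omega> u) + complex_of_real (\<mu> u)) * T u) (at u)"
      unfolding \<omega>_def \<mu>_def
      by (simp add: unit_normal_def scaleR_conv_of_real algebra_simps)
    then show "V1 u = (\<i> * complex_of_real (\<omega> u) + complex_of_real (\<mu> u)) * T u"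
      using V1[of u] vector_derivative_unique_at by blast
  qed
  define \<omega>' where "\<omega>' = k2 + \<alpha>1 x * \<sigma> x * k x + \<alpha> x * s x * k x"
  have d\<omega>: "(\<omega> has_real_derivative \<omega>') (at x)"
    unfolding \<omega>_def[abs_def] \<omega>'_def
    by (rule derivative_eq_intros k1 k2 \<alpha>1 ds refl)+ (simp add: crit algebra_simps)
  \<comment> \<open>Only the normal component of \<open>V2\<close> reaches the curvature, so the
    value of this derivative never has to be computed.\<close>
  obtain \<mu>' where d\<mu>: "(\<mu> has_real_derivative \<mu>') (at x)"
  proof -
    have "\<exists>m. (\<mu> has_real_derivative m) (at x)"
      unfolding \<mu>_def[abs_def] by (rule exI) (rule derivative_intros k1 \<alpha>2 ds)+
    then show ?thesis using that by blast
  qed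
  have V2_eq: "V2 = (\<i> * complex_of_real (\<omega>' + \<mu> x * \<sigma> x * k x) + complex_of_real (\<mu>' - \<omega> x * \<sigma> x * k x)) * T x"
    using vector_derivative_unique_at[OF V2[unfolded V1_eq] rot[OF d\<omega> d\<mu>]] .
  have p'_x: "p' x = (complex_of_real (s x) + \<i> * complex_of_real (k x * (\<sigma> x)\<^sup>2)) * T x"
    using p'_eq[of x] by (simp add: s_def mult.assoc)
  have TT: "cnj (a * T x) * (b * T x) = cnj a * b" for a b
  proof -
    have "cnj (a * T x) * (b * T x) = cnj a * b * (cnj (T x) * T x)" by (simp add: mult_ac)
    then show ?thesis by simp
  qed
  have e1: "Im (cnj (V1 x) * p' x) = \<mu> x * (k x * (\<sigma> x)\<^sup>2) - \<omega> x * s x"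
    unfolding V1_eq p'_x TT by simp
  have e2: "Im (cnj (p x) * V2) = \<sigma> x * (\<omega>' + \<mu> x * \<sigma> x * k x)"
    unfolding V2_eq p_eq[of x] TT by simp
  have e3: "Re (cnj (p x) * V1 x) = \<sigma> x * \<mu> x"
    unfolding V1_eq p_eq[of x] TT by simp
  have \<omega>_x: "\<omega> x = \<alpha> x * \<sigma> x * k x" by (simp add: \<omega>_def crit)
  have \<mu>_x: "\<alpha>1 x = \<mu> x + (k x - c) * \<sigma> x * k x" by (simp add: \<mu>_def)
  have key: "Im (cnj (V1 x) * p' x + cnj (p x) * V2)
      = \<sigma> x * k2 + 3 * \<mu> x * k x * (\<sigma> x)\<^sup>2 + (k x - c) * (k x)\<^sup>2 * (\<sigma> x)^3"
    unfolding plus_complex.sel e1 e2 \<omega>_x \<omega>'_def \<mu>_x by (simp add: algebra_simps power2_eq_square power3_eq_cube)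
  show ?thesis
    unfolding e3 key by (simp add: field_simps power2_eq_square power3_eq_cube)
qed

end

section \<open>The flow\<close>

locale isoperimetric_flow =
  fixes T :: ereal and \<Gamma> :: "real \<Rightarrow> real \<Rightarrow> complex" and \<alpha> :: "real \<Rightarrow> real \<Rightarrow> real"
  assumes smooth_family: "smooth_on (time_interval T \<times> UNIV) (\<lambda>(t, u). \<Gamma> t u)"
    and curves: "\<And>t. t \<in> time_interval T \<Longrightarrow> embedded_closed_curve (\<Gamma> t)"
    and smooth_tangential: "smooth_on (time_interval T \<times> UNIV) (\<lambda>(t, u). \<alpha> t u)"
    and periodic_tangential: "\<And>t u. t \<in> time_interval T \<Longrightarrow> \<alpha> t (u + 1) = \<alpha> t u"
    and evolution: "\<And>t u. t \<in> time_interval T \<Longrightarrow>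
      ((\<lambda>\<tau>. \<Gamma> \<tau> u) has_vector_derivative
        (flow_velocity (\<Gamma> t) u *\<^sub>R unit_normal (\<Gamma> t) u + \<alpha> t u *\<^sub>R tangent (\<Gamma> t) u))
        (at t within time_interval T)"
begin

abbreviation "I \<equiv> time_interval T"
abbreviation "L t \<equiv> curve_length (\<Gamma> t)"
abbreviation "A t \<equiv> enclosed_area (\<Gamma> t)"
definition "V t u = flow_velocity (\<Gamma> t) u *\<^sub>R unit_normal (\<Gamma> t) u + \<alpha> t u *\<^sub>R tangent (\<Gamma> t) u"
definition "Vu t u = vector_derivative (V t) (at u)"
definition "Vuu t u = vector_derivative (Vu t) (at u)"
definition "P t u = vector_derivative (\<Gamma> t) (at u)"
definition "Pu t u = vector_derivative (P t) (at u)"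

lemma jordan: "t \<in> I \<Longrightarrow> jordan_curve (\<Gamma> t)"
  using curves by unfold_locales

lemma regular: "t \<in> I \<Longrightarrow> regular_curve (\<Gamma> t)"
proof -
  assume "t \<in> I"
  then interpret jordan_curve "\<Gamma> t" by (rule jordan)
  show ?thesis by (rule regular_curve_axioms)
qed

lemma P_eq: "t \<in> I \<Longrightarrow> regular_curve.p (\<Gamma> t) = P t"
  by (simp add: fun_eq_iff regular_curve.p_def[OF regular] P_def)

lemma Pu_eq: "t \<in> I \<Longrightarrow> regular_curve.p' (\<Gamma> t) = Pu t"
  by (simp add: fun_eq_iff regular_curve.p'_def[OF regular] Pu_def P_eq)

text \<open>The velocity contains the nonlocal quantities length and area, whose regularity in time
  is still open here. Being the time derivative of the smooth family, it is smooth
  nevertheless.\<close>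

lemma smooth_V: "smooth_on (I \<times> UNIV) (\<lambda>(t, u). V t u)"
  by (rule smooth_on_time_derivative[OF smooth_family time_interval_nontrivial])
    (use evolution in \<open>simp_all add: V_def\<close>)

lemma deriv_V: "t \<in> I \<Longrightarrow> (V t has_vector_derivative Vu t u) (at u)"
  and smooth_Vu: "smooth_on (I \<times> UNIV) (\<lambda>(t, u). Vu t u)"
  using smooth_on_space_derivative[OF smooth_V] by (simp_all add: Vu_def)

lemma deriv_Vu: "t \<in> I \<Longrightarrow> (Vu t has_vector_derivative Vuu t u) (at u)"
  and smooth_Vuu: "smooth_on (I \<times> UNIV) (\<lambda>(t, u). Vuu t u)"
  using smooth_on_space_derivative[OF smooth_Vu] by (simp_all add: Vuu_def)

lemma deriv_\<Gamma>: "t \<in> I \<Longrightarrow> (\<Gamma> t has_vector_derivative P t u) (at u)"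
  and smooth_P: "smooth_on (I \<times> UNIV) (\<lambda>(t, u). P t u)"
  using smooth_on_space_derivative[OF smooth_family] by (simp_all add: P_def)

lemma deriv_P: "t \<in> I \<Longrightarrow> (P t has_vector_derivative Pu t u) (at u)"
  and smooth_Pu: "smooth_on (I \<times> UNIV) (\<lambda>(t, u). Pu t u)"
  using smooth_on_space_derivative[OF smooth_P] by (simp_all add: Pu_def)

lemma continuous_joint:
  assumes "smooth_on (I \<times> UNIV) (\<lambda>(t, u). f t u)" "continuous_on S a" "continuous_on S b" "\<And>z. z \<in> S \<Longrightarrow> a z \<in> I"
  shows "continuous_on S (\<lambda>z. f (a z) (b z))"
  using continuous_on_compose2[OF smooth_on_continuous_on[OF assms(1)] continuous_on_Pair[OF assms(2,3)]] assms(4)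
  by auto

lemmas joint_intros = continuous_joint[OF smooth_family] continuous_joint[OF smooth_V] continuous_joint[OF smooth_Vu]
  continuous_joint[OF smooth_Vuu] continuous_joint[OF smooth_P] continuous_joint[OF smooth_Pu]
  continuous_joint[OF smooth_tangential]

lemma time_deriv_\<Gamma>: "t \<in> I \<Longrightarrow> ((\<lambda>\<tau>. \<Gamma> \<tau> u) has_vector_derivative V t u) (at t within I)"
  using evolution by (simp add: V_def)

lemma time_deriv_P: "t \<in> I \<Longrightarrow> ((\<lambda>\<tau>. P \<tau> u) has_vector_derivative Vu t u) (at t within I)"
  by (rule mixed_partials[OF time_deriv_\<Gamma> deriv_\<Gamma> deriv_V smooth_on_continuous_on[OF smooth_V]
        smooth_on_continuous_on[OF smooth_Vu]])

lemma time_deriv_Pu: "t \<in> I \<Longrightarrow> ((\<lambda>\<tau>. Pu \<tau> u) has_vector_derivative Vuu t u) (at t within I)"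
  by (rule mixed_partials[OF time_deriv_P deriv_P deriv_Vu smooth_on_continuous_on[OF smooth_Vu]
        smooth_on_continuous_on[OF smooth_Vuu]])

lemma P_nz: "t \<in> I \<Longrightarrow> P t u \<noteq> 0"
  using regular_curve.regular[OF regular] by (simp add: P_def)

lemma speed_P: "speed (\<Gamma> t) = (\<lambda>u. norm (P t u))" by (simp add: fun_eq_iff speed_def P_def)

lemma curvature_P: "t \<in> I \<Longrightarrow> curvature (\<Gamma> t) u = Im (cnj (P t u) * Pu t u) / norm (P t u) ^ 3"
  using regular_curve.curvature_eq[OF regular] by (simp add: P_eq Pu_eq speed_P)

lemma V_periodic: "t \<in> I \<Longrightarrow> V t (u + 1) = V t u"
  using regular_curve.tangent_periodic[OF regular] regular_curve.curvature_periodic[OF regular] periodic_tangential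
  by (simp add: V_def flow_velocity_def unit_normal_def)

lemma V_eq: "V t u = (\<i> * flow_velocity (\<Gamma> t) u + \<alpha> t u) * tangent (\<Gamma> t) u"
  by (simp add: V_def unit_normal_def scaleR_conv_of_real algebra_simps)

text \<open>The rotation index enters here: it evaluates the terms linear in \<open>k\<close>, so
  that the first variations of area and length are explicit up to the integral of the squared
  curvature.\<close>

lemma velocity_integrals:
  assumes t: "t \<in> I"
  defines "\<beta> \<equiv> flow_velocity (\<Gamma> t)" and "k \<equiv> curvature (\<Gamma> t)" and "\<sigma> \<equiv> speed (\<Gamma> t)"
  shows "((\<lambda>u. \<beta> u * \<sigma> u) has_integral 2 * pi - (L t)\<^sup>2 / (2 * A t)) {0..1}"
    and "((\<lambda>u. k u * \<beta> u * \<sigma> u) has_integral integral {0..1} (\<lambda>u. (k u)\<^sup>2 * \<sigma> u) - pi * L t / A t) {0..1}"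
proof -
  interpret jordan_curve "\<Gamma> t" by (rule jordan[OF t])
  have Li: "(\<sigma> has_integral L t) {0..1}"
    unfolding \<sigma>_def curve_length_def by (intro integrable_integral integrable_continuous_real cont_speed)
  have K: "((\<lambda>u. k u * \<sigma> u) has_integral 2 * pi) {0..1}" unfolding k_def \<sigma>_def by (rule total_curvature)
  have K2: "((\<lambda>u. (k u)\<^sup>2 * \<sigma> u) has_integral integral {0..1} (\<lambda>u. (k u)\<^sup>2 * \<sigma> u)) {0..1}"
    unfolding \<sigma>_def k_def by (intro integrable_integral integrable_continuous_real continuous_intros cont_speed cont_curvature)
  have \<beta>: "\<beta> u = k u - L t / (2 * A t)" for u by (simp add: \<beta>_def k_def flow_velocity_def)
  have "((\<lambda>u. k u * \<sigma> u - L t / (2 * A t) * \<sigma> u) has_integral 2 * pi - L t / (2 * A t) * L t) {0..1}"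
    by (intro has_integral_diff has_integral_mult_right K Li)
  then show "((\<lambda>u. \<beta> u * \<sigma> u) has_integral 2 * pi - (L t)\<^sup>2 / (2 * A t)) {0..1}"
    by (simp add: \<beta> left_diff_distrib power2_eq_square)
  have "((\<lambda>u. (k u)\<^sup>2 * \<sigma> u - L t / (2 * A t) * (k u * \<sigma> u)) has_integral
      integral {0..1} (\<lambda>u. (k u)\<^sup>2 * \<sigma> u) - L t / (2 * A t) * (2 * pi)) {0..1}"
    by (intro has_integral_diff has_integral_mult_right K K2)
  then show "((\<lambda>u. k u * \<beta> u * \<sigma> u) has_integral integral {0..1} (\<lambda>u. (k u)\<^sup>2 * \<sigma> u) - pi * L t / A t) {0..1}"
    by (simp add: \<beta> algebra_simps power2_eq_square)
qed

lemma area_derivative: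
  assumes t: "t \<in> I"
  shows "(A has_real_derivative (L t)\<^sup>2 / (2 * A t) - 2 * pi) (at t within I)"
proof -
  interpret jordan_curve "\<Gamma> t" by (rule jordan[OF t])
  define E where "E \<tau> u = Im (V \<tau> u) * Re (P \<tau> u) + Im (\<Gamma> \<tau> u) * Re (Vu \<tau> u)" for \<tau> u
  have "((\<lambda>\<tau>. integral (cbox 0 1) (\<lambda>u. Im (\<Gamma> \<tau> u) * Re (P \<tau> u))) has_real_derivative integral (cbox 0 1) (E t)) (at t within I)"
  proof (rule leibniz_rule_field_derivative[OF _ _ _ t time_interval_convex])
    fix \<tau> u assume \<tau>: "\<tau> \<in> I"
    show "((\<lambda>\<tau>. Im (\<Gamma> \<tau> u) * Re (P \<tau> u)) has_real_derivative E \<tau> u) (at \<tau> within I)"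
      unfolding E_def
      by (rule DERIV_cong[OF DERIV_mult[OF has_vector_derivative_Im[OF time_deriv_\<Gamma>[OF \<tau>]] has_vector_derivative_Re[OF time_deriv_P[OF \<tau>]]]])
        (simp add: algebra_simps)
  next
    fix \<tau> assume \<tau>: "\<tau> \<in> I"
    show "(\<lambda>u. Im (\<Gamma> \<tau> u) * Re (P \<tau> u)) integrable_on cbox 0 1"
      by (intro integrable_continuous continuous_intros joint_intros) (use \<tau> in auto)
  next
    show "continuous_on (I \<times> cbox 0 1) (\<lambda>(\<tau>, u). E \<tau> u)"
      unfolding E_def split_beta by (intro continuous_intros joint_intros) auto
  qed
  then have D: "((\<lambda>\<tau>. - integral {0..1} (\<lambda>u. Im (\<Gamma> \<tau> u) * Re (P \<tau> u))) has_real_derivative - integral {0..1} (E t)) (at t within I)"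
    by (intro DERIV_minus) simp
  have A_eq: "A \<tau> = - integral {0..1} (\<lambda>u. Im (\<Gamma> \<tau> u) * Re (P \<tau> u))" if "\<tau> \<in> I" for \<tau>
    using jordan_curve.enclosed_area_eq[OF jordan[OF that]] by (simp add: P_eq[OF that])
  \<comment> \<open>A periodic function whose derivative is \<open>E\<close> minus the normal flux,
    so the two have the same integral. The tangential velocity contributes no flux since
    \<open>cnj T * T\<close> is real.\<close>
  have "((\<lambda>u. Im (\<Gamma> t u) * Re (V t u)) has_real_derivative
      E t u - flow_velocity (\<Gamma> t) u * speed (\<Gamma> t) u) (at u)" for u
  proof -
    have "cnj (V t u) * P t u = (cnj (\<i> * flow_velocity (\<Gamma> t) u + \<alpha> t u) * speed (\<Gamma> t) u) * (cnj (tangent (\<Gamma> t) u) * tangent (\<Gamma> t) u)"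
      unfolding V_eq using p_eq[of u] by (simp add: P_eq[OF t] mult_ac)
    then have "Im (cnj (V t u) * P t u) = - flow_velocity (\<Gamma> t) u * speed (\<Gamma> t) u" by simp
    then have "E t u - flow_velocity (\<Gamma> t) u * speed (\<Gamma> t) u = Im (P t u) * Re (V t u) + Im (\<Gamma> t u) * Re (Vu t u)"
      by (simp add: E_def algebra_simps)
    with DERIV_mult[OF has_vector_derivative_Im[OF deriv_\<Gamma>[OF t, of u]] has_vector_derivative_Re[OF deriv_V[OF t, of u]]]
    show ?thesis by (simp add: mult.commute)
  qed
  from integral_by_parts_periodic[OF this] have "((\<lambda>u. E t u - flow_velocity (\<Gamma> t) u * speed (\<Gamma> t) u) has_integral 0) {0..1}"
    using V_periodic[OF t, of 0] periodic[of 0] by simp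
  from has_integral_add[OF this velocity_integrals(1)[OF t]]
  have "integral {0..1} (E t) = 2 * pi - (L t)\<^sup>2 / (2 * A t)" by (simp add: integral_unique)
  with D show ?thesis
    by (intro DERIV_cong[OF has_field_derivative_transform_within[OF D zero_less_one t]]) (auto simp: A_eq)
qed

lemma length_derivative:
  assumes t: "t \<in> I"
  shows "(L has_real_derivative pi * L t / A t - integral {0..1} (\<lambda>u. (curvature (\<Gamma> t) u)\<^sup>2 * speed (\<Gamma> t) u)) (at t within I)"
proof -
  interpret jordan_curve "\<Gamma> t" by (rule jordan[OF t])
  define E where "E \<tau> u = Re (cnj (P \<tau> u) * Vu \<tau> u) / norm (P \<tau> u)" for \<tau> u
  have "((\<lambda>\<tau>. integral (cbox 0 1) (\<lambda>u. norm (P \<tau> u))) has_real_derivative integral (cbox 0 1) (E t)) (at t within I)"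
  proof (rule leibniz_rule_field_derivative[OF _ _ _ t time_interval_convex])
    fix \<tau> u assume \<tau>: "\<tau> \<in> I"
    show "((\<lambda>\<tau>. norm (P \<tau> u)) has_real_derivative E \<tau> u) (at \<tau> within I)"
      unfolding E_def by (rule has_vector_derivative_cmod[OF time_deriv_P[OF \<tau>] P_nz[OF \<tau>]])
  next
    fix \<tau> assume \<tau>: "\<tau> \<in> I"
    show "(\<lambda>u. norm (P \<tau> u)) integrable_on cbox 0 1"
      by (intro integrable_continuous continuous_intros joint_intros) (use \<tau> in auto)
  next
    show "continuous_on (I \<times> cbox 0 1) (\<lambda>(\<tau>, u). E \<tau> u)"
      unfolding E_def split_beta by (intro continuous_intros joint_intros) (auto simp: P_nz)
  qed
  then have D: "(L has_real_derivative integral {0..1} (E t)) (at t within I)"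
    by (simp add: curve_length_def speed_P)
  \<comment> \<open>The differentiated function is the tangential velocity \<alpha>. Being periodic,
    it leaves only \<open>- k \<beta> \<sigma>\<close> in the integral of \<open>E\<close>.\<close>
  have "((\<lambda>u. Re (cnj (tangent (\<Gamma> t) u) * V t u)) has_real_derivative
      E t u + curvature (\<Gamma> t) u * flow_velocity (\<Gamma> t) u * speed (\<Gamma> t) u) (at u)" for u
  proof -
    have d: "((\<lambda>u. cnj (tangent (\<Gamma> t) u)) has_vector_derivative cnj (\<i> * (speed (\<Gamma> t) u * curvature (\<Gamma> t) u) * tangent (\<Gamma> t) u)) (at u)"
      by (rule bounded_linear.has_vector_derivative[OF bounded_linear_cnj deriv_tangent])
    have X: "cnj (\<i> * (speed (\<Gamma> t) u * curvature (\<Gamma> t) u) * tangent (\<Gamma> t) u) * V t u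
       = (cnj (\<i> * (speed (\<Gamma> t) u * curvature (\<Gamma> t) u)) * (\<i> * flow_velocity (\<Gamma> t) u + \<alpha> t u)) * (cnj (tangent (\<Gamma> t) u) * tangent (\<Gamma> t) u)"
      unfolding V_eq by (simp only: complex_cnj_mult mult_ac)
    have 1: "Re (cnj (\<i> * (speed (\<Gamma> t) u * curvature (\<Gamma> t) u) * tangent (\<Gamma> t) u) * V t u)
       = curvature (\<Gamma> t) u * flow_velocity (\<Gamma> t) u * speed (\<Gamma> t) u" unfolding X tangent_cnj by simp
    have "P t u = complex_of_real (norm (P t u)) * tangent (\<Gamma> t) u"
      using p_eq[of u] by (simp add: P_eq[OF t] speed_P)
    from arg_cong[OF this, of cnj]
    have "cnj (P t u) * Vu t u = complex_of_real (norm (P t u)) * (cnj (tangent (\<Gamma> t) u) * Vu t u)"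
      by (simp only: complex_cnj_mult complex_cnj_complex_of_real mult.assoc)
    moreover have "Re (complex_of_real r * w) = r * Re w" for r w by simp
    ultimately have "Re (cnj (P t u) * Vu t u) = norm (P t u) * Re (cnj (tangent (\<Gamma> t) u) * Vu t u)"
      by (simp only:)
    then have 2: "Re (cnj (tangent (\<Gamma> t) u) * Vu t u) = E t u"
      using P_nz[OF t, of u] by (simp add: E_def)
    show ?thesis
      by (rule DERIV_cong[OF has_vector_derivative_Re[OF has_vector_derivative_complex_mult[OF d deriv_V[OF t]]]])
        (simp only: plus_complex.sel 1 2 add.commute)
  qed
  from integral_by_parts_periodic[OF this]
  have "((\<lambda>u. E t u + curvature (\<Gamma> t) u * flow_velocity (\<Gamma> t) u * speed (\<Gamma> t) u) has_integral 0) {0..1}"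
    using V_periodic[OF t, of 0] tangent_periodic[of 0] by simp
  from has_integral_diff[OF this velocity_integrals(2)[OF t]]
  have "integral {0..1} (E t) = pi * L t / A t - integral {0..1} (\<lambda>u. (curvature (\<Gamma> t) u)\<^sup>2 * speed (\<Gamma> t) u)"
    by (simp add: integral_unique)
  with D show ?thesis by simp
qed

lemma area_nonneg_derivative:
  assumes t: "t \<in> I"
  shows "(L t)\<^sup>2 / (2 * A t) - 2 * pi \<ge> 0"
proof -
  interpret jordan_curve "\<Gamma> t" by (rule jordan[OF t])
  have "2 * pi * (2 * A t) \<le> (L t)\<^sup>2" using isoperimetric_inequality by simp
  then show ?thesis using enclosed_area_pos by (simp add: le_divide_eq)
qed

lemma length_nonpos_derivative:
  assumes t: "t \<in> I" and "convex_curve (\<Gamma> t)"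
  shows "pi * L t / A t - integral {0..1} (\<lambda>u. (curvature (\<Gamma> t) u)\<^sup>2 * speed (\<Gamma> t) u) \<le> 0"
proof -
  interpret jordan_curve "\<Gamma> t" by (rule jordan[OF t])
  show ?thesis using gage_inequality[OF assms(2)] enclosed_area_pos by (simp add: divide_le_eq mult.commute)
qed

lemma isoperimetric_ratio_derivative:
  assumes t: "t \<in> I" and nz: "\<exists>u. flow_velocity (\<Gamma> t) u \<noteq> 0"
  shows "\<exists>D. ((\<lambda>\<tau>. isoperimetric_ratio (\<Gamma> \<tau>)) has_real_derivative D) (at t within I) \<and> D < 0"
proof -
  interpret jordan_curve "\<Gamma> t" by (rule jordan[OF t])
  define \<beta> where "\<beta> = flow_velocity (\<Gamma> t)"
  define \<sigma> where "\<sigma> = speed (\<Gamma> t)"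
  define k where "k = curvature (\<Gamma> t)"
  define L' where "L' = pi * L t / A t - integral {0..1} (\<lambda>u. (k u)\<^sup>2 * \<sigma> u)"
  define A' where "A' = (L t)\<^sup>2 / (2 * A t) - 2 * pi"
  have A: "A t > 0" and L: "L t > 0" by (rule enclosed_area_pos, rule length_pos)
  have cont: "continuous_on {0..1} (\<lambda>u. (\<beta> u)\<^sup>2 * \<sigma> u)"
    unfolding \<beta>_def \<sigma>_def flow_velocity_def by (intro continuous_intros cont_curvature cont_speed)
  have "((\<lambda>u. k u * \<beta> u * \<sigma> u - L t / (2 * A t) * (\<beta> u * \<sigma> u)) has_integral - L' - L t / (2 * A t) * (- A')) {0..1}"
    using has_integral_diff[OF velocity_integrals(2)[OF t] has_integral_mult_right[OF velocity_integrals(1)[OF t], of "L t / (2 * A t)"]]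
    by (simp add: L'_def A'_def \<beta>_def \<sigma>_def k_def)
  moreover have "k u * \<beta> u * \<sigma> u - L t / (2 * A t) * (\<beta> u * \<sigma> u) = (\<beta> u)\<^sup>2 * \<sigma> u" for u
  proof -
    have "k u = \<beta> u + L t / (2 * A t)" by (simp add: \<beta>_def k_def flow_velocity_def)
    then show ?thesis by (simp add: algebra_simps power2_eq_square)
  qed
  ultimately have int: "integral {0..1} (\<lambda>u. (\<beta> u)\<^sup>2 * \<sigma> u) = - (L' - L t / (2 * A t) * A')"
    by (simp add: integral_unique)
  have "integral {0..1} (\<lambda>u. (\<beta> u)\<^sup>2 * \<sigma> u) > 0"
  proof -
    obtain u where u: "\<beta> u \<noteq> 0" using nz by (auto simp: \<beta>_def)
    \<comment> \<open>The parameter with nonzero velocity may lie in any period and has to be moved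
      into the range of integration.\<close>
    have "\<beta> (frac u) = \<beta> u" by (simp add: \<beta>_def flow_velocity_def curvature_frac)
    moreover have "frac u \<in> {0..1}" using frac_ge_0[of u] frac_lt_1[of u] by simp
    ultimately have "\<exists>v\<in>{0..1}. (\<beta> v)\<^sup>2 * \<sigma> v \<noteq> 0" using u unfolding \<sigma>_def by (intro bexI[of _ "frac u"]) auto
    then have "integral {0..1} (\<lambda>u. (\<beta> u)\<^sup>2 * \<sigma> u) \<noteq> 0"
      by (subst integral_eq_0_iff[OF cont]) (auto simp: \<sigma>_def less_imp_le)
    moreover have "integral {0..1} (\<lambda>u. (\<beta> u)\<^sup>2 * \<sigma> u) \<ge> 0"
      by (rule integral_nonneg[OF integrable_continuous_real[OF cont]]) (auto simp: \<sigma>_def less_imp_le)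
    ultimately show ?thesis by linarith
  qed
  then have neg: "L' - L t / (2 * A t) * A' < 0" using int by linarith
  have dL: "(L has_real_derivative L') (at t within I)"
    unfolding L'_def k_def \<sigma>_def by (rule length_derivative[OF t])
  have dA: "(A has_real_derivative A') (at t within I)"
    unfolding A'_def by (rule area_derivative[OF t])
  have dL2: "((\<lambda>\<tau>. (L \<tau>)\<^sup>2) has_real_derivative 2 * L t * L') (at t within I)"
    using DERIV_power[OF dL, of 2] by (simp add: mult.commute mult.left_commute)
  have "((\<lambda>\<tau>. (L \<tau>)\<^sup>2 / (4 * pi * A \<tau>)) has_real_derivative
      (2 * L t * L' * (4 * pi * A t) - (L t)\<^sup>2 * (4 * pi * A')) / ((4 * pi * A t) * (4 * pi * A t))) (at t within I)"
    using A by (intro DERIV_divide dL2 DERIV_cmult dA) auto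
  then have "((\<lambda>\<tau>. isoperimetric_ratio (\<Gamma> \<tau>)) has_real_derivative
      (2 * L t * L' * (4 * pi * A t) - (L t)\<^sup>2 * (4 * pi * A')) / ((4 * pi * A t) * (4 * pi * A t))) (at t within I)"
    by (simp only: isoperimetric_ratio_def)
  moreover have "(2 * L t * L' * (4 * pi * A t) - (L t)\<^sup>2 * (4 * pi * A')) / ((4 * pi * A t) * (4 * pi * A t))
      = L t / (2 * pi * A t) * (L' - L t / (2 * A t) * A')"
    using A by (simp add: field_simps power2_eq_square)
  moreover have "L t / (2 * pi * A t) * (L' - L t / (2 * A t) * A') < 0"
    using neg A L by (intro mult_pos_neg) auto
  ultimately show ?thesis by auto
qed

section \<open>Maximum principle for the curvature\<close>

abbreviation "K t u \<equiv> curvature (\<Gamma> t) u"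

lemma K_frac: "t \<in> I \<Longrightarrow> K t (frac u) = K t u"
  by (rule regular_curve.curvature_frac[OF regular])

lemma continuous_K:
  assumes "continuous_on S a" "continuous_on S b" "\<And>z. z \<in> S \<Longrightarrow> a z \<in> I"
  shows "continuous_on S (\<lambda>z. K (a z) (b z))"
proof -
  have "continuous_on S (\<lambda>z. Im (cnj (P (a z) (b z)) * Pu (a z) (b z)) / norm (P (a z) (b z)) ^ 3)"
    by (intro continuous_intros joint_intros assms) (use assms(3) P_nz in auto)
  then show ?thesis
    by (rule continuous_on_eq) (simp add: curvature_P assms(3))
qed

text \<open>At a spatial minimum the first order terms of the curvature equation vanish, the one
  with \<alpha> included, and the second order term survives as the nonnegative \<open>q\<close>.
  The rest is written with a factor \<open>K t u\<close> in front, which makes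
  \<open>k \<beta>\<close> a zeroth order coefficient.\<close>

lemma curvature_time_derivative:
  assumes t: "t \<in> I" and min: "\<And>v. K t u \<le> K t v"
  obtains q where "((\<lambda>\<tau>. K \<tau> u) has_real_derivative q + K t u * (K t u * flow_velocity (\<Gamma> t) u)) (at t within I)" "q \<ge> 0"
proof -
  interpret jordan_curve "\<Gamma> t" by (rule jordan[OF t])
  obtain k1 k2 where k: "\<And>u. (K t has_real_derivative k1 u) (at u)" "\<And>u. (k1 has_real_derivative k2 u) (at u)"
    by (rule curvature_twice_differentiable) (rule that)
  note crit = second_derivative_at_min[OF k(1) k(2) min]
  define \<alpha>1 where "\<alpha>1 v = vector_derivative (\<alpha> t) (at v)" for v
  have s1: "smooth_on (I \<times> UNIV) (\<lambda>(t, u). vector_derivative (\<alpha> t) (at u))"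
    using smooth_on_space_derivative(1)[OF smooth_tangential] by simp
  have \<alpha>1: "(\<alpha> t has_real_derivative \<alpha>1 v) (at v)" for v
    using smooth_on_space_derivative(2)[OF smooth_tangential t]
    by (simp add: \<alpha>1_def has_real_derivative_iff_has_vector_derivative)
  have \<alpha>2: "(\<alpha>1 has_real_derivative vector_derivative \<alpha>1 (at u)) (at u)"
    using smooth_on_space_derivative(2)[OF s1 t]
    by (simp add: \<alpha>1_def[abs_def] has_real_derivative_iff_has_vector_derivative)
  define c where "c = L t / (2 * A t)"
  have V_c: "V t = (\<lambda>u. (K t u - c) *\<^sub>R unit_normal (\<Gamma> t) u + \<alpha> t u *\<^sub>R tangent (\<Gamma> t) u)"
    by (simp add: fun_eq_iff V_def flow_velocity_def c_def)
  have evol: "Im (cnj (Vu t u) * Pu t u + cnj (P t u) * Vuu t u) / norm (P t u) ^ 3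
      - 3 * K t u * Re (cnj (P t u) * Vu t u) / (norm (P t u))\<^sup>2
    = k2 u / (norm (P t u))\<^sup>2 + K t u * (K t u * (K t u - c))"
    using curvature_evolution[OF k(1) k(2) \<alpha>1 \<alpha>2 deriv_V[OF t, unfolded V_c] deriv_Vu[OF t] crit(1)]
    by (simp only: P_eq[OF t] Pu_eq[OF t] speed_P)
  have dc: "((\<lambda>\<tau>. cnj (P \<tau> u)) has_vector_derivative cnj (Vu t u)) (at t within I)"
    by (rule bounded_linear.has_vector_derivative[OF bounded_linear_cnj time_deriv_P[OF t]])
  have dn: "((\<lambda>\<tau>. Im (cnj (P \<tau> u) * Pu \<tau> u)) has_real_derivative Im (cnj (Vu t u) * Pu t u + cnj (P t u) * Vuu t u)) (at t within I)"
    by (rule has_vector_derivative_Im[OF has_vector_derivative_complex_mult[OF dc time_deriv_Pu[OF t]]])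
  have "((\<lambda>\<tau>. norm (P \<tau> u)) has_real_derivative Re (cnj (P t u) * Vu t u) / norm (P t u)) (at t within I)"
    by (rule has_vector_derivative_cmod[OF time_deriv_P[OF t] P_nz[OF t]])
  from DERIV_power[OF this, of 3]
  have dp: "((\<lambda>\<tau>. norm (P \<tau> u) ^ 3) has_real_derivative 3 * (norm (P t u) * Re (cnj (P t u) * Vu t u))) (at t within I)"
    using P_nz[OF t, of u] by (simp add: power2_eq_square mult.commute)
  have nz: "norm (P t u) \<noteq> 0" using P_nz[OF t] by simp
  have quot: "(N' * s ^ 3 - N * (3 * (s * r))) / (s ^ 3 * s ^ 3) = N' / s ^ 3 - 3 * (N / s ^ 3) * r / s\<^sup>2"
    if "s \<noteq> 0" for N' N s r :: real
    using that by (simp add: field_simps power2_eq_square power3_eq_cube)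
  have "((\<lambda>\<tau>. Im (cnj (P \<tau> u) * Pu \<tau> u) / norm (P \<tau> u) ^ 3) has_real_derivative
      Im (cnj (Vu t u) * Pu t u + cnj (P t u) * Vuu t u) / norm (P t u) ^ 3
      - 3 * K t u * Re (cnj (P t u) * Vu t u) / (norm (P t u))\<^sup>2) (at t within I)"
    unfolding curvature_P[OF t] quot[OF nz, symmetric]
    using nz by (intro DERIV_divide dn dp) simp
  then have "((\<lambda>\<tau>. K \<tau> u) has_real_derivative k2 u / (norm (P t u))\<^sup>2 + K t u * (K t u * (K t u - c))) (at t within I)"
    unfolding evol
    by (rule has_field_derivative_transform_within[OF _ zero_less_one t]) (simp add: curvature_P)
  then show ?thesis
    using crit(2) by (intro that[of "k2 u / (norm (P t u))\<^sup>2"]) (auto simp: flow_velocity_def c_def)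
qed

text \<open>Maximum principle: if \<open>r\<close> exceeds the zeroth order coefficient in absolute value, then
  \<open>exp (r (t - t0)) k\<close> cannot decrease to half of its initial minimum, since at the first time when
  this happens its time derivative at the spatial minimum is positive.\<close>
lemma convexity_preserved:
  assumes t0: "t0 \<in> I" and convex: "convex_curve (\<Gamma> t0)" and t1: "t1 \<in> I" and le: "t0 \<le> t1"
  shows "convex_curve (\<Gamma> t1)"
proof (rule ccontr)
  assume "\<not> convex_curve (\<Gamma> t1)"
  then obtain u1 where "K t1 u1 \<le> 0" by (auto simp: convex_curve_def not_less)
  then have u1: "K t1 (frac u1) \<le> 0" "frac u1 \<in> {0..1}"
    using K_frac[OF t1] frac_ge_0[of u1] frac_lt_1[of u1] by auto
  have t0_nonneg: "0 \<le> t0" using t0 by (simp add: time_interval_def)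
  have sub: "t \<in> I" if "t \<in> {t0..t1}" for t
    using time_interval_down[OF t1, of t] that t0_nonneg by auto
  define R where "R = {t0..t1} \<times> {0..1::real}"
  have R: "compact R" unfolding R_def by (intro compact_Times) auto
  \<comment> \<open>The zeroth order coefficient of the curvature equation. Length and area enter it
    continuously, so it is bounded on the compact rectangle.\<close>
  define Q where "Q z = K (fst z) (snd z) * flow_velocity (\<Gamma> (fst z)) (snd z)" for z
  have contA: "continuous_on I A" by (rule DERIV_continuous_on) (rule area_derivative)
  have contL: "continuous_on I L" by (rule DERIV_continuous_on) (rule length_derivative)
  have contR: "continuous_on R (\<lambda>z. K (fst z) (snd z))"
    by (intro continuous_K continuous_intros) (auto simp: R_def sub)
  have "continuous_on R (\<lambda>z. L (fst z))" "continuous_on R (\<lambda>z. A (fst z))"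
    by (rule continuous_on_compose2[OF contL] continuous_on_compose2[OF contA]; auto intro!: continuous_intros simp: R_def sub)+
  then have "continuous_on R Q"
    unfolding Q_def flow_velocity_def
    using jordan_curve.enclosed_area_pos[OF jordan] sub
    by (intro continuous_intros contR) (force simp: R_def)+
  then have "bounded (Q ` R)" using R by (intro compact_imp_bounded compact_continuous_image)
  then obtain M where "\<forall>x\<in>Q ` R. norm x \<le> M" unfolding bounded_iff by blast
  then have M: "\<bar>Q z\<bar> \<le> M" if "z \<in> R" for z using that by auto
  define r where "r = M + 1"
  have "continuous_on {0..1} (K t0)" using continuous_K[of "{0..1}" "\<lambda>_. t0" "\<lambda>u. u"] t0 by simp
  from continuous_attains_inf[OF compact_Icc _ this]
  obtain um where "\<forall>u\<in>{0..1}. K t0 um \<le> K t0 u" by auto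
  then have um: "\<And>u. u \<in> {0..1} \<Longrightarrow> K t0 um \<le> K t0 u" by blast
  define m where "m = K t0 um / 2"
  have m: "m > 0" using convex by (simp add: m_def convex_curve_def)
  define w where "w z = exp (r * (fst z - t0)) * K (fst z) (snd z) - m" for z
  have w0: "w (t0, u) > 0" if "u \<in> {0..1}" for u
    using um[OF that] m by (simp add: w_def m_def)
  have contw: "continuous_on R w"
    unfolding w_def[abs_def] by (intro continuous_intros contR)
  \<comment> \<open>Minimizing \<open>fst\<close> over this compact set yields the first time at
    which \<open>w\<close> fails to be positive, together with a parameter where this
    happens.\<close>
  define Z where "Z = R \<inter> w -` {..0}"
  have "closed Z" unfolding Z_def
    by (rule continuous_closed_preimage[OF contw compact_imp_closed[OF R] closed_atMost])
  moreover have "R \<inter> Z = Z" by (auto simp: Z_def)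
  ultimately have "compact Z" using compact_Int_closed[OF R, of Z] by simp
  moreover have "(t1, frac u1) \<in> Z"
    using u1 le m mult_nonneg_nonpos[of "exp (r * (t1 - t0))" "K t1 (frac u1)"] by (auto simp: Z_def R_def w_def)
  then have "Z \<noteq> {}" by blast
  ultimately obtain z where z: "z \<in> Z" "\<And>y. y \<in> Z \<Longrightarrow> fst z \<le> fst y"
    using continuous_attains_inf[of Z fst, OF _ _ continuous_on_fst[OF continuous_on_id]] by blast
  define \<tau> where "\<tau> = fst z"
  define u where "u = snd z"
  have \<tau>: "\<tau> \<in> {t0..t1}" "u \<in> {0..1}" "w (\<tau>, u) \<le> 0"
    using z(1) by (auto simp: Z_def R_def \<tau>_def u_def)
  have \<tau>I: "\<tau> \<in> I" by (rule sub[OF \<tau>(1)])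
  have before: "w (t, v) > 0" if "t0 \<le> t" "t < \<tau>" "v \<in> {0..1}" for t v
  proof (rule ccontr)
    assume "\<not> w (t, v) > 0"
    then have "(t, v) \<in> Z" using that \<tau> by (auto simp: Z_def R_def)
    from z(2)[OF this] show False using that by (simp add: \<tau>_def)
  qed
  have "\<tau> \<noteq> t0" using w0[OF \<tau>(2)] \<tau>(3) by auto
  then have gt: "t0 < \<tau>" using \<tau>(1) by auto
  \<comment> \<open>A negative value at time \<tau> would force an earlier zero at the same
    parameter. Hence \<open>u\<close> is a minimum of the curvature at that time, over all
    parameters by periodicity.\<close>
  have at: "w (\<tau>, v) \<ge> 0" if v: "v \<in> {0..1}" for v
  proof (rule ccontr)
    assume neg: "\<not> w (\<tau>, v) \<ge> 0"
    have "continuous_on {t0..\<tau>} (\<lambda>t. w (t, v))"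
      by (rule continuous_on_compose2[OF contw]) (use v \<tau> in \<open>auto intro!: continuous_intros simp: R_def\<close>)
    from IVT2'[OF _ _ _ this, of 0] neg w0[OF v] gt
    obtain t where t: "t0 \<le> t" "t \<le> \<tau>" "w (t, v) = 0" by auto
    with neg have "t < \<tau>" by (cases "t = \<tau>") auto
    from before[OF t(1) this v] t(3) show False by simp
  qed
  have w\<tau>: "w (\<tau>, u) = 0" using at[OF \<tau>(2)] \<tau>(3) by simp
  then have "exp (r * (\<tau> - t0)) * K \<tau> u > 0" using m by (simp add: w_def)
  then have K_pos: "K \<tau> u > 0" by (simp add: zero_less_mult_iff)
  have "K \<tau> u \<le> K \<tau> v" for v
  proof -
    have "frac v \<in> {0..1}" using frac_ge_0[of v] frac_lt_1[of v] by simp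
    from at[OF this] w\<tau> have "exp (r * (\<tau> - t0)) * K \<tau> u \<le> exp (r * (\<tau> - t0)) * K \<tau> (frac v)"
      by (simp add: w_def)
    then show ?thesis using K_frac[OF \<tau>I] by simp
  qed
  from curvature_time_derivative[OF \<tau>I this] obtain q where
    q: "((\<lambda>t. K t u) has_real_derivative q + K \<tau> u * (K \<tau> u * flow_velocity (\<Gamma> \<tau>) u)) (at \<tau> within I)" "q \<ge> 0" .
  have "((\<lambda>t. exp (r * (t - t0))) has_real_derivative exp (r * (\<tau> - t0)) * r) (at \<tau> within I)"
    by (auto intro!: derivative_eq_intros)
  from DERIV_diff[OF DERIV_mult[OF this q(1)] DERIV_const[of m]]
  have dw: "((\<lambda>t. w (t, u)) has_real_derivative
      exp (r * (\<tau> - t0)) * (q + K \<tau> u * (Q (\<tau>, u) + r))) (at \<tau> within I)"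
    unfolding w_def fst_conv snd_conv by (rule DERIV_cong) (simp add: Q_def algebra_simps)
  have "Q (\<tau>, u) + r > 0" using M[of "(\<tau>, u)"] \<tau> by (simp add: r_def R_def abs_le_iff)
  then have "exp (r * (\<tau> - t0)) * (q + K \<tau> u * (Q (\<tau>, u) + r)) > 0"
    using K_pos q(2) by (simp add: add_nonneg_pos)
  from has_real_derivative_pos_inc_left[OF dw this]
  obtain d where d: "d > 0" "\<And>h. h > 0 \<Longrightarrow> \<tau> - h \<in> I \<Longrightarrow> h < d \<Longrightarrow> w (\<tau> - h, u) < w (\<tau>, u)" by blast
  \<comment> \<open>The step back in time is cut off at \<open>t0\<close>, so that it ends where
    \<open>w\<close> is already known to be positive.\<close>
  define h where "h = min (d / 2) (\<tau> - t0)"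
  have h: "h > 0" "h < d" "t0 \<le> \<tau> - h" "\<tau> - h < \<tau>" using d(1) gt by (auto simp: h_def)
  have "\<tau> - h \<in> I" using h \<tau>(1) by (intro sub) auto
  from d(2)[OF h(1) this h(2)] before[OF h(3,4) \<tau>(2)] w\<tau> show False by simp
qed

end

theorem proposition2:
  fixes T :: ereal
    and \<Gamma> :: "real \<Rightarrow> real \<Rightarrow> complex"
    and \<alpha> :: "real \<Rightarrow> real \<Rightarrow> real"
  assumes T_pos: "T > 0"
    and smooth_family: "smooth_on (time_interval T \<times> UNIV) (\<lambda>(t, u). \<Gamma> t u)"
    and curves: "\<And>t. t \<in> time_interval T \<Longrightarrow> embedded_closed_curve (\<Gamma> t)"
    and smooth_tangential: "smooth_on (time_interval T \<times> UNIV) (\<lambda>(t, u). \<alpha> t u)"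
    and periodic_tangential: "\<And>t u. t \<in> time_interval T \<Longrightarrow> \<alpha> t (u + 1) = \<alpha> t u"
    and evolution: "\<And>t u. t \<in> time_interval T \<Longrightarrow>
      ((\<lambda>\<tau>. \<Gamma> \<tau> u) has_vector_derivative
        (flow_velocity (\<Gamma> t) u *\<^sub>R unit_normal (\<Gamma> t) u + \<alpha> t u *\<^sub>R tangent (\<Gamma> t) u))
        (at t within time_interval T)"
  shows
    "(\<forall>t\<in>time_interval T. (\<exists>u. flow_velocity (\<Gamma> t) u \<noteq> 0) \<longrightarrow>
        (\<exists>D. ((\<lambda>\<tau>. isoperimetric_ratio (\<Gamma> \<tau>)) has_real_derivative D) (at t within time_interval T)
             \<and> D < 0)) \<and>
     (\<forall>t\<^sub>0\<in>time_interval T. convex_curve (\<Gamma> t\<^sub>0) \<longrightarrow>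
        (\<forall>t\<in>time_interval T. t\<^sub>0 \<le> t \<longrightarrow> convex_curve (\<Gamma> t))) \<and>
     (\<forall>t\<in>time_interval T.
        \<exists>D. ((\<lambda>\<tau>. enclosed_area (\<Gamma> \<tau>)) has_real_derivative D) (at t within time_interval T)
             \<and> D \<ge> 0) \<and>
     (\<forall>t\<in>time_interval T. convex_curve (\<Gamma> t) \<longrightarrow>
        (\<exists>D. ((\<lambda>\<tau>. curve_length (\<Gamma> \<tau>)) has_real_derivative D) (at t within time_interval T)
             \<and> D \<le> 0))"
proof -
  interpret isoperimetric_flow T \<Gamma> \<alpha>
    by unfold_locales (fact smooth_family curves smooth_tangential periodic_tangential evolution)+
  show ?thesis
    using isoperimetric_ratio_derivative convexity_preserved area_derivative area_nonneg_derivative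
      length_derivative length_nonpos_derivative by blast
qed

end
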